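(* Let $K$ be a field, let $S_1,\dots,S_n\subseteq \mathrm{S}(K)\setminus\{v_{\mathrm{trivial}}\}$ be nonempty and pairwise disjoint, $t\in K^\times$, $\underline{y}_1,\dots,\underline{y}_n\in K^m$ and $\underline{z}_1,\dots,\underline{z}_n\in(K^\times)^m$, with $\underline{y}_i=(y_{i1},\dots,y_{im})$ and $\underline{z}_i=(z_{i1},\dots,z_{im})$. Assume: (U) the exceptional uniformity assumption (defined in the context) holds for $S_1,\dots,S_n$ and $t$; (T) each $S_i$ is compact in the constructible topology; (I) the elements of $S=S_1\cup\dots\cup S_n$ are pairwise independent. Let $g_1,\dots,g_m\in K(x_1,\dots,x_l)$ be rational functions, and let $D_g\subseteq K^l$ be their common domain. Suppose that for each $i$ and each $v\in S_i$ there exists some $\underline{x}_v\in D_g$ with $g_j(\underline{x}_v)\in \mathrm{B}_v(y_{ij},z_{ij})$ for every $j$. Then there exists $\underline{x}\in D_g$ with $$g_j(\underline{x})\in \mathrm{B}_v(y_{ij},z_{ij})$$ for every $i,j$ and every $v\in S_i$.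
   Context: Localities. For a field $K$, $\mathrm{S}_{\mathrm{val}}(K)$ is the set of equivalence classes of Krull valuations (written additively), $\mathrm{S}_{\mathrm{ord}}(K)$ the set of orderings, $\mathrm{S}_{\mathrm{abs}}(K)$ the set of equivalence classes of absolute values. $\mathrm{S}(K)$ is their union, with rank-1 valuations and archimedean orderings identified with the associated absolute values (and the trivial absolute value with the trivial valuation $v_{\mathrm{trivial}}$); its elements are called localities. For $v\in\mathrm{S}(K)$: $\mathcal{O}_v=\{v(x)\ge0\}$, $\{-1\le_v x\le_v 1\}$, $\{|x|_v\le 1\}$ and $\mathfrak{m}_v=\{v(x)>0\}$, $\{-1<_v x<_v 1\}$, $\{|x|_v<1\}$, according to whether $v$ is a valuation, ordering, or absolute value. The $v$-topology on $K$ is the field topology with neighbourhood base $\{z\mathfrak{m}_v: z\in K^\times\}$ at $0$; $\mathrm{B}_v(y,z)=y+z\mathfrak{m}_v$ for $y\in K$, $z\in K^\times$. Two localities are independent if they induce distinct topologies on $K$. The constructible topology on $\mathrm{S}(K)$ has open subbasis $\{v: x\in\mathcal{O}_v\}$, $\{v: x\in\mathfrak{m}_v\}$, $x\in K$. Compact means quasi-compact. Exceptional uniformity assumption for $S_1,\dots,S_n$ and $t\in K^\times$: there exists $f\in K[X]$ of degree $d\ge2$, with leading coefficient $a_d$, such that for all $v\in S_1\cup\dots\cup S_n$: (i) for any $x\in\mathcal{O}_v$, $f(x)\in\mathcal{O}_v$; (iii) for any $x\in K\setminus\mathcal{O}_v$, $f(x)\in x^d(\mathcal{O}_v\setminus t\mathfrak{m}_v)\cap(a_dx^d+x^{d-1}\mathcal{O}_v)$;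 (iv) $\mathcal{O}_v+\mathcal{O}_v\subseteq t^{-1}\mathcal{O}_v$; and such that for every infinite $S_i$ and all $v\in S_i$: (ii) for any $x\in\mathcal{O}_v$, $f(x)\notin t\mathfrak{m}_v$. Writing $g_j=h_j/k_j$ with $h_j,k_j\in K[x_1,\dots,x_l]$ coprime, $D_g=\{\underline{x}\in K^l: k_j(\underline{x})\ne0\text{ for all }j\}$. *)

theory Defs
  imports
    "HOL-Analysis.Analysis"
    "HOL-Algebra.Group"
    "HOL-Computational_Algebra.Polynomial"
    "HOL-Computational_Algebra.Fraction_Field"
    "HOL-Library.Poly_Mapping"
    "HOL-Library.Set_Algebras"
begin

section \<open>Valuations, orderings, absolute values\<close>

text \<open>The value group of a Krull valuation is a linearly ordered abelian group. It is a
  commutative group in the sense of HOL-Algebra, so the additively written group law appears as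
  \<open>\<otimes>\<close> and its neutral element \<open>0\<close> as \<open>\<one>\<close>.\<close>

record 'g ogroup = "'g monoid" +
  oleq :: "'g rel"

definition ordered_abelian_group :: "'g ogroup \<Rightarrow> bool" where
  "ordered_abelian_group G \<longleftrightarrow>
     comm_group G \<and> linear_order_on (carrier G) (oleq G) \<and>
     (\<forall>a\<in>carrier G. \<forall>b\<in>carrier G. \<forall>c\<in>carrier G.
        (a, b) \<in> oleq G \<longrightarrow> (a \<otimes>\<^bsub>G\<^esub> c, b \<otimes>\<^bsub>G\<^esub> c) \<in> oleq G)"

text \<open>The value \<open>\<infinity>\<close> at \<open>0\<close> is left implicit: only the values at nonzero arguments matter. By
  convention the value group is the full image of the multiplicative group.\<close>

definition krull_valuation :: "'g ogroup \<Rightarrow> ('a::field \<Rightarrow> 'g) \<Rightarrow> bool" where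
  "krull_valuation G v \<longleftrightarrow>
     ordered_abelian_group G \<and>
     v ` (- {0}) = carrier G \<and>
     (\<forall>x y. x \<noteq> 0 \<longrightarrow> y \<noteq> 0 \<longrightarrow> v (x * y) = v x \<otimes>\<^bsub>G\<^esub> v y) \<and>
     (\<forall>x y. x \<noteq> 0 \<longrightarrow> y \<noteq> 0 \<longrightarrow> x + y \<noteq> 0 \<longrightarrow>
        (v x, v (x + y)) \<in> oleq G \<or> (v y, v (x + y)) \<in> oleq G)"

definition field_ordering :: "'a::field rel \<Rightarrow> bool" where
  "field_ordering r \<longleftrightarrow>
     linear_order_on UNIV r \<and>
     (\<forall>x y z. (x, y) \<in> r \<longrightarrow> (x + z, y + z) \<in> r) \<and>
     (\<forall>x y. (0, x) \<in> r \<longrightarrow> (0, y) \<in> r \<longrightarrow> (0, x * y) \<in> r)"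

definition absolute_value :: "('a::field \<Rightarrow> real) \<Rightarrow> bool" where
  "absolute_value a \<longleftrightarrow>
     (\<forall>x. 0 \<le> a x) \<and> (\<forall>x. a x = 0 \<longleftrightarrow> x = 0) \<and>
     (\<forall>x y. a (x * y) = a x * a y) \<and> (\<forall>x y. a (x + y) \<le> a x + a y)"

section \<open>Localities\<close>

text \<open>The value group \<open>K\<^sup>\<times> / \<O>\<^sub>v\<^sup>\<times>\<close> of a valuation consists of subsets of \<open>K\<close>. Hence every Krull
  valuation, with values in whatever ordered group, is equivalent to one whose value group has
  a carrier of type \<open>'a set set\<close>.\<close>

datatype 'a representative =
    Valuation "'a set ogroup" "'a \<Rightarrow> 'a set"
  | Ordering "'a rel"
  | Absolute "'a \<Rightarrow> real"

fun valid_representative :: "'a::field representative \<Rightarrow> bool" where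
  "valid_representative (Valuation G v) \<longleftrightarrow> krull_valuation G v"
| "valid_representative (Ordering r) \<longleftrightarrow> field_ordering r"
| "valid_representative (Absolute a) \<longleftrightarrow> absolute_value a"

text \<open>The first two clauses are equivalence of valuations and of absolute values. The map \<open>\<phi>\<close> in
  the third clause embeds the value group into the additive group of the reals; it exists exactly
  if the valuation has rank at most 1, rank 0 yielding the trivial absolute value. The ring
  homomorphism \<open>\<iota>\<close> in the last clause is an order embedding into the reals; it exists exactly if
  the ordering is archimedean.\<close>

inductive linked :: "'a::field representative \<Rightarrow> 'a representative \<Rightarrow> bool" where
  valuations: "linked (Valuation G v) (Valuation H w)"
    if "krull_valuation G v" "krull_valuation H w" "\<phi> \<in> iso G H"
       "\<And>a b. (a, b) \<in> oleq G \<Longrightarrow> (\<phi> a, \<phi> b) \<in> oleq H"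
       "\<And>x. x \<noteq> 0 \<Longrightarrow> w x = \<phi> (v x)"
| absolutes: "linked (Absolute a) (Absolute b)"
    if "absolute_value a" "absolute_value b" "s > 0" "\<And>x. b x = a x powr s"
| rank_one: "linked (Valuation G v) (Absolute a)"
    if "krull_valuation G v" "absolute_value a"
       "\<And>b c. b \<in> carrier G \<Longrightarrow> c \<in> carrier G \<Longrightarrow> \<phi> (b \<otimes>\<^bsub>G\<^esub> c) = \<phi> b + \<phi> c"
       "\<And>b c. b \<in> carrier G \<Longrightarrow> c \<in> carrier G \<Longrightarrow> (b, c) \<in> oleq G \<longleftrightarrow> \<phi> b \<le> (\<phi> c :: real)"
       "\<And>x. x \<noteq> 0 \<Longrightarrow> a x = exp (- \<phi> (v x))"
| archimedean: "linked (Ordering r) (Absolute a)"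
    if "field_ordering r" "absolute_value a"
       "\<iota> 1 = 1" "\<And>x y. \<iota> (x + y) = \<iota> x + \<iota> y" "\<And>x y. \<iota> (x * y) = \<iota> x * \<iota> y"
       "\<And>x y. (x, y) \<in> r \<longleftrightarrow> \<iota> x \<le> (\<iota> y :: real)"
       "\<And>x. a x = \<bar>\<iota> x\<bar>"

definition same_locality :: "'a::field representative rel" where
  "same_locality =
     {(p, q). valid_representative p \<and> valid_representative q \<and> equivclp linked p q}"

type_synonym 'a locality = "'a representative set"

definition localities :: "'a::field locality set" where
  "localities = Collect valid_representative // same_locality"

definition trivial_locality :: "'a::field locality" where
  "trivial_locality = same_locality `` {Absolute (\<lambda>x. if x = 0 then 0 else 1)}"

fun rep_O :: "'a::field representative \<Rightarrow> 'a set" where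
  "rep_O (Valuation G v) = {x. x = 0 \<or> (\<one>\<^bsub>G\<^esub>, v x) \<in> oleq G}"
| "rep_O (Ordering r) = {x. (- 1, x) \<in> r \<and> (x, 1) \<in> r}"
| "rep_O (Absolute a) = {x. a x \<le> 1}"

fun rep_m :: "'a::field representative \<Rightarrow> 'a set" where
  "rep_m (Valuation G v) = {x. x = 0 \<or> (\<one>\<^bsub>G\<^esub>, v x) \<in> oleq G \<and> v x \<noteq> \<one>\<^bsub>G\<^esub>}"
| "rep_m (Ordering r) = {x. (- 1, x) \<in> r \<and> x \<noteq> - 1 \<and> (x, 1) \<in> r \<and> x \<noteq> 1}"
| "rep_m (Absolute a) = {x. a x < 1}"

text \<open>All representatives of a locality yield the same sets, see \<open>loc_O_class\<close> and
  \<open>loc_m_class\<close> below.\<close>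

definition loc_O :: "'a::field locality \<Rightarrow> 'a set" where
  "loc_O v = (\<Union>p\<in>v. rep_O p)"

definition loc_m :: "'a::field locality \<Rightarrow> 'a set" where
  "loc_m v = (\<Union>p\<in>v. rep_m p)"

definition loc_ball :: "'a::field locality \<Rightarrow> 'a \<Rightarrow> 'a \<Rightarrow> 'a set" where
  "loc_ball v y z = y +o (z *o loc_m v)"

text \<open>The predicate is indeed a topology, see \<open>openin_loc_topology\<close> below.\<close>

definition loc_topology :: "'a::field locality \<Rightarrow> 'a topology" where
  "loc_topology v = topology (\<lambda>U. \<forall>y\<in>U. \<exists>z. z \<noteq> 0 \<and> loc_ball v y z \<subseteq> U)"

definition independent_localities :: "'a::field locality \<Rightarrow> 'a locality \<Rightarrow> bool" where
  "independent_localities v w \<longleftrightarrow> loc_topology v \<noteq> loc_topology w"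

definition constructible_topology :: "'a::field locality topology" where
  "constructible_topology = topology_generated_by
     ((\<Union>x. {{v \<in> localities. x \<in> loc_O v}}) \<union> (\<Union>x. {{v \<in> localities. x \<in> loc_m v}}))"

definition exceptional_uniformity ::
    "nat \<Rightarrow> (nat \<Rightarrow> 'a::field locality set) \<Rightarrow> 'a \<Rightarrow> bool" where
  "exceptional_uniformity n S t \<longleftrightarrow>
     (\<exists>(f :: 'a poly) d. d = degree f \<and> d \<ge> 2 \<and>
       (\<forall>v \<in> (\<Union>i\<in>{1..n}. S i).
          (\<forall>x \<in> loc_O v. poly f x \<in> loc_O v) \<and>
          (\<forall>x. x \<notin> loc_O v \<longrightarrow>
             poly f x \<in> (x ^ d *o (loc_O v - t *o loc_m v)) \<inter>
                         ((lead_coeff f * x ^ d) +o (x ^ (d - 1) *o loc_O v))) \<and>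
          loc_O v + loc_O v \<subseteq> inverse t *o loc_O v) \<and>
       (\<forall>i\<in>{1..n}. infinite (S i) \<longrightarrow>
          (\<forall>v \<in> S i. \<forall>x \<in> loc_O v. poly f x \<notin> t *o loc_m v)))"

section \<open>Polynomials and rational functions in several variables\<close>

text \<open>A monomial maps each variable index to its exponent, a polynomial maps each monomial to its
  coefficient. \<open>K[x\<^sub>1,\<dots>,x\<^sub>l]\<close> is the subring of the polynomials involving only variables with
  index in \<open>{1..l}\<close>, and \<open>K(x\<^sub>1,\<dots>,x\<^sub>l)\<close> is the corresponding subfield of the fraction field.\<close>

type_synonym 'a mpoly = "(nat \<Rightarrow>\<^sub>0 nat) \<Rightarrow>\<^sub>0 'a"

type_synonym 'a ratfun = "'a mpoly fract"

definition mpolys :: "nat \<Rightarrow> 'a::field mpoly set" where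
  "mpolys l = {p. \<forall>M \<in> Poly_Mapping.keys p. Poly_Mapping.keys M \<subseteq> {1..l}}"

definition mpoly_eval :: "'a::field mpoly \<Rightarrow> (nat \<Rightarrow> 'a) \<Rightarrow> 'a" where
  "mpoly_eval p x =
     (\<Sum>M \<in> Poly_Mapping.keys p. Poly_Mapping.lookup p M *
        (\<Prod>i \<in> Poly_Mapping.keys M. x i ^ Poly_Mapping.lookup M i))"

definition ratfuns :: "nat \<Rightarrow> 'a::field ratfun set" where
  "ratfuns l = {Fract h k | h k. h \<in> mpolys l \<and> k \<in> mpolys l \<and> k \<noteq> 0}"

definition mpoly_coprime :: "nat \<Rightarrow> 'a::field mpoly \<Rightarrow> 'a mpoly \<Rightarrow> bool" where
  "mpoly_coprime l h k \<longleftrightarrow>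
     (\<forall>c \<in> mpolys l. (\<exists>h' \<in> mpolys l. h = c * h') \<longrightarrow> (\<exists>k' \<in> mpolys l. k = c * k') \<longrightarrow>
        (\<exists>u \<in> mpolys l. c * u = 1))"

text \<open>Existence is \<open>ex_lowest_terms\<close> below; the choice only concerns a common nonzero constant
  factor of numerator and denominator.\<close>

definition lowest_terms :: "nat \<Rightarrow> 'a::field ratfun \<Rightarrow> 'a mpoly \<times> 'a mpoly" where
  "lowest_terms l g = (SOME (h, k). h \<in> mpolys l \<and> k \<in> mpolys l \<and> k \<noteq> 0 \<and>
     g = Fract h k \<and> mpoly_coprime l h k)"

definition ratfun_domain :: "nat \<Rightarrow> nat \<Rightarrow> (nat \<Rightarrow> 'a::field ratfun) \<Rightarrow> (nat \<Rightarrow> 'a) set" where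
  "ratfun_domain l m g = {x \<in> {1..l} \<rightarrow>\<^sub>E UNIV.
     \<forall>j\<in>{1..m}. mpoly_eval (snd (lowest_terms l (g j))) x \<noteq> 0}"

definition ratfun_eval :: "nat \<Rightarrow> 'a::field ratfun \<Rightarrow> (nat \<Rightarrow> 'a) \<Rightarrow> 'a" where
  "ratfun_eval l g x =
     mpoly_eval (fst (lowest_terms l g)) x / mpoly_eval (snd (lowest_terms l g)) x"

section \<open>Well-definedness\<close>

lemma equivclp_linked_cong:
  assumes "equivclp linked p q"
  shows "rep_O p = rep_O q \<and> rep_m p = rep_m q"
proof -
  have link: "rep_O p = rep_O q \<and> rep_m p = rep_m q" if "linked p q" for p q :: "'a representative"
    using that
  proof cases
    case (valuations G v H w \<phi>)
    have cG: "comm_group G" and cH: "comm_group H"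
      and loG: "linear_order_on (carrier G) (oleq G)" and loH: "linear_order_on (carrier H) (oleq H)"
      and vim: "v ` (- {0}) = carrier G"
      using valuations by (auto simp: krull_valuation_def ordered_abelian_group_def)
    have one: "\<phi> \<one>\<^bsub>G\<^esub> = \<one>\<^bsub>H\<^esub>"
      using cG cH valuations(5) by (meson comm_group_def hom_one iso_imp_homomorphism)
    have inj: "inj_on \<phi> (carrier G)"
      using valuations(5) by (auto simp: iso_def bij_betw_def)
    have one_in: "\<one>\<^bsub>G\<^esub> \<in> carrier G"
      using cG by (simp add: comm_group_def group.is_monoid)
    have eq1: "\<phi> (v x) = \<one>\<^bsub>H\<^esub> \<longleftrightarrow> v x = \<one>\<^bsub>G\<^esub>" if "x \<noteq> 0" for x
      using inj one one_in vim that by (metis Compl_iff image_eqI inj_onD singletonD)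
    have le1: "(\<one>\<^bsub>H\<^esub>, \<phi> (v x)) \<in> oleq H \<longleftrightarrow> (\<one>\<^bsub>G\<^esub>, v x) \<in> oleq G" if x: "x \<noteq> 0" for x
    proof
      assume "(\<one>\<^bsub>G\<^esub>, v x) \<in> oleq G"
      then show "(\<one>\<^bsub>H\<^esub>, \<phi> (v x)) \<in> oleq H" using valuations(6) one by metis
    next
      assume *: "(\<one>\<^bsub>H\<^esub>, \<phi> (v x)) \<in> oleq H"
      have vx: "v x \<in> carrier G" using vim x by auto
      show "(\<one>\<^bsub>G\<^esub>, v x) \<in> oleq G"
      proof (rule ccontr)
        assume n: "(\<one>\<^bsub>G\<^esub>, v x) \<notin> oleq G"
        then have "(v x, \<one>\<^bsub>G\<^esub>) \<in> oleq G"
          using loG vx one_in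
          unfolding linear_order_on_def total_on_def partial_order_on_def preorder_on_def refl_on_def
          by metis
        then have "(\<phi> (v x), \<one>\<^bsub>H\<^esub>) \<in> oleq H" using valuations(6) one by metis
        then have "\<phi> (v x) = \<one>\<^bsub>H\<^esub>"
          using * loH by (auto simp: linear_order_on_def partial_order_on_def antisym_def)
        then have "v x = \<one>\<^bsub>G\<^esub>" using eq1 x by simp
        with n show False
          using loG one_in by (auto simp: linear_order_on_def partial_order_on_def preorder_on_def refl_on_def)
      qed
    qed
    have "x \<in> rep_O p \<longleftrightarrow> x \<in> rep_O q" for x
      using valuations(1,2,7) le1 by (cases "x = 0") auto
    moreover have "x \<in> rep_m p \<longleftrightarrow> x \<in> rep_m q" for x
      using valuations(1,2,7) eq1 [of x] le1 [of x] by (cases "x = 0") auto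
    ultimately show ?thesis by blast
  next
    case (absolutes a b s)
    have nn: "0 \<le> a x" for x using absolutes(3) by (simp add: absolute_value_def)
    have lt: "a x powr s < 1" if "a x < 1" for x
      using powr_less_mono2 [OF absolutes(5) nn that] by simp
    have gt: "1 < a x powr s" if "1 < a x" for x
      using powr_less_mono2 [OF absolutes(5) _ that] by simp
    have "a x powr s \<le> 1 \<longleftrightarrow> a x \<le> 1" "a x powr s < 1 \<longleftrightarrow> a x < 1" for x
      using lt [of x] gt [of x] by (cases "a x" "1 :: real" rule: linorder_cases; simp)+
    then show ?thesis using absolutes by auto
  next
    case (rank_one G v a \<phi>)
    have cG: "comm_group G" and vim: "v ` (- {0}) = carrier G"
      and loG: "linear_order_on (carrier G) (oleq G)"
      using rank_one by (auto simp: krull_valuation_def ordered_abelian_group_def)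
    have one_in: "\<one>\<^bsub>G\<^esub> \<in> carrier G"
      using cG by (simp add: comm_group_def group.is_monoid)
    have "\<phi> (\<one>\<^bsub>G\<^esub> \<otimes>\<^bsub>G\<^esub> \<one>\<^bsub>G\<^esub>) = \<phi> \<one>\<^bsub>G\<^esub> + \<phi> \<one>\<^bsub>G\<^esub>"
      by (rule rank_one(5)) (rule one_in)+
    moreover have "\<one>\<^bsub>G\<^esub> \<otimes>\<^bsub>G\<^esub> \<one>\<^bsub>G\<^esub> = \<one>\<^bsub>G\<^esub>"
      using cG by (simp add: comm_group_def group.is_monoid)
    ultimately have one: "\<phi> \<one>\<^bsub>G\<^esub> = 0" by simp
    have a0: "a 0 = 0" using rank_one(4) by (simp add: absolute_value_def)
    have vx: "v x \<in> carrier G" if "x \<noteq> 0" for x using that vim by auto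
    have le: "(\<one>\<^bsub>G\<^esub>, v x) \<in> oleq G \<longleftrightarrow> 0 \<le> \<phi> (v x)" if "x \<noteq> 0" for x
      using rank_one(6) [OF one_in vx [OF that]] one by simp
    have eq: "v x = \<one>\<^bsub>G\<^esub> \<longleftrightarrow> \<phi> (v x) = 0" if "x \<noteq> 0" for x
    proof
      assume z: "\<phi> (v x) = 0"
      have "(\<one>\<^bsub>G\<^esub>, v x) \<in> oleq G" "(v x, \<one>\<^bsub>G\<^esub>) \<in> oleq G"
        using rank_one(6) one_in vx [OF that] one z by auto
      then show "v x = \<one>\<^bsub>G\<^esub>"
        using loG by (auto simp: linear_order_on_def partial_order_on_def antisym_def)
    qed (simp add: one)
    have "x \<in> rep_O p \<longleftrightarrow> x \<in> rep_O q" for x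
      using rank_one(1,2,7) a0 le by (cases "x = 0") auto
    moreover have "x \<in> rep_m p \<longleftrightarrow> x \<in> rep_m q" for x
      using rank_one(1,2,7) a0 le [of x] eq [of x] by (cases "x = 0") auto
    ultimately show ?thesis by blast
  next
    case (archimedean r a \<iota>)
    have i0: "\<iota> 0 = 0" using archimedean(6) [of 0 0] by simp
    have im: "\<iota> (- 1) = - 1" using archimedean(6) [of "- 1" 1] archimedean(5) i0 by simp
    have anti: "antisym r"
      using archimedean(3) by (simp add: field_ordering_def linear_order_on_def partial_order_on_def)
    have inj: "\<iota> x = \<iota> y \<longleftrightarrow> x = y" for x y
      using archimedean(8) anti by (metis antisymD order_refl)
    have ne: "x \<noteq> 1 \<longleftrightarrow> \<iota> x \<noteq> 1" "x \<noteq> - 1 \<longleftrightarrow> \<iota> x \<noteq> - 1" for x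
      using inj [of x 1] inj [of x "- 1"] archimedean(5) im by auto
    show ?thesis using archimedean(1,2,5,8,9) im ne by auto
  qed
  show ?thesis
    using assms
  proof (induction rule: equivclp_induct)
    case base
    then show ?case by simp
  next
    case (step y z)
    then show ?case using link by metis
  qed
qed

lemma
  assumes "valid_representative p"
  shows loc_O_class: "loc_O (same_locality `` {p}) = rep_O p"
    and loc_m_class: "loc_m (same_locality `` {p}) = rep_m p"
proof -
  have "p \<in> same_locality `` {p}" using assms by (simp add: same_locality_def)
  moreover have "rep_O q = rep_O p \<and> rep_m q = rep_m p" if "q \<in> same_locality `` {p}" for q
    using that equivclp_linked_cong [of p q] by (simp add: same_locality_def)
  ultimately show "loc_O (same_locality `` {p}) = rep_O p" "loc_m (same_locality `` {p}) = rep_m p"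
    unfolding loc_O_def loc_m_def by blast+
qed

lemma localities_cases:
  assumes "v \<in> localities"
  obtains p where "valid_representative p" "v = same_locality `` {p}" "loc_O v = rep_O p" "loc_m v = rep_m p"
proof -
  obtain p where "valid_representative p" "v = same_locality `` {p}"
    using assms unfolding localities_def by (auto elim!: quotientE)
  then show thesis using that loc_O_class loc_m_class by blast
qed

lemma krull_valuation_facts:
  assumes "krull_valuation G v"
  shows "comm_group G" "\<And>x. x \<noteq> 0 \<Longrightarrow> v x \<in> carrier G"
    "\<And>x y. x \<noteq> 0 \<Longrightarrow> y \<noteq> 0 \<Longrightarrow> v (x * y) = v x \<otimes>\<^bsub>G\<^esub> v y" "v 1 = \<one>\<^bsub>G\<^esub>"
    "\<And>a b. a \<in> carrier G \<Longrightarrow> b \<in> carrier G \<Longrightarrow> (a, b) \<in> oleq G \<or> (b, a) \<in> oleq G"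
    "\<And>a b. (a, b) \<in> oleq G \<Longrightarrow> (b, a) \<in> oleq G \<Longrightarrow> a = b"
    "\<And>a b c. (a, b) \<in> oleq G \<Longrightarrow> (b, c) \<in> oleq G \<Longrightarrow> (a, c) \<in> oleq G"
    "\<And>a b c. a \<in> carrier G \<Longrightarrow> b \<in> carrier G \<Longrightarrow> c \<in> carrier G \<Longrightarrow> (a, b) \<in> oleq G \<Longrightarrow>
       (a \<otimes>\<^bsub>G\<^esub> c, b \<otimes>\<^bsub>G\<^esub> c) \<in> oleq G"
proof -
  have lo: "linear_order_on (carrier G) (oleq G)"
    using assms by (simp add: krull_valuation_def ordered_abelian_group_def)
  show cG: "comm_group G"
    using assms by (simp add: krull_valuation_def ordered_abelian_group_def)
  interpret comm_group G by (rule cG)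
  show vx: "\<And>x. x \<noteq> 0 \<Longrightarrow> v x \<in> carrier G"
    using assms by (auto simp: krull_valuation_def)
  show mult: "\<And>x y. x \<noteq> 0 \<Longrightarrow> y \<noteq> 0 \<Longrightarrow> v (x * y) = v x \<otimes>\<^bsub>G\<^esub> v y"
    using assms by (simp add: krull_valuation_def)
  show "v 1 = \<one>\<^bsub>G\<^esub>"
    using mult [of 1 1] vx [of 1] by (simp add: r_cancel_one)
  show "\<And>a b. a \<in> carrier G \<Longrightarrow> b \<in> carrier G \<Longrightarrow> (a, b) \<in> oleq G \<or> (b, a) \<in> oleq G"
    using lo unfolding linear_order_on_def total_on_def partial_order_on_def preorder_on_def refl_on_def
    by metis
  show "\<And>a b. (a, b) \<in> oleq G \<Longrightarrow> (b, a) \<in> oleq G \<Longrightarrow> a = b"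
    using lo by (auto simp: linear_order_on_def partial_order_on_def antisym_def)
  show "\<And>a b c. (a, b) \<in> oleq G \<Longrightarrow> (b, c) \<in> oleq G \<Longrightarrow> (a, c) \<in> oleq G"
    using lo unfolding linear_order_on_def partial_order_on_def preorder_on_def by (meson transD)
  show "\<And>a b c. a \<in> carrier G \<Longrightarrow> b \<in> carrier G \<Longrightarrow> c \<in> carrier G \<Longrightarrow> (a, b) \<in> oleq G \<Longrightarrow>
       (a \<otimes>\<^bsub>G\<^esub> c, b \<otimes>\<^bsub>G\<^esub> c) \<in> oleq G"
    using assms by (simp add: krull_valuation_def ordered_abelian_group_def)
qed

lemma field_ordering_facts:
  assumes "field_ordering r"
  shows "\<And>x y. (x, y) \<in> r \<longleftrightarrow> (0, y - x) \<in> r"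
    "\<And>x y. (0, x) \<in> r \<Longrightarrow> (0, y) \<in> r \<Longrightarrow> (0, x + y) \<in> r"
    "\<And>x y. (0, x) \<in> r \<Longrightarrow> (0, y) \<in> r \<Longrightarrow> (0, x * y) \<in> r"
    "\<And>x. (0, x) \<in> r \<or> (0, - x) \<in> r"
    "\<And>x. (0, x) \<in> r \<Longrightarrow> (0, - x) \<in> r \<Longrightarrow> x = 0"
proof -
  have lo: "linear_order_on UNIV r" and tr: "\<And>x y z. (x, y) \<in> r \<Longrightarrow> (x + z, y + z) \<in> r"
    using assms by (auto simp: field_ordering_def)
  show diff: "(x, y) \<in> r \<longleftrightarrow> (0, y - x) \<in> r" for x y
  proof
    show "(0, y - x) \<in> r" if "(x, y) \<in> r" using tr [OF that, of "- x"] by simp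
    show "(x, y) \<in> r" if "(0, y - x) \<in> r" using tr [OF that, of x] by simp
  qed
  show "(0, x + y) \<in> r" if "(0, x) \<in> r" "(0, y) \<in> r" for x y
  proof -
    have "(y, x + y) \<in> r" using tr [of 0 x y] that by simp
    with that show ?thesis
      using lo unfolding linear_order_on_def partial_order_on_def preorder_on_def by (meson transD)
  qed
  show "\<And>x y. (0, x) \<in> r \<Longrightarrow> (0, y) \<in> r \<Longrightarrow> (0, x * y) \<in> r"
    using assms by (simp add: field_ordering_def)
  have tot: "(x, y) \<in> r \<or> (y, x) \<in> r" for x y
  proof -
    have "total_on UNIV r" "refl_on UNIV r"
      using lo by (simp_all add: linear_order_on_def partial_order_on_def preorder_on_def)
    then show ?thesis by (cases "x = y") (simp_all add: total_on_def refl_on_def)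
  qed
  show "(0, x) \<in> r \<or> (0, - x) \<in> r" for x
    using tot [of 0 x] diff [of x 0] by simp
  show "x = 0" if "(0, x) \<in> r" "(0, - x) \<in> r" for x
  proof -
    have "(x, 0) \<in> r" using that(2) diff [of x 0] by simp
    moreover have "antisym r" using lo by (simp add: linear_order_on_def partial_order_on_def)
    ultimately show ?thesis using that(1) by (simp add: antisymD)
  qed
qed

lemma rep_O_or_inverse:
  assumes "valid_representative p" "x \<noteq> 0"
  shows "x \<in> rep_O p \<or> inverse x \<in> rep_O p"
proof (cases p)
  case (Valuation G v)
  then have kv: "krull_valuation G v" using assms by simp
  note f = krull_valuation_facts [OF kv]
  interpret comm_group G by (rule f(1))
  have one: "v x \<otimes>\<^bsub>G\<^esub> v (inverse x) = \<one>\<^bsub>G\<^esub>"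
    using f(3) [of x "inverse x"] f(4) assms(2) by simp
  have "(\<one>\<^bsub>G\<^esub>, v x) \<in> oleq G \<or> (v x, \<one>\<^bsub>G\<^esub>) \<in> oleq G"
    using f(5) f(2) assms(2) by blast
  moreover have "(\<one>\<^bsub>G\<^esub>, v (inverse x)) \<in> oleq G" if "(v x, \<one>\<^bsub>G\<^esub>) \<in> oleq G"
    using f(8) [of "v x" "\<one>\<^bsub>G\<^esub>" "v (inverse x)"] that one f(2) [of x] f(2) [of "inverse x"] assms(2)
    by simp
  ultimately show ?thesis using Valuation by auto
next
  case (Ordering r)
  then have "field_ordering r" using assms by simp
  note f = field_ordering_facts [OF this]
  define P where "P = (\<lambda>x. (0, x) \<in> r)"
  have add: "\<And>x y. P x \<Longrightarrow> P y \<Longrightarrow> P (x + y)" and mult: "\<And>x y. P x \<Longrightarrow> P y \<Longrightarrow> P (x * y)"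
    and tot: "\<And>x. P x \<or> P (- x)"
    using f(2-4) by (auto simp: P_def)
  have O: "y \<in> rep_O p \<longleftrightarrow> P (1 + y) \<and> P (1 - y)" for y
    using f(1) [of "- 1" y] f(1) [of y 1] Ordering by (simp add: P_def add.commute)
  have sq: "P (y * y)" for y
    using tot [of y] mult [of y y] mult [of "- y" "- y"] by auto
  have one: "P 1" using sq [of 1] by simp
  have key: "inverse y \<in> rep_O p" if y: "P (y - 1)" "y \<noteq> 0" for y
  proof -
    have "P y" using add [OF y(1) one] by simp
    then have iy: "P (inverse y)"
      using mult [OF \<open>P y\<close> sq [of "inverse y"]] y(2) by (simp flip: mult.assoc)
    have "P (1 - inverse y)" using mult [OF y(1) iy] y(2) by (simp add: left_diff_distrib)
    then show ?thesis using O add [OF one iy] by simp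
  qed
  have "P (1 + x) \<and> P (1 - x) \<or> P (x - 1) \<or> P (- x - 1)"
  proof -
    have "- (1 + x) = - x - 1" "- (1 - x) = x - 1" by simp_all
    then show ?thesis using tot [of "1 + x"] tot [of "1 - x"] by metis
  qed
  moreover have "inverse x \<in> rep_O p" if "P (- x - 1)"
  proof -
    have "inverse (- x) \<in> rep_O p" using key [OF that] assms(2) by simp
    then have "P (1 + inverse (- x))" "P (1 - inverse (- x))" unfolding O by blast+
    then show ?thesis unfolding O by simp
  qed
  ultimately show ?thesis using key assms(2) O by blast
next
  case (Absolute a)
  then have a: "absolute_value a" using assms by simp
  have mult: "a (x * y) = a x * a y" for x y using a by (simp add: absolute_value_def)
  have z: "a x = 0 \<longleftrightarrow> x = 0" "0 \<le> a x" for x using a by (auto simp: absolute_value_def)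
  have "a 1 = 1" using mult [of 1 1] z(1) [of 1] by simp
  then have "a x * a (inverse x) = 1" using mult [of x "inverse x"] assms(2) by simp
  moreover have "a x > 0" using z [of x] assms(2) by simp
  ultimately have "a x \<le> 1 \<or> a (inverse x) \<le> 1"
    by (smt (verit, best) mult_less_cancel_left1)
  then show ?thesis using Absolute by simp
qed

lemma rep_O_m:
  assumes "valid_representative p" "x \<in> rep_O p" "y \<in> rep_m p"
  shows "x * y \<in> rep_m p"
proof (cases p)
  case (Valuation G v)
  then have kv: "krull_valuation G v" using assms by simp
  note f = krull_valuation_facts [OF kv]
  interpret comm_group G by (rule f(1))
  show ?thesis
  proof (cases "x = 0 \<or> y = 0")
    case True
    then show ?thesis using Valuation by auto
  next
    case False
    then have c: "v x \<in> carrier G" "v y \<in> carrier G" using f(2) by auto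
    have x: "(\<one>\<^bsub>G\<^esub>, v x) \<in> oleq G" and y: "(\<one>\<^bsub>G\<^esub>, v y) \<in> oleq G" "v y \<noteq> \<one>\<^bsub>G\<^esub>"
      using assms Valuation False by auto
    have le: "(v y, v (x * y)) \<in> oleq G"
      using f(8) [OF _ c(1) c(2) x] f(3) False c by simp
    then have "(\<one>\<^bsub>G\<^esub>, v (x * y)) \<in> oleq G" using f(7) y(1) by blast
    moreover have "v (x * y) \<noteq> \<one>\<^bsub>G\<^esub>" using f(6) le y by metis
    ultimately show ?thesis using Valuation by simp
  qed
next
  case (Ordering r)
  then have "field_ordering r" using assms by simp
  note f = field_ordering_facts [OF this]
  define P where "P = (\<lambda>x. (0, x) \<in> r)"
  have add: "\<And>x y. P x \<Longrightarrow> P y \<Longrightarrow> P (x + y)" and mult: "\<And>x y. P x \<Longrightarrow> P y \<Longrightarrow> P (x * y)"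
    and tot: "\<And>x. P x \<or> P (- x)" and anti: "\<And>x. P x \<Longrightarrow> P (- x) \<Longrightarrow> x = 0"
    using f(2-5) by (auto simp: P_def)
  have O: "y \<in> rep_O p \<longleftrightarrow> P (1 + y) \<and> P (1 - y)" for y
    using f(1) [of "- 1" y] f(1) [of y 1] Ordering by (simp add: P_def add.commute)
  have m: "y \<in> rep_m p \<longleftrightarrow> P (1 + y) \<and> y \<noteq> - 1 \<and> P (1 - y) \<and> y \<noteq> 1" for y
    using f(1) [of "- 1" y] f(1) [of y 1] Ordering by (simp add: P_def add.commute)
  have sum0: "a = 0" if "P a" "P b" "a + b = 0" for a b
  proof -
    have "b = - a" using that(3) by (simp add: eq_neg_iff_add_eq_0 add.commute)
    then show ?thesis using anti [of a] that by simp
  qed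
  have key: "P (1 - u * y) \<and> u * y \<noteq> 1" if u: "P (1 + u)" "P (1 - u)" for u
  proof (cases "P y")
    case True
    have eq: "1 - u * y = (1 - y) + y * (1 - u)" by (simp add: algebra_simps)
    have py: "P (1 - y)" "y \<noteq> 1" using assms(3) unfolding m by blast+
    have pu: "P (y * (1 - u))" using mult [OF True u(2)] .
    have "P (1 - u * y)" unfolding eq by (rule add [OF py(1) pu])
    moreover have "u * y \<noteq> 1"
    proof
      assume "u * y = 1"
      then have "1 - y = 0" using sum0 [OF py(1) pu] eq by simp
      then show False using py(2) by simp
    qed
    ultimately show ?thesis by blast
  next
    case False
    then have ny: "P (- y)" using tot by blast
    have eq: "1 - u * y = (1 + y) + (- y) * (1 + u)" by (simp add: algebra_simps)
    have py: "P (1 + y)" "y \<noteq> - 1" using assms(3) unfolding m by blast+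
    have pu: "P ((- y) * (1 + u))" using mult [OF ny u(1)] .
    have "P (1 - u * y)" unfolding eq by (rule add [OF py(1) pu])
    moreover have "u * y \<noteq> 1"
    proof
      assume "u * y = 1"
      then have "1 + y = 0" using sum0 [OF py(1) pu] eq by simp
      then show False using py(2) by (simp add: add_eq_0_iff)
    qed
    ultimately show ?thesis by blast
  qed
  have "P (1 + x)" "P (1 - x)" using assms(2) unfolding O by blast+
  then have k: "P (1 - x * y)" "x * y \<noteq> 1" "P (1 - (- x) * y)" "(- x) * y \<noteq> 1"
    using key [of x] key [of "- x"] by simp_all
  then have "P (1 + x * y)" by simp
  moreover have "x * y \<noteq> - 1"
  proof
    assume "x * y = - 1"
    then have "(- x) * y = 1" by simp
    with k(4) show False by blast
  qed
  ultimately show ?thesis using k(1,2) unfolding m by blast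
next
  case (Absolute a)
  then have a: "absolute_value a" using assms by simp
  have "a (x * y) = a x * a y" "0 \<le> a x" "0 \<le> a y" using a by (auto simp: absolute_value_def)
  moreover have "a x \<le> 1" "a y < 1" using assms Absolute by auto
  ultimately have "a (x * y) < 1"
    using mult_left_le_one_le [of "a y" "a x"] by linarith
  then show ?thesis using Absolute by simp
qed

lemma openin_loc_topology:
  assumes "v \<in> localities"
  shows "openin (loc_topology v) U \<longleftrightarrow> (\<forall>y\<in>U. \<exists>z. z \<noteq> 0 \<and> loc_ball v y z \<subseteq> U)"
proof -
  obtain p where p: "valid_representative p" "loc_m v = rep_m p"
    using assms by (rule localities_cases)
  have sub: "loc_ball v y a \<subseteq> loc_ball v y b"
    if "a * inverse b \<in> rep_O p" "b \<noteq> 0" for a b y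
  proof
    fix c assume "c \<in> loc_ball v y a"
    then obtain u where u: "u \<in> rep_m p" "c = y + a * u"
      by (auto simp: loc_ball_def p elt_set_plus_def elt_set_times_def)
    then have "c = y + b * ((a * inverse b) * u)" using that by simp
    moreover have "(a * inverse b) * u \<in> rep_m p" using rep_O_m p that u by blast
    ultimately show "c \<in> loc_ball v y b"
      by (auto simp: loc_ball_def p elt_set_plus_def elt_set_times_def)
  qed
  have chain: "loc_ball v y a \<subseteq> loc_ball v y b \<or> loc_ball v y b \<subseteq> loc_ball v y a"
    if "a \<noteq> 0" "b \<noteq> 0" for a b y
    using rep_O_or_inverse [OF p(1), of "a * inverse b"] sub [of a b y] sub [of b a y] that
    by (auto simp: mult.commute)
  have "istopology (\<lambda>U. \<forall>y\<in>U. \<exists>z. z \<noteq> 0 \<and> loc_ball v y z \<subseteq> U)"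
    unfolding istopology_def
  proof (intro conjI allI impI ballI)
    fix A B y
    assume A: "\<forall>y\<in>A. \<exists>z. z \<noteq> 0 \<and> loc_ball v y z \<subseteq> A"
      and B: "\<forall>y\<in>B. \<exists>z. z \<noteq> 0 \<and> loc_ball v y z \<subseteq> B" and y: "y \<in> A \<inter> B"
    then obtain a b where "a \<noteq> 0" "loc_ball v y a \<subseteq> A" "b \<noteq> 0" "loc_ball v y b \<subseteq> B" by blast
    then show "\<exists>z. z \<noteq> 0 \<and> loc_ball v y z \<subseteq> A \<inter> B" using chain [of a b y] by blast
  next
    fix \<K> y
    assume "\<forall>A\<in>\<K>. \<forall>y\<in>A. \<exists>z. z \<noteq> 0 \<and> loc_ball v y z \<subseteq> A" "y \<in> \<Union>\<K>"
    then show "\<exists>z. z \<noteq> 0 \<and> loc_ball v y z \<subseteq> \<Union>\<K>" by (meson Union_upper UnionE subset_trans)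
  qed
  then show ?thesis by (simp add: loc_topology_def)
qed

lemma keys_Max_times:
  fixes p q :: "'a::field mpoly"
  assumes "p \<noteq> 0" "q \<noteq> 0"
  shows "Max (Poly_Mapping.keys (p * q)) = Max (Poly_Mapping.keys p) + Max (Poly_Mapping.keys q)"
proof -
  define F G where "F = Poly_Mapping.keys p" and "G = Poly_Mapping.keys q"
  have fin: "finite F" "finite G" and ne: "F \<noteq> {}" "G \<noteq> {}"
    using assms by (auto simp: F_def G_def)
  have mem: "Max F \<in> F" "Max G \<in> G" using fin ne by auto
  have le: "\<And>a. a \<in> F \<Longrightarrow> a \<le> Max F" "\<And>b. b \<in> G \<Longrightarrow> b \<le> Max G" using fin by auto
  define s where "s = Max F + Max G"
  have "Poly_Mapping.lookup (p * q) s =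
      (\<Sum>(a, b). Poly_Mapping.lookup p a * Poly_Mapping.lookup q b when s = a + b)"
    unfolding times_poly_mapping.rep_eq by (rule prod_fun_unfold_prod) simp_all
  also have "\<dots> = (\<Sum>ab. (case ab of (a, b) \<Rightarrow> Poly_Mapping.lookup p a * Poly_Mapping.lookup q b)
      when (Max F, Max G) = ab)"
  proof (rule Sum_any.cong)
    fix ab :: "(nat \<Rightarrow>\<^sub>0 nat) \<times> (nat \<Rightarrow>\<^sub>0 nat)"
    obtain a b where [simp]: "ab = (a, b)" by (cases ab)
    have "Poly_Mapping.lookup p a * Poly_Mapping.lookup q b = 0 \<or> (Max F, Max G) = (a, b)" if "s = a + b"
    proof (rule ccontr)
      assume n: "\<not> ?thesis"
      then have "a \<in> F" "b \<in> G" by (auto simp: F_def G_def in_keys_iff)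
      then have *: "a \<le> Max F" "b \<le> Max G" using le by auto
      with n have "a < Max F \<or> b < Max G" by auto
      then have "a + b < Max F + Max G"
        using * by (metis add_less_le_mono add_le_less_mono)
      with that show False by (simp add: s_def)
    qed
    then show "(case ab of (a, b) \<Rightarrow> Poly_Mapping.lookup p a * Poly_Mapping.lookup q b when s = a + b) =
        ((case ab of (a, b) \<Rightarrow> Poly_Mapping.lookup p a * Poly_Mapping.lookup q b) when (Max F, Max G) = ab)"
      by (auto simp: when_def s_def)
  qed
  also have "\<dots> = Poly_Mapping.lookup p (Max F) * Poly_Mapping.lookup q (Max G)" by simp
  also have "\<dots> \<noteq> 0" using mem by (simp add: F_def G_def in_keys_iff)
  finally have s: "s \<in> Poly_Mapping.keys (p * q)" by (simp add: in_keys_iff)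
  have "c \<le> s" if c: "c \<in> Poly_Mapping.keys (p * q)" for c
  proof -
    obtain a b where "a \<in> F" "b \<in> G" "c = a + b"
      using c keys_mult [of p q] unfolding F_def G_def by blast
    then show ?thesis using le unfolding s_def by (metis add_mono)
  qed
  with s have "Max (Poly_Mapping.keys (p * q)) = s" by (intro Max_eqI) auto
  then show ?thesis by (simp add: s_def F_def G_def)
qed

lemma ex_lowest_terms:
  fixes g :: "'a::field ratfun"
  assumes "g \<in> ratfuns l"
  shows "\<exists>h k. h \<in> mpolys l \<and> k \<in> mpolys l \<and> k \<noteq> 0 \<and> g = Fract h k \<and> mpoly_coprime l h k"
proof -
  define md :: "(nat \<Rightarrow>\<^sub>0 nat) \<Rightarrow> nat" where "md = (\<lambda>M. Sum_any (Poly_Mapping.lookup M))"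
  have md_add: "md (M + N) = md M + md N" for M N
    by (simp add: md_def lookup_add Sum_any.distrib)
  have md_0: "M = 0" if "md M = 0" for M
  proof (rule poly_mapping_eqI)
    fix i
    have "(\<Sum>i\<in>Poly_Mapping.keys M. Poly_Mapping.lookup M i) = 0"
      using that by (simp add: md_def Sum_any.expand_set keys.rep_eq)
    then show "Poly_Mapping.lookup M i = Poly_Mapping.lookup 0 i"
      by (cases "i \<in> Poly_Mapping.keys M") (auto simp: in_keys_iff)
  qed
  define deg :: "'a mpoly \<Rightarrow> nat" where "deg = (\<lambda>p. md (Max (Poly_Mapping.keys p)))"
  have unit: "\<exists>u\<in>mpolys l. c * u = 1" if c: "c \<noteq> 0" "deg c = 0" for c
  proof -
    have "Max (Poly_Mapping.keys c) = 0" using md_0 c(2) by (simp add: deg_def)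
    then have "M \<le> 0" if "M \<in> Poly_Mapping.keys c" for M
      using that by (metis Max_ge finite_keys)
    moreover have "\<not> M < 0" for M :: "nat \<Rightarrow>\<^sub>0 nat"
      by transfer (auto simp: less_fun_def)
    ultimately have M0: "M = 0" if "M \<in> Poly_Mapping.keys c" for M using that by (metis order_le_less)
    define a where "a = Poly_Mapping.lookup c 0"
    have ca: "c = Poly_Mapping.single 0 a"
      using M0 by (intro poly_mapping_eqI) (auto simp: a_def lookup_single when_def in_keys_iff)
    have "a \<noteq> 0" using c(1) ca by auto
    then have "c * Poly_Mapping.single 0 (inverse a) = 1"
      by (simp add: ca mult_single flip: single_one)
    moreover have "Poly_Mapping.single 0 (inverse a) \<in> mpolys l" by (simp add: mpolys_def)
    ultimately show ?thesis by blast
  qed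
  have "\<exists>h k. h \<in> mpolys l \<and> k \<in> mpolys l \<and> k \<noteq> 0 \<and> g = Fract h k \<and> mpoly_coprime l h k"
    if "h \<in> mpolys l" "k \<in> mpolys l" "k \<noteq> 0" "g = Fract h k" for h k
    using that
  proof (induction "deg k" arbitrary: h k rule: less_induct)
    case less
    show ?case
    proof (cases "mpoly_coprime l h k")
      case True
      with less.prems show ?thesis by blast
    next
      case False
      then obtain c h' k' where c: "h' \<in> mpolys l" "h = c * h'" "k' \<in> mpolys l" "k = c * k'"
        and nu: "\<not> (\<exists>u\<in>mpolys l. c * u = 1)"
        unfolding mpoly_coprime_def by blast
      have nz: "c \<noteq> 0" "k' \<noteq> 0" using c less.prems(3) by auto
      have "deg k = deg c + deg k'" unfolding c(4) deg_def by (simp add: keys_Max_times nz md_add)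
      moreover have "deg c \<noteq> 0" using unit nz nu by blast
      ultimately have "deg k' < deg k" by simp
      moreover have "g = Fract h' k'" using less.prems(4) c nz by (simp add: mult_fract_cancel)
      ultimately show ?thesis using less.hyps c nz by blast
    qed
  qed
  with assms show ?thesis by (auto simp: ratfuns_def)
qed

end

theory Submission
  imports Defs "HOL-Computational_Algebra.Fundamental_Theorem_Algebra"
begin

text \<open>For a locality \<open>v\<close> write \<open>x \<sqsubseteq> y\<close> for \<open>x / y \<in> \<O>\<^sub>v\<close>. By assumption (iv) this total preorder satisfies
  \<open>t (x + y) \<sqsubseteq> z\<close> whenever \<open>x, y \<sqsubseteq> z\<close>, uniformly in \<open>v \<in> S\<close>. Finitely many independent places are separated by a
  truncation argument. At the places satisfying (ii), the function \<open>\<psi>(u) = t / f(1 / u)\<close> is bounded by \<open>1\<close>,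
  small where \<open>u\<close> is small, and at least of size \<open>t\<close> where \<open>u\<close> is not. Hence it truncates products of separating
  elements uniformly, and compactness leads from pairs of places to pairs of compact sets of places. Only finitely
  many places violate (ii); there \<open>t / f\<close> is large at some integral point, and this separates them from all others.

  For rational functions, the sets \<open>S\<^sub>i\<close> are cut into finitely many clopen pieces, on each of which one of the given points
  can be used and has a uniform neighbourhood. This requires the maximal ideals to be open uniformly in the place,
  which for archimedean absolute values rests on Ostrowski's theorem, applied to a single element.\<close>

section \<open>Quasi-valuations\<close>

text \<open>Every sum costs a factor \<open>t\<close>. In a partition of unity the number of
  summands is known beforehand, so \<open>t ^ card I\<close> pays for it. Merging separating
  elements along a finite subcover is different: the size of the subcover depends on the bound aimed
  at, so a loss per step would be fatal. Degree at least 2 prevents it: \<open>\<psi> u\<close> is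
  bounded by the square of a small \<open>u\<close>, so a product of two separating elements,
  divided by the square of \<open>t\<close> and truncated once, is back at level \<open>t\<close> on
  the large side and keeps its bound on the small side. A neighbourhood of a place is described only
  by memberships of elements of K in \<open>loc_O\<close> and \<open>loc_m\<close>, so the real gap
  between the size of \<open>y\<close> and 1 has to be witnessed by some \<rho> in K. At a
  neighbouring archimedean place \<rho> need not be real, and the triangle inequality bounds 1 -
  \<rho> only by 1 plus the size of \<rho>. The conditions on \<rho> must therefore control its
  direction as well as its size, and they become an inequality by comparison with a complex
  number.\<close>

locale quasi_valuation =
  fixes le :: "'a::field \<Rightarrow> 'a \<Rightarrow> bool"  (infix "\<sqsubseteq>" 50)
    and t :: 'a
  assumes total: "x \<sqsubseteq> y \<or> y \<sqsubseteq> x"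
    and trans [trans]: "x \<sqsubseteq> y \<Longrightarrow> y \<sqsubseteq> z \<Longrightarrow> x \<sqsubseteq> z"
    and mult_right: "x \<sqsubseteq> y \<Longrightarrow> x * z \<sqsubseteq> y * z"
    and le_0D: "x \<sqsubseteq> 0 \<Longrightarrow> x = 0"
    and uminus_le: "- x \<sqsubseteq> x"
    and t_nonzero: "t \<noteq> 0"
    and add_le: "x \<sqsubseteq> z \<Longrightarrow> y \<sqsubseteq> z \<Longrightarrow> t * (x + y) \<sqsubseteq> z"
begin

abbreviation less (infix "\<sqsubset>" 50) where "x \<sqsubset> y \<equiv> \<not> y \<sqsubseteq> x"

lemma refl [simp]: "x \<sqsubseteq> x"
  using total by blast

lemma less_imp_le: "x \<sqsubset> y \<Longrightarrow> x \<sqsubseteq> y"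
  using total by blast

lemma zero_le [simp]: "0 \<sqsubseteq> x"
  using total [of 0 x] le_0D by auto

lemma le_0_iff [simp]: "x \<sqsubseteq> 0 \<longleftrightarrow> x = 0"
  using le_0D by auto

lemma le_less_trans: "x \<sqsubseteq> y \<Longrightarrow> y \<sqsubset> z \<Longrightarrow> x \<sqsubset> z"
  by (meson trans)

lemma less_le_trans: "x \<sqsubset> y \<Longrightarrow> y \<sqsubseteq> z \<Longrightarrow> x \<sqsubset> z"
  by (meson trans)

lemma mult_right_iff: "z \<noteq> 0 \<Longrightarrow> x * z \<sqsubseteq> y * z \<longleftrightarrow> x \<sqsubseteq> y"
  using mult_right [of "x * z" "y * z" "inverse z"] mult_right [of x y z] by (auto simp: mult.assoc)

lemma mult_left_iff: "z \<noteq> 0 \<Longrightarrow> z * x \<sqsubseteq> z * y \<longleftrightarrow> x \<sqsubseteq> y"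
  using mult_right_iff [of z x y] by (simp add: mult.commute)

lemma mult_mono: "a \<sqsubseteq> b \<Longrightarrow> c \<sqsubseteq> d \<Longrightarrow> a * c \<sqsubseteq> b * d"
  using trans [OF mult_right [of a b c] mult_right [of c d b, unfolded mult.commute [of _ b]]] .

lemma mult_less_le: "a \<sqsubset> b \<Longrightarrow> c \<sqsubseteq> d \<Longrightarrow> d \<noteq> 0 \<Longrightarrow> a * c \<sqsubset> b * d"
proof
  assume *: "a \<sqsubset> b" "c \<sqsubseteq> d" "d \<noteq> 0" "b * d \<sqsubseteq> a * c"
  have "a * c \<sqsubseteq> a * d" using mult_mono [OF refl *(2)] .
  then have "b * d \<sqsubseteq> a * d" using *(4) by (rule trans [rotated])
  then show False using *(1,3) mult_right_iff by blast
qed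

lemma mult_le_one: "a \<sqsubseteq> 1 \<Longrightarrow> b \<sqsubseteq> c \<Longrightarrow> a * b \<sqsubseteq> c"
  using mult_mono [of a 1 b c] by simp

lemma mult_le_one_less: "a \<sqsubseteq> 1 \<Longrightarrow> b \<sqsubset> c \<Longrightarrow> a * b \<sqsubset> c"
  using mult_le_one [OF _ refl, of a b] le_less_trans by blast

lemma divide_le_iff: "y \<noteq> 0 \<Longrightarrow> x / y \<sqsubseteq> z \<longleftrightarrow> x \<sqsubseteq> z * y"
  using mult_right_iff [of y "x / y" z] by simp

lemma le_divide_iff: "y \<noteq> 0 \<Longrightarrow> z \<sqsubseteq> x / y \<longleftrightarrow> z * y \<sqsubseteq> x"
  using mult_right_iff [of y z "x / y"] by simp

lemma power_mono: "x \<sqsubseteq> y \<Longrightarrow> x ^ n \<sqsubseteq> y ^ n"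
  by (induction n) (auto intro: mult_mono)

lemma power_le_one: "x \<sqsubseteq> 1 \<Longrightarrow> x ^ n \<sqsubseteq> 1"
  using power_mono [of x 1 n] by simp

lemma uminus_le_iff [simp]: "- x \<sqsubseteq> y \<longleftrightarrow> x \<sqsubseteq> y"
  using trans [OF uminus_le, of x y] trans [OF uminus_le, of "- x" y] by auto

lemma le_uminus_iff [simp]: "x \<sqsubseteq> - y \<longleftrightarrow> x \<sqsubseteq> y"
  using trans [OF _ uminus_le, of x y] trans [OF _ uminus_le, of x "- y"] by auto

lemma t_le_one: "t \<sqsubseteq> 1"
  using add_le [of 1 1 0] by simp

lemma add_less: "x \<sqsubset> z \<Longrightarrow> y \<sqsubset> z \<Longrightarrow> t * (x + y) \<sqsubset> z"
  by (metis add_le refl total less_le_trans le_less_trans)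

lemma sum_less:
  assumes "finite A" "\<And>a. a \<in> A \<Longrightarrow> g a \<sqsubset> z" "z \<noteq> 0"
  shows "t ^ card A * sum g A \<sqsubset> z"
  using assms
proof (induction A)
  case (insert a A)
  have "t ^ card A * g a \<sqsubset> z"
    using insert.prems by (intro mult_le_one_less power_le_one t_le_one) auto
  then have "t * (t ^ card A * g a + t ^ card A * sum g A) \<sqsubset> z"
    using insert by (intro add_less) auto
  then show ?case using insert.hyps by (simp add: algebra_simps)
qed simp

text \<open>Reverse triangle inequality: were \<open>x + y\<close> also smaller than
  \<open>t * x\<close>, then \<open>t * x\<close>, being t times the sum of \<open>x + y\<close> and
  \<open>- y\<close>, would be smaller than itself.\<close>

lemma less_add_lower: "y \<sqsubset> t * x \<Longrightarrow> t * x \<sqsubseteq> x + y"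
proof (rule ccontr)
  assume *: "y \<sqsubset> t * x" "x + y \<sqsubset> t * x"
  have "t * ((x + y) + (- y)) \<sqsubset> t * x" by (rule add_less) (use * in simp_all)
  then show False by simp
qed

lemma less_imp_nonzero: "x \<sqsubset> y \<Longrightarrow> y \<noteq> 0"
  by auto

text \<open>The estimate behind all truncations below: a dominant summand bounds the denominator
  from below up to the factor \<open>t\<close>.\<close>

lemma quotient_le:
  assumes "y \<sqsubset> t * x"
  shows "x + y \<noteq> 0" "y / (x + y) \<sqsubseteq> y / (t * x)"
proof -
  have nz: "t * x \<noteq> 0" using assms less_imp_nonzero by blast
  have le: "t * x \<sqsubseteq> x + y" by (rule less_add_lower [OF assms])
  then show nz': "x + y \<noteq> 0" using nz le_0D by metis
  have "y * (t * x) \<sqsubseteq> y * (x + y)" by (rule mult_mono [OF refl le])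
  then show "y / (x + y) \<sqsubseteq> y / (t * x)"
    using nz nz' by (simp add: divide_le_iff le_divide_iff)
qed


text \<open>The default bound 1 serves the case \<open>y = 0\<close>, where the product vanishes
  whatever \<open>u\<close> is.\<close>

lemma mult_less_of_less:
  assumes "u \<sqsubset> (if y = 0 then 1 else c / y)" "c \<noteq> 0"
  shows "y * u \<sqsubset> c"
proof (cases "y = 0")
  case False
  then have "u * y \<sqsubset> c / y * y" using assms(1) by (intro mult_less_le) auto
  with False show ?thesis by (simp add: mult.commute)
qed (use assms in simp)

text \<open>The \<open>e i\<close> are approximate indicators. The error splits into one term for
  the deviation of \<open>e k\<close> from 1 and one for each other index, and the bound with
  \<open>t ^ card I\<close> absorbs the cost of adding them.\<close>

lemma sum_unity_less:
  assumes "finite I" "k \<in> I" "z \<noteq> 0"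
    and "y k * (e k - 1) \<sqsubset> t ^ card I * z"
    and "\<And>i. i \<in> I \<Longrightarrow> i \<noteq> k \<Longrightarrow> y i * e i \<sqsubset> t ^ card I * z"
  shows "(\<Sum>i\<in>I. y i * e i) - y k \<sqsubset> z"
proof -
  define g where "g = (\<lambda>i. if i = k then y k * (e k - 1) else y i * e i)"
  have "(\<Sum>i\<in>I. y i * e i) - y k = y k * (e k - 1) + (\<Sum>i\<in>I - {k}. y i * e i)"
    using assms(1,2) by (simp add: sum.remove algebra_simps)
  also have "\<dots> = g k + sum g (I - {k})" by (simp add: g_def)
  also have "\<dots> = sum g I" using assms(1,2) by (simp add: sum.remove)
  finally have eq: "(\<Sum>i\<in>I. y i * e i) - y k = sum g I" .
  have "t ^ card I * sum g I \<sqsubset> t ^ card I * z"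
    using assms t_nonzero by (intro sum_less) (auto simp: g_def)
  then show ?thesis unfolding eq using t_nonzero mult_left_iff by auto
qed

end

section \<open>Families of independent places\<close>

text \<open>\<open>independent\<close> is the form in which distinctness of the topologies is used:
  an element arbitrarily small at one place need not be small at the other. The roles of
  \<open>v\<close> and \<open>w\<close> may be exchanged.\<close>

locale place_family =
  fixes le :: "'v \<Rightarrow> 'a::field \<Rightarrow> 'a \<Rightarrow> bool" and S :: "'v set" and t :: 'a
  assumes quasi_valuation: "v \<in> S \<Longrightarrow> quasi_valuation (le v) t"
    and nontrivial: "v \<in> S \<Longrightarrow> \<exists>x. x \<noteq> 0 \<and> \<not> le v 1 x"
    and independent: "v \<in> S \<Longrightarrow> w \<in> S \<Longrightarrow> v \<noteq> w \<Longrightarrow> a \<noteq> 0 \<Longrightarrow> \<exists>x. x \<noteq> 0 \<and> le w x a \<and> le v 1 x"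
begin

abbreviation lt where "lt v x y \<equiv> \<not> le v y x"

lemma ex_less:
  assumes "v \<in> S" "finite A" "0 \<notin> A"
  shows "\<exists>d. d \<noteq> 0 \<and> (\<forall>a\<in>A. lt v d a)"
  using assms(2,3)
proof (induction A)
  case empty
  show ?case by (rule exI [of _ 1]) simp
next
  case (insert a A)
  interpret quasi_valuation "le v" t by (rule quasi_valuation [OF assms(1)])
  obtain d where d: "d \<noteq> 0" "\<And>b. b \<in> A \<Longrightarrow> lt v d b" using insert by auto
  obtain \<pi> where \<pi>: "\<pi> \<noteq> 0" "lt v \<pi> 1" using nontrivial [OF assms(1)] by blast
  have small: "lt v (\<pi> * c) c" if "c \<noteq> 0" for c
    using mult_less_le [OF \<pi>(2) refl that] by simp
  show ?case
  proof (cases "le v d a")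
    case True
    have "lt v (\<pi> * d) b" if "b \<in> insert a A" for b
      using small [OF d(1)] True d(2) that less_le_trans less_imp_le by blast
    then show ?thesis using d(1) \<pi>(1) by (intro exI [of _ "\<pi> * d"]) auto
  next
    case False
    have a: "a \<noteq> 0" using insert by auto
    have "lt v (\<pi> * a) b" if "b \<in> insert a A" for b
    proof (cases "b = a")
      case False
      then have "lt v d b" using d(2) that by blast
      then show ?thesis using small [OF a] less_imp_le [OF \<open>lt v a d\<close>] less_le_trans less_imp_le by meson
    qed (use small a in simp)
    then show ?thesis using a \<pi>(1) by (intro exI [of _ "\<pi> * a"]) auto
  qed
qed

text \<open>The denominator \<open>c + x\<close> truncates \<open>x\<close> at the new place \<open>p\<close>; of the two candidates for \<open>c\<close> at
  least one is not close to \<open>- x\<close> there.\<close>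

lemma ex_small_on_finite:
  assumes "finite F" "F \<subseteq> S" "w \<in> S" "w \<notin> F" "\<And>q. q \<in> F \<Longrightarrow> b q \<noteq> 0"
  shows "\<exists>x. x \<noteq> 0 \<and> (\<forall>q\<in>F. le q x (b q)) \<and> le w 1 x"
  using assms(1,2,4,5)
proof (induction F arbitrary: b)
  case empty
  interpret quasi_valuation "le w" t by (rule quasi_valuation [OF assms(3)])
  show ?case by (rule exI [of _ 1]) simp
next
  case (insert p F b)
  have pS: "p \<in> S" and pw: "w \<noteq> p" and bp: "b p \<noteq> 0" using insert.prems by auto
  interpret P: quasi_valuation "le p" t by (rule quasi_valuation [OF pS])
  interpret W: quasi_valuation "le w" t by (rule quasi_valuation [OF assms(3)])
  note t = P.t_nonzero
  \<comment> \<open>Of the four factors \<open>t\<close>, one is spent on passing to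
    \<open>y0 / t\<close>, which makes up for the loss in \<open>c + x\<close> at \<open>w\<close>;
    the other three pay for the estimate \<open>le p (t ^ 3 * x) (c + x)\<close> at the new
    place.\<close>
  obtain y0 where y0: "y0 \<noteq> 0" "le p y0 (t ^ 4 * b p)" "le w 1 y0"
    using independent [OF assms(3) pS pw, of "t ^ 4 * b p"] bp t by auto
  define y where "y = y0 / t"
  have y: "y \<noteq> 0" "le p y (t ^ 3 * b p)" "le w 1 (t * y)"
    using y0 t by (auto simp: y_def P.divide_le_iff power_numeral_reduce mult_ac)
  obtain \<pi> where \<pi>: "\<pi> \<noteq> 0" "lt p \<pi> (t\<^sup>2)"
    using ex_less [OF pS, of "{t\<^sup>2}"] t by auto
  \<comment> \<open>Dividing by \<open>s\<close> makes \<open>x\<close> at least 1 and at least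
    \<open>\<pi>\<close> at \<open>w\<close>, so that \<open>x\<close> dominates
    \<open>c + x\<close> there for either candidate \<open>c\<close>. The induction hypothesis is
    used with bounds multiplied by \<open>s\<close>.\<close>
  obtain s where s: "s \<noteq> 0" "lt w s 1" "lt w s (1 / \<pi>)"
    using ex_less [OF assms(3), of "{1, 1 / \<pi>}"] \<pi>(1) by auto
  have "\<exists>d. d \<noteq> 0 \<and> (\<forall>c\<in>{1, \<pi>}. lt q d (t * c) \<and> lt q d (b q * (t * c) / y))" if "q \<in> F" for q
  proof -
    have "b q \<noteq> 0" "q \<in> S" using that insert.prems by auto
    then show ?thesis
      using ex_less [of q "{t * 1, t * \<pi>, b q * (t * 1) / y, b q * (t * \<pi>) / y}"] t \<pi>(1) y(1) by auto
  qed
  then obtain d where d: "\<And>q. q \<in> F \<Longrightarrow> d q \<noteq> 0"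
    "\<And>q c. q \<in> F \<Longrightarrow> c \<in> {1, \<pi>} \<Longrightarrow> lt q (d q) (t * c) \<and> lt q (d q) (b q * (t * c) / y)"
    by metis
  obtain x' where x': "x' \<noteq> 0" "\<And>q. q \<in> F \<Longrightarrow> le q x' (d q * s)" "le w 1 x'"
    using insert.IH [of "\<lambda>q. d q * s"] insert.prems d(1) s(1) by auto
  define x where "x = x' / s"
  have x0: "x \<noteq> 0" using x' s by (simp add: x_def)
  have xq: "le q x (d q)" if "q \<in> F" for q
  proof -
    interpret quasi_valuation "le q" t using quasi_valuation that insert.prems by auto
    show ?thesis using x'(2) [OF that] s(1) by (simp add: x_def divide_le_iff)
  qed
  have xw: "le w c x" if "c \<in> {1, \<pi>}" for c
  proof -
    have "le w (s * c) (1 / c * c)" using that s W.less_imp_le \<pi>(1) by (intro W.mult_mono) auto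
    moreover have "c \<noteq> 0" using that \<pi>(1) by auto
    ultimately have "le w (c * s) x'" using x'(3) by (metis W.trans mult.commute nonzero_divide_eq_eq)
    then show ?thesis by (simp add: x_def W.le_divide_iff s(1))
  qed
  \<comment> \<open>If \<open>1 + x\<close> is not below the square of \<open>t\<close> at
    \<open>p\<close>, then \<open>c = 1\<close> serves. Otherwise \<open>x\<close> is at least
    \<open>t\<close> there, and \<open>\<pi>\<close>, chosen below the square of \<open>t\<close>,
    is negligible against \<open>t * x\<close>.\<close>
  have "\<exists>c\<in>{1, \<pi>}. le p (t ^ 3 * x) (c + x)"
  proof (cases "le p (t\<^sup>2) (1 + x)")
    case True
    have "le p (t\<^sup>2 * 1) (1 + x)" using True by simp
    moreover have "le p (t\<^sup>2 * (1 + x)) (1 + x)"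
      by (rule P.mult_le_one [OF P.power_le_one P.refl]) (rule P.t_le_one)
    ultimately have "le p (t * (t\<^sup>2 * (1 + x) + - (t\<^sup>2 * 1))) (1 + x)"
      by (intro P.add_le) auto
    then have "le p (t ^ 3 * x) (1 + x)" by (simp add: algebra_simps power_numeral_reduce power2_eq_square)
    then show ?thesis by blast
  next
    case False
    have tt: "le p (t\<^sup>2) t" using P.mult_le_one [OF P.t_le_one P.refl, of t] by (simp add: power2_eq_square)
    have "lt p (1 + x) t" using False tt by (rule P.less_le_trans)
    then have "lt p (- (1 + x)) (t * 1)" unfolding P.le_uminus_iff by simp
    from P.less_add_lower [OF this] have tx: "le p t x" by simp
    then have "le p (t\<^sup>2) (t * x)" using P.mult_left_iff [OF t, of t x] by (simp add: power2_eq_square)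
    then have "lt p \<pi> (t * x)" using \<pi>(2) P.less_le_trans by blast
    from P.less_add_lower [OF this] have "le p (t * x) (\<pi> + x)" by (simp add: add.commute)
    moreover have "le p (t\<^sup>2 * (t * x)) (t * x)"
      by (rule P.mult_le_one [OF P.power_le_one P.refl]) (rule P.t_le_one)
    ultimately have "le p (t ^ 3 * x) (\<pi> + x)"
      using P.trans by (simp add: power_numeral_reduce mult_ac)
    then show ?thesis by blast
  qed
  then obtain c where c: "c \<in> {1, \<pi>}" "le p (t ^ 3 * x) (c + x)" by blast
  have c0: "c \<noteq> 0" using c(1) \<pi>(1) by auto
  have cx: "c + x \<noteq> 0" using c(2) P.le_0D x0 t by (metis mult_eq_0_iff power_eq_0_iff)
  define X where "X = x / (c + x) * y"
  have "le p (x * y) (x * (t ^ 3 * b p))" by (rule P.mult_mono [OF P.refl y(2)])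
  moreover have "le p ((t ^ 3 * x) * b p) ((c + x) * b p)" by (rule P.mult_mono [OF c(2) P.refl])
  ultimately have "le p (x * y) (b p * (c + x))" using P.trans by (simp add: mult_ac)
  then have "le p X (b p)" using cx by (simp add: X_def P.divide_le_iff)
  moreover have "le q X (b q)" if q: "q \<in> F" for q
  proof -
    interpret Q: quasi_valuation "le q" t using quasi_valuation q insert.prems by auto
    have "le q (x / (c + x)) (x / (t * c))"
      by (rule Q.quotient_le(2)) (rule Q.le_less_trans [OF xq [OF q]], use d(2) [OF q c(1)] in blast)
    then have "le q X (x / (t * c) * y)" unfolding X_def by (rule Q.mult_mono) simp
    moreover have "le q x (b q * (t * c) / y)"
      using xq [OF q] d(2) [OF q c(1)] Q.trans Q.less_imp_le by blast
    then have "le q (x / (t * c) * y) (b q)"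
      using y(1) c0 t Q.divide_le_iff [of "t * c" "x * y" "b q"] by (simp add: Q.le_divide_iff)
    ultimately show ?thesis by (rule Q.trans)
  qed
  moreover have "le w 1 X"
  proof -
    have "le w (t * (c + x)) x" using xw [OF c(1)] by (intro W.add_le) auto
    then have "le w t (x / (c + x))" using cx by (simp add: W.le_divide_iff)
    then have "le w (t * y) X" unfolding X_def by (rule W.mult_mono) simp
    then show ?thesis using y(3) W.trans by blast
  qed
  moreover have "X \<noteq> 0" using x0 cx y(1) by (simp add: X_def)
  ultimately show ?case by auto
qed

text \<open>Take \<open>e = x / (s + x)\<close> where, up to the margins required, \<open>s\<close>
  is negligible against \<open>x\<close> at \<open>p\<close> and \<open>x\<close> is negligible
  against \<open>s\<close> at the other places.\<close>

lemma ex_near_one_small: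
  assumes "finite F" "F \<subseteq> S" "p \<in> F" "\<And>q. q \<in> F \<Longrightarrow> b q \<noteq> 0"
  shows "\<exists>e. lt p (e - 1) (b p) \<and> (\<forall>q\<in>F - {p}. lt q e (b q))"
proof -
  have pS: "p \<in> S" using assms by blast
  interpret P: quasi_valuation "le p" t by (rule quasi_valuation [OF pS])
  note t = P.t_nonzero
  obtain s where s: "s \<noteq> 0" "lt p s t" "lt p s (b p * t)"
    using ex_less [OF pS, of "{t, b p * t}"] assms(3,4) t by auto
  have "\<exists>d. d \<noteq> 0 \<and> lt q d t \<and> lt q d (b q * t)" if "q \<in> F" for q
    using ex_less [of q "{t, b q * t}"] assms(2,4) t that by auto
  then obtain d where d: "\<And>q. q \<in> F \<Longrightarrow> d q \<noteq> 0 \<and> lt q (d q) t \<and> lt q (d q) (b q * t)" by metis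
  obtain x where x: "x \<noteq> 0" "\<And>q. q \<in> F - {p} \<Longrightarrow> le q x (d q * s)" "le p 1 x"
  proof -
    have "\<exists>x. x \<noteq> 0 \<and> (\<forall>q\<in>F - {p}. le q x (d q * s)) \<and> le p 1 x"
      using assms(1,2) pS d s(1) by (intro ex_small_on_finite) auto
    then show thesis using that by blast
  qed
  define e where "e = x / (s + x)"
  have "lt p s (t * x)"
    using P.less_le_trans [OF s(2)] P.mult_mono [OF P.refl x(3), of t] by simp
  note q = P.quotient_le [OF this]
  have "le p (s / (t * x)) (s / t)"
    using P.mult_mono [OF P.refl x(3), of s] x(1) t P.divide_le_iff [of "t * x" s] by simp
  then have "lt p (s / (x + s)) (b p)"
    using q(2) s(3) t P.trans P.le_divide_iff P.le_less_trans by blast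
  moreover have "e - 1 = - (s / (x + s))" using q(1) by (simp add: e_def field_simps)
  ultimately have "lt p (e - 1) (b p)" by simp
  moreover have "lt q e (b q)" if "q \<in> F - {p}" for q
  proof -
    interpret Q: quasi_valuation "le q" t using quasi_valuation that assms by auto
    have "le q (x / s) (d q)" using x(2) [OF that] s(1) by (simp add: Q.divide_le_iff)
    then have *: "lt q (x / s) t" "lt q (x / s) (b q * t)" using d that Q.le_less_trans by blast+
    have "lt q x (t * s)" using *(1) s(1) by (simp add: Q.le_divide_iff)
    from Q.quotient_le(2) [OF this] have "le q e (x / s / t)" by (simp add: e_def mult.commute)
    moreover have "lt q (x / s / t) (b q)" using *(2) unfolding Q.le_divide_iff [OF t] .
    ultimately show ?thesis by (rule Q.le_less_trans)
  qed
  ultimately show ?thesis by blast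
qed

text \<open>Interpolation by the sum of all \<open>y i * e i\<close> with approximate indicators
  \<open>e i\<close>, whose accuracy is chosen relative to \<open>y i\<close>.\<close>

theorem finite_approximation:
  assumes "finite F" "F \<subseteq> S" "\<And>p. p \<in> F \<Longrightarrow> z p \<noteq> 0"
  shows "\<exists>x. \<forall>p\<in>F. lt p (x - y p) (z p)"
proof (cases "F = {}")
  case False
  then obtain p0 where "p0 \<in> F" by blast
  then interpret P0: quasi_valuation "le p0" t using quasi_valuation assms(2) by blast
  define c where "c = (\<lambda>q. t ^ card F * z q)"
  have c: "c q \<noteq> 0" if "q \<in> F" for q using that assms(3) P0.t_nonzero by (simp add: c_def)
  have "\<exists>e. lt p (e - 1) (if y p = 0 then 1 else c p / y p) \<and>
      (\<forall>q\<in>F - {p}. lt q e (if y p = 0 then 1 else c q / y p))" if "p \<in> F" for p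
    using ex_near_one_small [OF assms(1,2) that, of "\<lambda>q. if y p = 0 then 1 else c q / y p"] c by simp
  then obtain e where e: "\<And>p. p \<in> F \<Longrightarrow> lt p (e p - 1) (if y p = 0 then 1 else c p / y p)"
    "\<And>p q. p \<in> F \<Longrightarrow> q \<in> F - {p} \<Longrightarrow> lt q (e p) (if y p = 0 then 1 else c q / y p)"
    by metis
  have "lt p ((\<Sum>i\<in>F. y i * e i) - y p) (z p)" if p: "p \<in> F" for p
  proof -
    interpret P: quasi_valuation "le p" t using quasi_valuation p assms(2) by blast
    have "lt p (y p * (e p - 1)) (c p)"
      by (rule P.mult_less_of_less [OF e(1) [OF p] c [OF p]])
    moreover have "lt p (y i * e i) (c p)" if "i \<in> F" "i \<noteq> p" for i
      by (rule P.mult_less_of_less [OF e(2) c [OF p]]) (use that p in auto)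
    ultimately show ?thesis
      unfolding c_def by (intro P.sum_unity_less) (use assms(1,3) p in auto)
  qed
  then show ?thesis by blast
qed simp


section \<open>Convergence uniform in the place\<close>

text \<open>The place varies together with the point, and the fixed element
  \<open>\<epsilon>\<close> is compared at the varying place. This covers limits at a single place
  as well as limits along pairs of a nearby place and a nearby point.\<close>

definition tends :: "('v \<times> 'b) filter \<Rightarrow> ('b \<Rightarrow> 'a) \<Rightarrow> 'a \<Rightarrow> bool" where
  "tends F \<phi> c \<longleftrightarrow> (\<forall>\<epsilon>. \<epsilon> \<noteq> 0 \<longrightarrow> (\<forall>\<^sub>F (v, x) in F. v \<in> S \<and> lt v (\<phi> x - c) \<epsilon>))"

lemma tendsD: "tends F \<phi> c \<Longrightarrow> \<epsilon> \<noteq> 0 \<Longrightarrow> \<forall>\<^sub>F (v, x) in F. v \<in> S \<and> lt v (\<phi> x - c) \<epsilon>"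
  by (simp add: tends_def)

lemma tends_const:
  assumes "\<forall>\<^sub>F (v, x) in F. v \<in> S"
  shows "tends F (\<lambda>x. c) c"
  unfolding tends_def
proof (intro allI impI)
  fix \<epsilon> :: 'a assume \<epsilon>: "\<epsilon> \<noteq> 0"
  show "\<forall>\<^sub>F (v, x) in F. v \<in> S \<and> lt v (c - c) \<epsilon>"
    using assms
  proof eventually_elim
    case (elim vx)
    obtain v x where [simp]: "vx = (v, x)" by (cases vx)
    have "v \<in> S" using elim by simp
    then interpret quasi_valuation "le v" t by (rule quasi_valuation)
    show ?case using \<open>v \<in> S\<close> \<epsilon> by simp
  qed
qed

lemma tends_add:
  assumes "tends F \<phi> c" "tends F \<psi> d"
  shows "tends F (\<lambda>x. \<phi> x + \<psi> x) (c + d)"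
  unfolding tends_def
proof (intro allI impI)
  fix \<epsilon> :: 'a assume \<epsilon>: "\<epsilon> \<noteq> 0"
  show "\<forall>\<^sub>F (v, x) in F. v \<in> S \<and> lt v (\<phi> x + \<psi> x - (c + d)) \<epsilon>"
  \<comment> \<open>No place satisfies the axioms with \<open>t = 0\<close>. Then \<open>S\<close>
    is empty, and convergence says that a false property holds eventually.\<close>
  proof (cases "t = 0")
    case True
    have "v \<notin> S" for v using quasi_valuation [of v] True by (auto simp: quasi_valuation_def)
    then show ?thesis using tendsD [OF assms(1) \<epsilon>] by simp
  next
    case False
    then have "t * \<epsilon> \<noteq> 0" using \<epsilon> by simp
    from tendsD [OF assms(1) this] tendsD [OF assms(2) this] show ?thesis
    proof eventually_elim
      case (elim vx)
      obtain v x where [simp]: "vx = (v, x)" by (cases vx)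
      have v: "v \<in> S" using elim by simp
      interpret quasi_valuation "le v" t by (rule quasi_valuation [OF v])
      have "lt v (t * ((\<phi> x - c) + (\<psi> x - d))) (t * \<epsilon>)" using elim by (intro add_less) auto
      then have "lt v ((\<phi> x - c) + (\<psi> x - d)) \<epsilon>" unfolding mult_left_iff [OF False] .
      then show ?case using v by (simp add: algebra_simps)
    qed
  qed
qed

lemma tends_mult:
  assumes "tends F \<phi> c" "tends F \<psi> d"
  shows "tends F (\<lambda>x. \<phi> x * \<psi> x) (c * d)"
  unfolding tends_def
proof (intro allI impI)
  fix \<epsilon> :: 'a assume \<epsilon>: "\<epsilon> \<noteq> 0"
  show "\<forall>\<^sub>F (v, x) in F. v \<in> S \<and> lt v (\<phi> x * \<psi> x - c * d) \<epsilon>"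
  proof (cases "t = 0")
    case True
    have "v \<notin> S" for v using quasi_valuation [of v] True by (auto simp: quasi_valuation_def)
    then show ?thesis using tendsD [OF assms(1) \<epsilon>] by simp
  next
    case False
    \<comment> \<open>The difference of the products is a sum of three terms, two linear in the
      errors and one quadratic; two additions cost two factors \<open>t\<close>.\<close>
    define \<delta> where "\<delta> = t * (t * \<epsilon>)"
    have \<delta>: "\<delta> \<noteq> 0" using False \<epsilon> by (simp add: \<delta>_def)
    have nz: "(if c = 0 then 1 else \<delta> / c) \<noteq> 0" "(if d = 0 then 1 else \<delta> / d) \<noteq> 0" using \<delta> by auto
    from tendsD [OF assms(1) one_neq_zero] tendsD [OF assms(1) nz(2)]
      tendsD [OF assms(2) \<delta>] tendsD [OF assms(2) nz(1)] show ?thesis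
    proof eventually_elim
      case (elim vx)
      obtain v x where [simp]: "vx = (v, x)" by (cases vx)
      have v: "v \<in> S" using elim by simp
      interpret quasi_valuation "le v" t by (rule quasi_valuation [OF v])
      have "lt v (c * (\<psi> x - d)) \<delta>" by (rule mult_less_of_less [OF _ \<delta>]) (use elim in simp)
      moreover have "lt v (d * (\<phi> x - c)) \<delta>" by (rule mult_less_of_less [OF _ \<delta>]) (use elim in simp)
      ultimately have "lt v (t * (c * (\<psi> x - d) + d * (\<phi> x - c))) \<delta>" by (rule add_less)
      then have 1: "lt v (c * (\<psi> x - d) + d * (\<phi> x - c)) (t * \<epsilon>)"
        by (simp add: \<delta>_def mult_left_iff [OF False])
      have "lt v ((\<phi> x - c) * (\<psi> x - d)) \<delta>"
        by (rule mult_le_one_less) (use elim less_imp_le in auto)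
      moreover have "le v \<delta> (t * \<epsilon>)" unfolding \<delta>_def by (rule mult_le_one [OF t_le_one refl])
      ultimately have 2: "lt v ((\<phi> x - c) * (\<psi> x - d)) (t * \<epsilon>)" by (rule less_le_trans)
      have "lt v (t * ((c * (\<psi> x - d) + d * (\<phi> x - c)) + (\<phi> x - c) * (\<psi> x - d))) (t * \<epsilon>)"
        by (rule add_less [OF 1 2])
      moreover have "(c * (\<psi> x - d) + d * (\<phi> x - c)) + (\<phi> x - c) * (\<psi> x - d) = \<phi> x * \<psi> x - c * d"
        by (simp add: algebra_simps)
      ultimately show ?case using v by (simp add: mult_left_iff [OF False])
    qed
  qed
qed

lemma tends_inverse:
  assumes "tends F \<phi> c" "c \<noteq> 0"
  shows "\<forall>\<^sub>F (v, x) in F. \<phi> x \<noteq> 0" "tends F (\<lambda>x. inverse (\<phi> x)) (inverse c)"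
proof -
  have *: "\<forall>\<^sub>F (v, x) in F. v \<in> S \<and> \<phi> x \<noteq> 0 \<and> lt v (inverse (\<phi> x) - inverse c) \<epsilon>" if \<epsilon>: "\<epsilon> \<noteq> 0" for \<epsilon>
  proof (cases "t = 0")
    case True
    have "v \<notin> S" for v using quasi_valuation [of v] True by (auto simp: quasi_valuation_def)
    then show ?thesis using tendsD [OF assms(1) \<epsilon>] by simp
  next
    case False
    have nz: "t * c \<noteq> 0" "\<epsilon> * (t * c * c) \<noteq> 0" using False \<epsilon> assms(2) by auto
    from tendsD [OF assms(1) nz(1)] tendsD [OF assms(1) nz(2)] show ?thesis
    proof eventually_elim
      case (elim vx)
      obtain v x where [simp]: "vx = (v, x)" by (cases vx)
      have v: "v \<in> S" using elim by simp
      interpret quasi_valuation "le v" t by (rule quasi_valuation [OF v])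
      have le: "le v (t * c) (\<phi> x)" using less_add_lower [where x = c and y = "\<phi> x - c"] elim by simp
      then have \<phi>: "\<phi> x \<noteq> 0" using nz(1) by auto
      have "lt v (- (\<phi> x - c)) (\<epsilon> * (t * c * c))" unfolding le_uminus_iff using elim by simp
      also have "le v (\<epsilon> * (t * c * c)) (\<epsilon> * (\<phi> x * c))"
        by (intro mult_mono le refl)
      finally (less_le_trans) have "lt v (- (\<phi> x - c)) (\<epsilon> * (\<phi> x * c))" .
      then have "lt v (- (\<phi> x - c) / (\<phi> x * c)) \<epsilon>"
        using \<phi> assms(2) by (subst le_divide_iff) auto
      moreover have "- (\<phi> x - c) / (\<phi> x * c) = inverse (\<phi> x) - inverse c"
        using \<phi> assms(2) by (simp add: field_simps)
      ultimately show ?case using v \<phi> by simp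
    qed
  qed
  show "\<forall>\<^sub>F (v, x) in F. \<phi> x \<noteq> 0" using * [of 1] by (auto elim: eventually_mono)
  show "tends F (\<lambda>x. inverse (\<phi> x)) (inverse c)"
    unfolding tends_def by (auto intro: eventually_mono [OF *])
qed

end

section \<open>Compact sets of places\<close>

context place_family
begin

text \<open>Compactness tested only on covers by sets of the form "\<open>c v\<close> is smaller
  than 1", each indexed by a point that it contains. Such sets are open in the constructible
  topology, and every covering argument below uses a cover of this kind.\<close>

definition qcompact :: "'v set \<Rightarrow> bool" where
  "qcompact X \<longleftrightarrow>
     (\<forall>c. (\<forall>v\<in>X. lt v (c v) 1) \<longrightarrow> (\<exists>V. finite V \<and> V \<subseteq> X \<and> (\<forall>w\<in>X. \<exists>v\<in>V. lt w (c v) 1)))"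

lemma qcompactD:
  assumes "qcompact X" "\<And>v. v \<in> X \<Longrightarrow> lt v (c v) 1"
  obtains V where "finite V" "V \<subseteq> X" "\<And>w. w \<in> X \<Longrightarrow> \<exists>v\<in>V. lt w (c v) 1"
  using assms unfolding qcompact_def by metis

lemma qcompact_finite: "finite X \<Longrightarrow> qcompact X"
  unfolding qcompact_def by (intro allI impI exI [of _ X]) auto

lemma qcompact_UN:
  assumes "finite I" "\<And>i. i \<in> I \<Longrightarrow> qcompact (X i)"
  shows "qcompact (\<Union>i\<in>I. X i)"
  unfolding qcompact_def
proof (intro allI impI)
  fix c assume c: "\<forall>v\<in>(\<Union>i\<in>I. X i). lt v (c v) 1"
  have "\<exists>V. finite V \<and> V \<subseteq> X i \<and> (\<forall>w\<in>X i. \<exists>v\<in>V. lt w (c v) 1)" if i: "i \<in> I" for i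
  proof (rule qcompactD [OF assms(2) [OF i], of c])
    show "lt v (c v) 1" if "v \<in> X i" for v using c i that by blast
  qed (intro exI conjI ballI)
  then have "\<exists>V. \<forall>i\<in>I. finite (V i) \<and> V i \<subseteq> X i \<and> (\<forall>w\<in>X i. \<exists>v\<in>V i. lt w (c v) 1)"
    by (intro bchoice ballI)
  then obtain V where V: "\<forall>i\<in>I. finite (V i) \<and> V i \<subseteq> X i \<and> (\<forall>w\<in>X i. \<exists>v\<in>V i. lt w (c v) 1)" ..
  show "\<exists>V. finite V \<and> V \<subseteq> (\<Union>i\<in>I. X i) \<and> (\<forall>w\<in>(\<Union>i\<in>I. X i). \<exists>v\<in>V. lt w (c v) 1)"
  proof (intro exI [of _ "\<Union>i\<in>I. V i"] conjI ballI)
    show "finite (\<Union>i\<in>I. V i)" using assms(1) V by blast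
    show "(\<Union>i\<in>I. V i) \<subseteq> (\<Union>i\<in>I. X i)" using V by fast
    fix w assume "w \<in> (\<Union>i\<in>I. X i)"
    then obtain i where "i \<in> I" "w \<in> X i" by blast
    then show "\<exists>v\<in>(\<Union>i\<in>I. V i). lt w (c v) 1" using V by (meson UN_I)
  qed
qed

end

section \<open>Truncation by the polynomial\<close>

text \<open>\<open>f_large\<close> keeps only quadratic growth from condition (iii), and
  \<open>G\<close> is a set of places at which condition (ii) holds.\<close>

locale uniform_place_family = place_family le S t
  for le :: "'v \<Rightarrow> 'a::field \<Rightarrow> 'a \<Rightarrow> bool" and S t +
  fixes f :: "'a poly" and G :: "'v set"
  assumes f_le_one: "v \<in> S \<Longrightarrow> le v x 1 \<Longrightarrow> le v (poly f x) 1"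
    and f_large: "v \<in> S \<Longrightarrow> lt v 1 x \<Longrightarrow> le v (t * x\<^sup>2) (poly f x)"
    and G_subset: "G \<subseteq> S"
    and G_nonempty: "G \<noteq> {}"
    and f_good: "v \<in> G \<Longrightarrow> le v x 1 \<Longrightarrow> le v t (poly f x)"
begin

lemma quasi_valuation_G: "v \<in> G \<Longrightarrow> quasi_valuation (le v) t"
  using quasi_valuation G_subset by blast

lemma t_nonzero: "t \<noteq> 0"
  using quasi_valuation_G G_nonempty by (auto simp: quasi_valuation_def)

lemma t_le_f:
  assumes "v \<in> G"
  shows "le v t (poly f x)"
proof (cases "le v x 1")
  case False
  interpret quasi_valuation "le v" t by (rule quasi_valuation_G [OF assms])
  have "le v (1\<^sup>2) (x\<^sup>2)" using power_mono less_imp_le [OF False] by blast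
  then have "le v t (t * x\<^sup>2)" using mult_mono [OF refl, of 1 "x\<^sup>2" t] by simp
  then show ?thesis using f_large False assms G_subset trans by blast
qed (use f_good assms in blast)

lemma f_nonzero: "poly f x \<noteq> 0"
proof -
  obtain v where v: "v \<in> G" using G_nonempty by blast
  interpret quasi_valuation "le v" t by (rule quasi_valuation_G [OF v])
  show ?thesis using t_le_f [OF v, of x] t_nonzero by auto
qed

text \<open>A bounded substitute for the identity: \<open>\<psi> u\<close> is small where \<open>u\<close> is small, and of size between \<open>t\<close> and \<open>1\<close>
  where \<open>u\<close> is not.\<close>

definition \<psi> :: "'a \<Rightarrow> 'a" where "\<psi> u = t / poly f (1 / u)"

lemma psi_nonzero: "\<psi> u \<noteq> 0"
  using f_nonzero t_nonzero by (simp add: \<psi>_def)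

lemma psi_le_one:
  assumes "v \<in> G"
  shows "le v (\<psi> u) 1"
proof -
  interpret quasi_valuation "le v" t by (rule quasi_valuation_G [OF assms])
  show ?thesis unfolding \<psi>_def divide_le_iff [OF f_nonzero] using t_le_f [OF assms] by simp
qed

text \<open>For \<open>1 / u\<close> outside the integral elements, \<open>f_large\<close> bounds
  the denominator of \<open>\<psi> u\<close> from below by t times the square of
  \<open>1 / u\<close>. This quadratic decay is what \<open>separates_Un\<close> lives on.\<close>

lemma psi_le_square:
  assumes "v \<in> G" "le v u 1" "u \<noteq> 0"
  shows "le v (\<psi> u) (u\<^sup>2)"
proof -
  interpret quasi_valuation "le v" t by (rule quasi_valuation_G [OF assms(1)])
  show ?thesis
  proof (cases "le v (1 / u) 1")
    case True
    then have "le v 1 u" using assms(3) by (simp add: divide_le_iff)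
    then have "le v (1\<^sup>2) (u\<^sup>2)" by (rule power_mono)
    then have "le v 1 (u\<^sup>2)" by simp
    with psi_le_one [OF assms(1)] show ?thesis by (rule trans)
  next
    case False
    then have "le v (t * (1 / u)\<^sup>2) (poly f (1 / u))" using f_large assms(1) G_subset by blast
    then have "le v (t * (1 / u)\<^sup>2 * u\<^sup>2) (poly f (1 / u) * u\<^sup>2)" by (rule mult_right)
    then have "le v t (u\<^sup>2 * poly f (1 / u))" using assms(3) by (simp add: power_divide mult.commute)
    then show ?thesis by (simp add: \<psi>_def divide_le_iff f_nonzero)
  qed
qed

lemma psi_le:
  assumes "v \<in> G" "u \<noteq> 0"
  shows "le v (\<psi> u) u"
proof -
  interpret quasi_valuation "le v" t by (rule quasi_valuation_G [OF assms(1)])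
  show ?thesis
  proof (cases "le v u 1")
    case True
    have "le v (u * u) u" by (rule mult_le_one [OF True refl])
    then show ?thesis using psi_le_square [OF assms(1) True assms(2)] trans by (simp add: power2_eq_square)
  next
    case False
    then show ?thesis using psi_le_one [OF assms(1)] less_imp_le trans by blast
  qed
qed

lemma le_psi:
  assumes "v \<in> S" "le v 1 u"
  shows "le v t (\<psi> u)"
proof -
  interpret quasi_valuation "le v" t by (rule quasi_valuation [OF assms(1)])
  have "u \<noteq> 0" using assms(2) by auto
  then have "le v (poly f (1 / u)) 1"
    using assms by (intro f_le_one) (simp_all add: divide_le_iff)
  from mult_mono [OF refl this, of t] show ?thesis by (simp add: \<psi>_def le_divide_iff f_nonzero)
qed

lemma prod_le:
  assumes "v \<in> G" "finite V" "w \<in> V" "\<And>a. a \<in> V \<Longrightarrow> le v (u a) 1"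
  shows "le v (prod u V) (u w)"
proof -
  interpret quasi_valuation "le v" t by (rule quasi_valuation_G [OF assms(1)])
  have "le v (prod u A) 1" if "A \<subseteq> V" for A
    using finite_subset [OF that assms(2)] that
    by (induction A) (auto intro!: mult_le_one assms(4))
  then have "le v (prod u (V - {w})) 1" by simp
  from mult_le_one [OF this refl [of "u w"]] show ?thesis
    using assms(2,3) by (simp add: prod.remove mult.commute)
qed

text \<open>The level on \<open>A\<close> is \<open>t\<close> and not 1 because \<open>t\<close> is
  the lower bound that \<open>le_psi\<close> guarantees; each construction below returns to this
  level.\<close>

definition separates :: "'a \<Rightarrow> 'v set \<Rightarrow> 'v set \<Rightarrow> bool" where
  "separates b A B \<longleftrightarrow>
     (\<exists>u. u \<noteq> 0 \<and> (\<forall>v\<in>G. le v u 1) \<and> (\<forall>v\<in>A. le v t u) \<and> (\<forall>v\<in>B. le v u b))"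

lemma separates_psi:
  assumes "A \<subseteq> G" "B \<subseteq> G" "x \<noteq> 0" "\<And>v. v \<in> A \<Longrightarrow> le v 1 x" "\<And>v. v \<in> B \<Longrightarrow> le v x b"
  shows "separates b A B"
  unfolding separates_def
proof (intro exI conjI ballI)
  show "\<psi> x \<noteq> 0" by (rule psi_nonzero)
  show "le v (\<psi> x) 1" if "v \<in> G" for v using that by (rule psi_le_one)
  show "le v t (\<psi> x)" if "v \<in> A" for v using le_psi assms that G_subset by blast
  fix v assume v: "v \<in> B"
  interpret quasi_valuation "le v" t using quasi_valuation_G v assms(2) by blast
  show "le v (\<psi> x) b" using psi_le [OF _ assms(3)] assms(2,5) v trans by blast
qed

lemma separates_empty: "A \<subseteq> G \<Longrightarrow> separates b A {}"
proof (rule separates_psi [of _ _ 1])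
  fix v assume "A \<subseteq> G" "v \<in> A"
  then interpret quasi_valuation "le v" t using quasi_valuation_G by blast
  show "le v 1 1" by simp
qed auto

text \<open>The product of the two elements is divided by the square of \<open>t\<close> and
  truncated. On \<open>A\<close> the quotient is at least 1, so truncation gives \<open>t\<close>.
  On \<open>B\<close> and \<open>C\<close> it is at most the square of \<open>t\<close>, because
  \<open>b\<close> is below \<open>t ^ 4\<close>; its own square is then at most the product itself,
  hence at most \<open>b\<close>.\<close>

lemma separates_Un:
  assumes "A \<subseteq> G" "B \<subseteq> G" "C \<subseteq> G" "\<And>v. v \<in> G \<Longrightarrow> le v b (t ^ 4)"
    and "separates b A B" "separates b A C"
  shows "separates b A (B \<union> C)"
proof -
  obtain u where u: "u \<noteq> 0" "\<And>v. v \<in> G \<Longrightarrow> le v u 1" "\<And>v. v \<in> A \<Longrightarrow> le v t u" "\<And>v. v \<in> B \<Longrightarrow> le v u b"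
    using assms(5) unfolding separates_def by blast
  obtain u' where u': "u' \<noteq> 0" "\<And>v. v \<in> G \<Longrightarrow> le v u' 1" "\<And>v. v \<in> A \<Longrightarrow> le v t u'"
      "\<And>v. v \<in> C \<Longrightarrow> le v u' b"
    using assms(6) unfolding separates_def by blast
  define x where "x = u * u' / t\<^sup>2"
  have x0: "x \<noteq> 0" using u(1) u'(1) t_nonzero by (simp add: x_def)
  have "le v t (\<psi> x)" if v: "v \<in> A" for v
  proof -
    interpret quasi_valuation "le v" t using quasi_valuation_G v assms(1) by blast
    have "le v (t * t) (u * u')" by (intro mult_mono u(3) u'(3) v)
    then have "le v 1 x" using t_nonzero by (simp add: x_def le_divide_iff power2_eq_square)
    then show ?thesis using le_psi v assms(1) G_subset by blast
  qed
  moreover have "le v (\<psi> x) b" if v: "v \<in> B \<union> C" for v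
  proof -
    have vG: "v \<in> G" using v assms(2,3) by blast
    interpret quasi_valuation "le v" t using quasi_valuation_G [OF vG] .
    have uu: "le v (u * u') b"
      using v mult_mono [OF u(4) u'(2) [OF vG]] mult_mono [OF u(2) [OF vG] u'(4)] by auto
    then have "le v (u * u') (t ^ 4)" using assms(4) [OF vG] trans by blast
    then have xt: "le v x (t\<^sup>2)"
      using t_nonzero by (simp add: x_def divide_le_iff flip: power_add)
    have "le v (t\<^sup>2) 1" by (rule power_le_one [OF t_le_one])
    with xt have x1: "le v x 1" by (rule trans)
    have "le v (x * t\<^sup>2) b" using uu t_nonzero by (simp add: x_def)
    moreover have "le v (x * x) (x * t\<^sup>2)" by (rule mult_mono [OF refl xt])
    moreover have "le v (\<psi> x) (x * x)" using psi_le_square [OF vG x1 x0] by (simp add: power2_eq_square)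
    ultimately show ?thesis using trans by blast
  qed
  ultimately show ?thesis
    unfolding separates_def using psi_nonzero psi_le_one by blast
qed

lemma separates_UN:
  assumes "finite V" "A \<subseteq> G" "\<And>v. v \<in> G \<Longrightarrow> le v b (t ^ 4)"
    and "\<And>a. a \<in> V \<Longrightarrow> B a \<subseteq> G" "\<And>a. a \<in> V \<Longrightarrow> separates b A (B a)"
  shows "separates b A (\<Union>a\<in>V. B a)"
  using assms(1,4,5)
proof (induction V)
  case (insert a V)
  then have "separates b A (B a \<union> (\<Union>a\<in>V. B a))"
    using assms(2,3) by (intro separates_Un) auto
  then show ?case by simp
qed (use separates_empty assms in simp)

lemma separates_mono: "separates b A B \<Longrightarrow> A' \<subseteq> A \<Longrightarrow> B' \<subseteq> B \<Longrightarrow> separates b A' B'"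
  unfolding separates_def by blast

text \<open>The quotient \<open>b * t / u\<close> is at least 1 where \<open>u\<close> is at most
  \<open>b * t\<close>, and at most \<open>b\<close> where \<open>u\<close> is at least
  \<open>t\<close>. Truncation makes it bounded on all of \<open>G\<close>, at the price of the
  factor \<open>t\<close> in the hypothesis.\<close>

lemma separates_swap:
  assumes "A \<subseteq> G" "B \<subseteq> G" "b \<noteq> 0" "separates (b * t) A B"
  shows "separates b B A"
proof -
  obtain u where u: "u \<noteq> 0" "\<And>v. v \<in> A \<Longrightarrow> le v t u" "\<And>v. v \<in> B \<Longrightarrow> le v u (b * t)"
    using assms(4) unfolding separates_def by blast
  show ?thesis
  proof (rule separates_psi [of _ _ "b * t / u"])
    show "b * t / u \<noteq> 0" using u(1) assms(3) t_nonzero by simp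
  next
    fix v assume v: "v \<in> B"
    then interpret quasi_valuation "le v" t using quasi_valuation_G assms(2) by blast
    show "le v 1 (b * t / u)" using u(3) [OF v] u(1) by (simp add: le_divide_iff)
  next
    fix v assume v: "v \<in> A"
    then interpret quasi_valuation "le v" t using quasi_valuation_G assms(1) by blast
    show "le v (b * t / u) b" using mult_mono [OF refl u(2) [OF v]] u(1) by (simp add: divide_le_iff)
  qed (fact assms)+
qed

end

section \<open>Separation of disjoint compact sets\<close>

locale compact_place_family = uniform_place_family le S t f G
  for le :: "'v \<Rightarrow> 'a::field \<Rightarrow> 'a \<Rightarrow> bool" and S t f G +
  assumes G_compact: "qcompact G"
begin

text \<open>A product of truncations over a finite subcover: all factors are at most 1, and at each
  place one of them is smaller than 1.\<close>

lemma ex_less_one: "\<exists>\<pi>. \<pi> \<noteq> 0 \<and> (\<forall>v\<in>G. lt v \<pi> 1)"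
proof -
  have "\<exists>x. x \<noteq> 0 \<and> lt v x 1" if "v \<in> G" for v using nontrivial that G_subset by blast
  then obtain x where x: "\<And>v. v \<in> G \<Longrightarrow> x v \<noteq> 0 \<and> lt v (x v) 1" by metis
  obtain V where V: "finite V" "V \<subseteq> G" "\<And>w. w \<in> G \<Longrightarrow> \<exists>v\<in>V. lt w (x v) 1"
    using qcompactD [OF G_compact, of x] x by blast
  have "lt w (\<Prod>v\<in>V. \<psi> (x v)) 1" if w: "w \<in> G" for w
  proof -
    interpret quasi_valuation "le w" t by (rule quasi_valuation_G [OF w])
    obtain v where v: "v \<in> V" "lt w (x v) 1" using V w by blast
    have "le w (\<Prod>v\<in>V. \<psi> (x v)) (\<psi> (x v))" by (rule prod_le [OF w V(1) v(1)]) (rule psi_le_one [OF w])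
    also have "le w (\<psi> (x v)) (x v)" by (rule psi_le [OF w]) (use x v V in blast)
    finally show ?thesis using v(2) by (rule le_less_trans)
  qed
  moreover have "(\<Prod>v\<in>V. \<psi> (x v)) \<noteq> 0" using V(1) psi_nonzero by simp
  ultimately show ?thesis by blast
qed

definition \<pi> :: 'a where "\<pi> = (SOME \<pi>. \<pi> \<noteq> 0 \<and> (\<forall>v\<in>G. lt v \<pi> 1))"

lemma pi: "\<pi> \<noteq> 0" "v \<in> G \<Longrightarrow> lt v \<pi> 1"
  using someI_ex [OF ex_less_one] unfolding \<pi>_def by auto

text \<open>Converts weak bounds into strict ones, the form in which \<open>qcompact\<close> accepts
  them.\<close>

lemma pi_mult_less:
  assumes "v \<in> G" "b \<noteq> 0"
  shows "lt v (b * \<pi>) b"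
proof -
  interpret quasi_valuation "le v" t by (rule quasi_valuation_G [OF assms(1)])
  show ?thesis using mult_less_le [OF pi(2) [OF assms(1)] refl assms(2)] by (simp add: mult.commute)
qed

text \<open>Independence gives, for each place of \<open>B\<close>, an element that is small there
  and at least 1 at \<open>v\<close>. It stays small on a neighbourhood, finitely many
  neighbourhoods cover \<open>B\<close>, and \<open>separates_UN\<close> merges them without
  loss.\<close>

lemma separates_point:
  assumes "v \<in> G" "B \<subseteq> G" "v \<notin> B" "qcompact B" "b \<noteq> 0" "\<And>v. v \<in> G \<Longrightarrow> le v b (t ^ 4)"
  shows "separates b {v} B"
proof -
  have "\<exists>x. x \<noteq> 0 \<and> le w x (b * \<pi>) \<and> le v 1 x" if "w \<in> B" for w
    using independent [of v w "b * \<pi>"] that assms pi(1) G_subset by auto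
  then obtain x where x: "\<And>w. w \<in> B \<Longrightarrow> x w \<noteq> 0 \<and> le w (x w) (b * \<pi>) \<and> le v 1 (x w)" by metis
  have lt: "lt w (a / b) 1 \<longleftrightarrow> lt w a b" if "w \<in> B" for w a
  proof -
    interpret quasi_valuation "le w" t using quasi_valuation_G that assms(2) by blast
    show ?thesis using assms(5) by (simp add: le_divide_iff)
  qed
  have "lt w (x w / b) 1" if w: "w \<in> B" for w
  proof -
    interpret quasi_valuation "le w" t using quasi_valuation_G w assms(2) by blast
    show ?thesis unfolding lt [OF w]
      by (rule le_less_trans [OF _ pi_mult_less]) (use x [OF w] w assms(2,5) in auto)
  qed
  from qcompactD [OF assms(4) this] obtain V where V: "finite V" "V \<subseteq> B"
      "\<And>w. w \<in> B \<Longrightarrow> \<exists>a\<in>V. lt w (x a / b) 1" by blast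
  have "separates b {v} {w \<in> B. lt w (x a) b}" if "a \<in> V" for a
  proof (rule separates_psi [of _ _ "x a"])
    fix w assume w: "w \<in> {w \<in> B. lt w (x a) b}"
    then interpret quasi_valuation "le w" t using quasi_valuation_G assms(2) by blast
    show "le w (x a) b" using w less_imp_le by blast
  qed (use assms x that V in auto)
  then have "separates b {v} (\<Union>a\<in>V. {w \<in> B. lt w (x a) b})"
    using V assms by (intro separates_UN) auto
  then show ?thesis by (rule separates_mono) (use V lt in auto)
qed

text \<open>Compactness can enlarge only the side on which elements are small. So each point of
  \<open>A\<close> is separated from \<open>B\<close> as the large side, the sides are exchanged,
  and then the points of \<open>A\<close> are the ones to be covered. The exchange costs a factor
  \<open>t\<close> and strictness a factor \<open>\<pi>\<close>.\<close>

lemma separates: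
  assumes "A \<subseteq> G" "B \<subseteq> G" "A \<inter> B = {}" "qcompact A" "qcompact B" "b \<noteq> 0"
    and "\<And>v. v \<in> G \<Longrightarrow> le v b (t ^ 4)"
  shows "separates b B A"
proof -
  have le: "le v (b * \<pi> * t) (t ^ 4)" "le v (b * \<pi>) (t ^ 4)" if "v \<in> G" for v
  proof -
    interpret quasi_valuation "le v" t by (rule quasi_valuation_G [OF that])
    show *: "le v (b * \<pi>) (t ^ 4)"
      using mult_le_one [OF less_imp_le [OF pi(2) [OF that]] assms(7) [OF that]] by (simp add: mult.commute)
    show "le v (b * \<pi> * t) (t ^ 4)"
      using mult_le_one [OF t_le_one *] by (simp add: mult.commute)
  qed
  have "separates (b * \<pi>) B {v}" if v: "v \<in> A" for v
  proof (rule separates_swap)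
    show "separates (b * \<pi> * t) {v} B"
      using v assms le pi(1) t_nonzero by (intro separates_point) auto
  qed (use v assms pi in auto)
  then obtain u where u: "\<And>v. v \<in> A \<Longrightarrow> u v \<noteq> 0 \<and> (\<forall>w\<in>G. le w (u v) 1) \<and> (\<forall>w\<in>B. le w t (u v)) \<and>
      le v (u v) (b * \<pi>)"
    unfolding separates_def by simp metis
  have lt: "lt w (a / b) 1 \<longleftrightarrow> lt w a b" if "w \<in> A" for w a
  proof -
    interpret quasi_valuation "le w" t using quasi_valuation_G that assms(1) by blast
    show ?thesis using assms(6) by (simp add: le_divide_iff)
  qed
  have "lt w (u w / b) 1" if w: "w \<in> A" for w
  proof -
    interpret quasi_valuation "le w" t using quasi_valuation_G w assms(1) by blast
    show ?thesis unfolding lt [OF w]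
      by (rule le_less_trans [OF _ pi_mult_less]) (use u [OF w] w assms(1,6) in auto)
  qed
  from qcompactD [OF assms(4) this] obtain V where V: "finite V" "V \<subseteq> A"
      "\<And>w. w \<in> A \<Longrightarrow> \<exists>a\<in>V. lt w (u a / b) 1" by blast
  have "separates b B {w \<in> A. lt w (u a) b}" if "a \<in> V" for a
    unfolding separates_def
  proof (intro exI [of _ "u a"] conjI ballI)
    fix w assume w: "w \<in> {w \<in> A. lt w (u a) b}"
    then interpret quasi_valuation "le w" t using quasi_valuation_G assms(1) by blast
    show "le w (u a) b" using w less_imp_le by blast
  qed (use u that V in auto)
  then have "separates b B (\<Union>a\<in>V. {w \<in> A. lt w (u a) b})"
    using V assms by (intro separates_UN) auto
  then show ?thesis by (rule separates_mono) (use V lt in auto)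
qed

lemma ex_near_one_small_compact:
  assumes "A \<inter> B = {}" "A \<union> B = G" "qcompact A" "qcompact B" "\<beta> \<noteq> 0"
  shows "\<exists>e. (\<forall>v\<in>A. lt v (e - 1) \<beta>) \<and> (\<forall>v\<in>B. lt v e \<beta>)"
proof -
  note t = t_nonzero
  \<comment> \<open>Lies strictly below both \<open>\<beta>\<close> and 1 throughout
    \<open>G\<close>, whatever the size of \<open>\<beta>\<close> at the individual places.\<close>
  define \<gamma> where "\<gamma> = \<psi> \<beta> * \<pi>"
  have \<gamma>0: "\<gamma> \<noteq> 0" using psi_nonzero pi(1) by (simp add: \<gamma>_def)
  have \<gamma>: "lt v \<gamma> \<beta>" "lt v \<gamma> 1" if "v \<in> G" for v
  proof -
    interpret quasi_valuation "le v" t by (rule quasi_valuation_G [OF that])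
    have "lt v \<gamma> (\<psi> \<beta>)" unfolding \<gamma>_def by (rule pi_mult_less [OF that psi_nonzero])
    then show "lt v \<gamma> \<beta>" "lt v \<gamma> 1"
      using less_le_trans [OF _ psi_le [OF that assms(5)]] less_le_trans [OF _ psi_le_one [OF that]] by auto
  qed
  \<comment> \<open>Chosen against the guaranteed lower bound \<open>t\<close> of \<open>u\<close>
    on \<open>A\<close>: there \<open>c\<close> is below \<open>t * u\<close>, and the quotient of
    the two is at most \<open>\<gamma>\<close>.\<close>
  define c where "c = \<gamma> * t\<^sup>2"
  have c0: "c \<noteq> 0" using \<gamma>0 t by (simp add: c_def)
  \<comment> \<open>Meets two demands at once: below \<open>t ^ 4\<close>, as
    \<open>separates\<close> requires, and below \<open>\<gamma> * (t * c)\<close>, so that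
    \<open>u\<close> is negligible against \<open>c\<close> on \<open>B\<close>.\<close>
  define b where "b = t ^ 4 * \<psi> (\<gamma> * (t * c))"
  have b: "le v b (t ^ 4)" "le v b (\<gamma> * (t * c))" if "v \<in> G" for v
  proof -
    interpret quasi_valuation "le v" t by (rule quasi_valuation_G [OF that])
    show "le v b (t ^ 4)"
      using mult_le_one [OF psi_le_one [OF that] refl] by (simp add: b_def mult.commute)
    show "le v b (\<gamma> * (t * c))"
      unfolding b_def using \<gamma>0 c0 t
      by (intro mult_le_one power_le_one t_le_one psi_le that) simp
  qed
  have "separates b A B"
    using assms b by (intro separates) (auto simp: b_def t psi_nonzero)
  then obtain u where u: "u \<noteq> 0" "\<And>v. v \<in> A \<Longrightarrow> le v t u" "\<And>v. v \<in> B \<Longrightarrow> le v u b"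
    unfolding separates_def by blast
  define e where "e = u / (c + u)"
  have "lt v (e - 1) \<beta>" if v: "v \<in> A" for v
  proof -
    have vG: "v \<in> G" using v assms(2) by blast
    interpret quasi_valuation "le v" t by (rule quasi_valuation_G [OF vG])
    have tu: "le v (t * t) (t * u)" by (rule mult_mono [OF refl u(2) [OF v]])
    have "lt v c (1 * t\<^sup>2)" unfolding c_def
      by (rule mult_less_le [OF \<gamma>(2) [OF vG]]) (use t in auto)
    then have "lt v c (t * t)" by (simp add: power2_eq_square)
    from less_le_trans [OF this tu] have "lt v c (t * u)" .
    note q = quotient_le [OF this]
    have "le v c (\<gamma> * (t * u))" unfolding c_def using mult_mono [OF refl tu, of \<gamma>] by (simp add: power2_eq_square)
    then have "le v (c / (t * u)) \<gamma>" using t u(1) by (simp add: divide_le_iff)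
    with q(2) have "le v (c / (u + c)) \<gamma>" by (rule trans)
    then have "le v (- (c / (u + c))) \<gamma>" unfolding uminus_le_iff .
    moreover have "e - 1 = - (c / (u + c))" using q(1) by (simp add: e_def field_simps)
    ultimately show ?thesis using le_less_trans [OF _ \<gamma>(1) [OF vG]] by metis
  qed
  moreover have "lt v e \<beta>" if v: "v \<in> B" for v
  proof -
    have vG: "v \<in> G" using v assms(2) by blast
    interpret quasi_valuation "le v" t by (rule quasi_valuation_G [OF vG])
    have le: "le v u (\<gamma> * (t * c))" using u(3) [OF v] b(2) [OF vG] by (rule trans)
    moreover have "lt v (\<gamma> * (t * c)) (1 * (t * c))"
      by (rule mult_less_le [OF \<gamma>(2) [OF vG]]) (use t c0 in auto)
    ultimately have "lt v u (1 * (t * c))" by (rule le_less_trans)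
    then have "lt v u (t * c)" by simp
    note q = quotient_le [OF this]
    have "le v (u / (t * c)) \<gamma>" using le t c0 by (simp add: divide_le_iff)
    with q(2) have "le v e \<gamma>" unfolding e_def by (rule trans)
    then show ?thesis using \<gamma>(1) [OF vG] by (rule le_less_trans)
  qed
  ultimately show ?thesis by blast
qed

lemma compact_approximation:
  assumes "finite I" "(\<Union>k\<in>I. X k) = G" "disjoint_family_on X I" "\<And>k. k \<in> I \<Longrightarrow> qcompact (X k)"
    and "z \<noteq> 0"
  shows "\<exists>x. \<forall>k\<in>I. \<forall>v\<in>X k. lt v (x - y k) z"
proof -
  define c where "c = t ^ card I * z"
  have c: "c \<noteq> 0" using t_nonzero assms(5) by (simp add: c_def)
  define \<beta> where "\<beta> = (\<lambda>k. if y k = 0 then 1 else c / y k)"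
  have "\<exists>e. (\<forall>v\<in>X k. lt v (e - 1) (\<beta> k)) \<and> (\<forall>v\<in>(\<Union>j\<in>I - {k}. X j). lt v e (\<beta> k))" if k: "k \<in> I" for k
  proof (rule ex_near_one_small_compact)
    show "X k \<inter> (\<Union>j\<in>I - {k}. X j) = {}"
      using assms(3) k by (fastforce simp: disjoint_family_on_def)
    show "qcompact (\<Union>j\<in>I - {k}. X j)" using assms(1,4) by (intro qcompact_UN) auto
  qed (use assms(2,4) k c in \<open>auto simp: \<beta>_def\<close>)
  then obtain e where e: "\<And>k v. k \<in> I \<Longrightarrow> v \<in> X k \<Longrightarrow> lt v (e k - 1) (\<beta> k)"
    "\<And>k j v. k \<in> I \<Longrightarrow> j \<in> I - {k} \<Longrightarrow> v \<in> X j \<Longrightarrow> lt v (e k) (\<beta> k)" by (metis UN_iff)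
  have "lt v ((\<Sum>k\<in>I. y k * e k) - y k) z" if k: "k \<in> I" "v \<in> X k" for k v
  proof -
    interpret quasi_valuation "le v" t using quasi_valuation_G k assms(2) by blast
    have "lt v (y k * (e k - 1)) c"
      using mult_less_of_less [OF e(1) [OF k, unfolded \<beta>_def] c] .
    moreover have "lt v (y i * e i) c" if "i \<in> I" "i \<noteq> k" for i
      by (rule mult_less_of_less [OF e(2) [OF that(1) _ k(2), unfolded \<beta>_def] c]) (use k that in auto)
    ultimately show ?thesis
      unfolding c_def using assms(1,5) k(1) by (intro sum_unity_less)
  qed
  then show ?thesis by blast
qed

end

context place_family
begin

definition point_filter :: "'v \<Rightarrow> 'a \<Rightarrow> ('v \<times> 'a) filter" where
  "point_filter p a = (INF r\<in>- {0}. principal {(p, x) |x. lt p (x - a) r})"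

lemma eventually_point_filter:
  assumes "p \<in> S"
  shows "eventually P (point_filter p a) \<longleftrightarrow> (\<exists>r. r \<noteq> 0 \<and> (\<forall>x. lt p (x - a) r \<longrightarrow> P (p, x)))"
proof -
  interpret quasi_valuation "le p" t by (rule quasi_valuation [OF assms])
  have "\<exists>r\<in>- {0}. principal {(p, x) |x. lt p (x - a) r} \<le>
      inf (principal {(p, x) |x. lt p (x - a) r1}) (principal {(p, x) |x. lt p (x - a) r2})"
    if "r1 \<in> - {0}" "r2 \<in> - {0}" for r1 r2
  proof -
    obtain r where "r \<in> {r1, r2}" "le p r r1" "le p r r2" by (metis insertCI total refl)
    then show ?thesis using that by (intro bexI [of _ r]) (auto dest: less_le_trans)
  qed
  then have "eventually P (point_filter p a) \<longleftrightarrow>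
      (\<exists>r\<in>- {0}. eventually P (principal {(p, x) |x. lt p (x - a) r}))"
    unfolding point_filter_def by (intro eventually_INF_base) (use one_neq_zero [where ?'a = 'a] in blast)+
  then show ?thesis by (auto simp: eventually_principal)
qed

lemma tends_point_filter: "p \<in> S \<Longrightarrow> tends (point_filter p a) (\<lambda>x. x) a"
  unfolding tends_def by (auto simp: eventually_point_filter)

lemma tends_poly:
  assumes "tends F \<phi> c"
  shows "tends F (\<lambda>x. poly f (\<phi> x)) (poly f c)"
proof -
  have *: "\<forall>\<^sub>F (v, x) in F. v \<in> S"
    using tendsD [OF assms one_neq_zero] by (auto elim: eventually_mono)
  show ?thesis
  proof (induction f)
    case (pCons a f)
    then show ?case using tends_add [OF tends_const [OF *] tends_mult [OF assms]] by simp
  qed (use tends_const [OF *] in simp)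
qed

end

section \<open>Separation of exceptional places from a compact set\<close>

context compact_place_family
begin

text \<open>At \<open>p\<close> the value \<open>\<psi> (1 / x) = t / poly f x\<close> is at least 1
  as soon as \<open>poly f x\<close> is smaller than \<open>t\<close>. By \<open>less_open\<close>
  and continuity this is an open condition on \<open>x\<close>, so finite approximation can combine
  it for all \<open>p\<close> in \<open>F\<close> with making \<open>x\<close> large at a given
  place of \<open>G\<close>. A product over a finite subcover keeps both properties, its factors
  being at most 1 on \<open>G\<close> and at least 1 on \<open>F\<close>.\<close>

lemma ex_small_on_compact:
  assumes "finite F" "F \<subseteq> S" "F \<inter> G = {}" "a \<noteq> 0"
    and less_open: "\<And>p x. p \<in> F \<Longrightarrow> lt p x 1 \<Longrightarrow> \<exists>r. r \<noteq> 0 \<and> (\<forall>u. lt p u r \<longrightarrow> lt p (x + u) 1)"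
    and bad: "\<And>p. p \<in> F \<Longrightarrow> \<exists>x. lt p (poly f x) t"
  shows "\<exists>U. U \<noteq> 0 \<and> (\<forall>v\<in>G. le v U a) \<and> (\<forall>p\<in>F. le p 1 U)"
proof -
  note t = t_nonzero
  have "\<exists>x r. r \<noteq> 0 \<and> (\<forall>x'. lt p (x' - x) r \<longrightarrow> lt p (poly f x') t)" if p: "p \<in> F" for p
  proof -
    have pS: "p \<in> S" using p assms(2) by blast
    interpret quasi_valuation "le p" t by (rule quasi_valuation [OF pS])
    obtain x where x: "lt p (poly f x) t" using bad [OF p] by blast
    then have "lt p (poly f x / t) 1" using t by (simp add: le_divide_iff)
    then obtain r where r: "r \<noteq> 0" "\<And>u. lt p u r \<Longrightarrow> lt p (poly f x / t + u) 1"
      using less_open [OF p] by blast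
    have "\<forall>\<^sub>F (v, x') in point_filter p x. v \<in> S \<and> lt v (poly f x' - poly f x) (r * t)"
      using tendsD [OF tends_poly [OF tends_point_filter [OF pS]], of "r * t"] r(1) t by simp
    then obtain s where s: "s \<noteq> 0" "\<And>x'. lt p (x' - x) s \<Longrightarrow> lt p (poly f x' - poly f x) (r * t)"
      unfolding eventually_point_filter [OF pS] by auto
    have "lt p (poly f x') t" if "lt p (x' - x) s" for x'
    proof -
      have "lt p ((poly f x' - poly f x) / t) r" using s(2) [OF that] t by (simp add: le_divide_iff)
      from r(2) [OF this] have "lt p (poly f x' / t) 1" by (simp add: diff_divide_distrib)
      then show ?thesis using t by (simp add: le_divide_iff)
    qed
    with s(1) show ?thesis by blast
  qed
  then obtain x r where xr: "\<And>p. p \<in> F \<Longrightarrow> r p \<noteq> 0"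
      "\<And>p x'. p \<in> F \<Longrightarrow> lt p (x' - x p) (r p) \<Longrightarrow> lt p (poly f x') t" by metis
  have "\<exists>x'. x' \<noteq> 0 \<and> lt v (1 / x') a \<and> (\<forall>p\<in>F. lt p (poly f x') t)" if v: "v \<in> G" for v
  proof -
    have vS: "v \<in> S" using v G_subset by blast
    interpret quasi_valuation "le v" t by (rule quasi_valuation [OF vS])
    obtain s where s: "s \<noteq> 0" "lt v s (a * t)" using ex_less [OF vS, of "{a * t}"] assms(4) t by auto
    \<comment> \<open>The target at \<open>v\<close> has radius \<open>t * y\<close>, so an
      approximation is still at least \<open>t * y\<close>, and its inverse is at most
      \<open>s / t\<close>, which is below \<open>a\<close>.\<close>
    define y where "y = 1 / s"
    have ty: "t * y \<noteq> 0" using s(1) t by (simp add: y_def)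
    have "\<exists>x'. \<forall>p\<in>insert v F. lt p (x' - (if p = v then y else x p)) (if p = v then t * y else r p)"
      using assms(1,2) vS xr(1) ty by (intro finite_approximation) auto
    then obtain x' where *: "\<forall>p\<in>insert v F. lt p (x' - (if p = v then y else x p)) (if p = v then t * y else r p)" ..
    have x': "lt v (x' - y) (t * y)" using * by simp
    have x'F: "lt p (x' - x p) (r p)" if "p \<in> F" for p
    proof -
      have "p \<noteq> v" using that v assms(3) by blast
      then show ?thesis using * that by auto
    qed
    have le: "le v (t * y) x'" using less_add_lower [OF x'] by simp
    then have x0: "x' \<noteq> 0" using ty by auto
    have "le v 1 (x' * (s / t))" using mult_right [OF le, of "s / t"] s(1) t by (simp add: y_def)
    then have "le v (1 / x') (s / t)" using x0 by (simp add: divide_le_iff mult.commute)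
    moreover have "lt v (s / t) a" using s(2) unfolding le_divide_iff [OF t] .
    ultimately have "lt v (1 / x') a" by (rule le_less_trans)
    then show ?thesis using x0 xr(2) x'F by blast
  qed
  then obtain x' where x': "\<And>v. v \<in> G \<Longrightarrow> x' v \<noteq> 0" "\<And>v. v \<in> G \<Longrightarrow> lt v (1 / x' v) a"
      "\<And>v p. v \<in> G \<Longrightarrow> p \<in> F \<Longrightarrow> lt p (poly f (x' v)) t" by metis
  have lt: "lt w (b / a) 1 \<longleftrightarrow> lt w b a" if "w \<in> G" for w b
  proof -
    interpret quasi_valuation "le w" t by (rule quasi_valuation_G [OF that])
    show ?thesis using assms(4) by (simp add: le_divide_iff)
  qed
  have "lt v (1 / x' v / a) 1" if "v \<in> G" for v
    unfolding lt [OF that] by (rule x'(2) [OF that])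
  from qcompactD [OF G_compact this] obtain V where V: "finite V" "V \<subseteq> G"
      "\<And>w. w \<in> G \<Longrightarrow> \<exists>v\<in>V. lt w (1 / x' v / a) 1" by blast
  define U where "U = (\<Prod>v\<in>V. \<psi> (1 / x' v))"
  have "le w U a" if w: "w \<in> G" for w
  proof -
    interpret quasi_valuation "le w" t by (rule quasi_valuation_G [OF w])
    obtain v where v: "v \<in> V" "lt w (1 / x' v) a" using V(3) [OF w] unfolding lt [OF w] by blast
    have "le w U (\<psi> (1 / x' v))"
      unfolding U_def by (rule prod_le [OF w V(1) v(1)]) (rule psi_le_one [OF w])
    also have "le w (\<psi> (1 / x' v)) (1 / x' v)"
      by (rule psi_le [OF w]) (use x'(1) v(1) V(2) in auto)
    also have "le w (1 / x' v) a" by (rule less_imp_le [OF v(2)])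
    finally show ?thesis .
  qed
  moreover have "le p 1 U" if p: "p \<in> F" for p
  proof -
    interpret quasi_valuation "le p" t using quasi_valuation p assms(2) by blast
    have one_le: "le p 1 (\<psi> (1 / x' v))" if "v \<in> V" for v
    proof -
      have "lt p (poly f (x' v)) t" using x'(3) p that V(2) by blast
      then show ?thesis by (simp add: \<psi>_def le_divide_iff f_nonzero less_imp_le)
    qed
    have "le p 1 (\<Prod>v\<in>A. \<psi> (1 / x' v))" if "A \<subseteq> V" for A
      using finite_subset [OF that V(1)] that
    proof (induction A)
      case (insert a A)
      have "le p (1 * 1) (\<psi> (1 / x' a) * (\<Prod>v\<in>A. \<psi> (1 / x' v)))"
        using insert by (intro mult_mono one_le) auto
      then show ?case using insert.hyps by simp
    qed simp
    then show ?thesis unfolding U_def by simp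
  qed
  moreover have "U \<noteq> 0" using V(1) psi_nonzero by (simp add: U_def)
  ultimately show ?thesis by blast
qed

text \<open>Take \<open>e = c / (U + c)\<close> with \<open>c\<close> small on \<open>F\<close>, and
  \<open>U\<close> at least 1 on \<open>F\<close> but negligible against \<open>c\<close> on
  \<open>G\<close>. The element \<open>c\<close> is fixed before \<open>U\<close>, because the
  smallness of \<open>U\<close> is measured against it.\<close>

lemma ex_near_one_small_finite_compact:
  assumes "finite F" "F \<subseteq> S" "F \<inter> G = {}" "\<beta> \<noteq> 0" "\<And>p. p \<in> F \<Longrightarrow> \<gamma> p \<noteq> 0"
    and less_open: "\<And>p x. p \<in> F \<Longrightarrow> lt p x 1 \<Longrightarrow> \<exists>r. r \<noteq> 0 \<and> (\<forall>u. lt p u r \<longrightarrow> lt p (x + u) 1)"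
    and bad: "\<And>p. p \<in> F \<Longrightarrow> \<exists>x. lt p (poly f x) t"
  shows "\<exists>e. (\<forall>v\<in>G. lt v (e - 1) \<beta>) \<and> (\<forall>p\<in>F. lt p e (\<gamma> p))"
proof -
  note t = t_nonzero
  have "\<exists>d. d \<noteq> 0 \<and> lt p d t \<and> lt p d (\<gamma> p * t)" if "p \<in> F" for p
    using ex_less [of p "{t, \<gamma> p * t}"] assms(2,5) t that by auto
  then obtain d where d: "\<And>p. p \<in> F \<Longrightarrow> d p \<noteq> 0 \<and> lt p (d p) t \<and> lt p (d p) (\<gamma> p * t)" by metis
  obtain w where w: "w \<in> G" using G_nonempty by blast
  have "\<exists>c. c \<noteq> 0 \<and> (\<forall>p\<in>F. le p c (d p)) \<and> le w 1 c"
    using assms(1-3) w G_subset d by (intro ex_small_on_finite) auto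
  then obtain c where c: "c \<noteq> 0" "\<And>p. p \<in> F \<Longrightarrow> le p c (d p)" by blast
  define \<delta> where "\<delta> = \<psi> \<beta> * \<pi>"
  have \<delta>0: "\<delta> \<noteq> 0" using psi_nonzero pi(1) by (simp add: \<delta>_def)
  obtain U where U: "U \<noteq> 0" "\<And>v. v \<in> G \<Longrightarrow> le v U (\<delta> * (t * c))" "\<And>p. p \<in> F \<Longrightarrow> le p 1 U"
    using ex_small_on_compact [OF assms(1-3) _ less_open bad, of "\<delta> * (t * c)"] \<delta>0 t c(1) by auto
  define e where "e = c / (U + c)"
  have "lt v (e - 1) \<beta>" if v: "v \<in> G" for v
  proof -
    interpret quasi_valuation "le v" t by (rule quasi_valuation_G [OF v])
    have *: "lt v \<delta> (\<psi> \<beta>)" unfolding \<delta>_def by (rule pi_mult_less [OF v psi_nonzero])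
    have "lt v (\<delta> * (t * c)) (1 * (t * c))"
      by (rule mult_less_le [OF less_le_trans [OF * psi_le_one [OF v]] refl]) (use t c(1) in simp)
    from le_less_trans [OF U(2) [OF v] this] have "lt v U (t * c)" by simp
    note q = quotient_le [OF this]
    have "le v (U / (t * c)) \<delta>" using U(2) [OF v] t c(1) by (simp add: divide_le_iff)
    with q(2) have "le v (U / (c + U)) \<delta>" by (rule trans)
    from le_less_trans [OF this less_le_trans [OF * psi_le [OF v assms(4)]]]
    have "lt v (- (U / (c + U))) \<beta>" unfolding le_uminus_iff .
    moreover have "e - 1 = - (U / (c + U))" using q(1) by (simp add: e_def field_simps)
    ultimately show ?thesis by metis
  qed
  moreover have "lt p e (\<gamma> p)" if p: "p \<in> F" for p
  proof -
    interpret quasi_valuation "le p" t using quasi_valuation p assms(2) by blast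
    have tU: "le p (t * 1) (t * U)" by (rule mult_mono [OF refl U(3) [OF p]])
    have *: "lt p c t" "lt p c (\<gamma> p * t)"
      using le_less_trans [OF c(2) [OF p]] d [OF p] by blast+
    have "lt p c (t * U)" using less_le_trans [OF *(1)] tU by simp
    from quotient_le(2) [OF this] have "le p e (c / (t * U))" unfolding e_def .
    moreover have "le p (c / (t * U)) (c / t)"
      using mult_mono [OF refl U(3) [OF p], of c] t U(1) divide_le_iff [of "t * U" c] by simp
    ultimately have "le p e (c / t)" by (rule trans)
    moreover have "lt p (c / t) (\<gamma> p)" using *(2) unfolding le_divide_iff [OF t] .
    ultimately show ?thesis by (rule le_less_trans)
  qed
  ultimately show ?thesis by blast
qed

end

section \<open>Approximation on finitely many compact pieces\<close>

theorem (in place_family) approximation: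
  assumes f_le_one: "\<And>v x. v \<in> S \<Longrightarrow> le v x 1 \<Longrightarrow> le v (poly f x) 1"
    and f_large: "\<And>v x. v \<in> S \<Longrightarrow> lt v 1 x \<Longrightarrow> le v (t * x\<^sup>2) (poly f x)"
    and less_open: "\<And>v x. v \<in> S \<Longrightarrow> lt v x 1 \<Longrightarrow> \<exists>r. r \<noteq> 0 \<and> (\<forall>u. lt v u r \<longrightarrow> lt v (x + u) 1)"
    and I: "finite I" "disjoint_family_on X I" "S = (\<Union>k\<in>I. X k)" "\<And>k. k \<in> I \<Longrightarrow> qcompact (X k)"
    and dichotomy: "\<And>k. k \<in> I \<Longrightarrow> finite (X k) \<or> (\<forall>v\<in>X k. \<forall>x. le v x 1 \<longrightarrow> le v t (poly f x))"
    and z: "\<And>k. k \<in> I \<Longrightarrow> z k \<noteq> 0"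
  shows "\<exists>x. \<forall>k\<in>I. \<forall>v\<in>X k. lt v (x - y k) (z k)"
proof (cases "S = {}")
  case False
  then obtain v0 where "v0 \<in> S" by blast
  then interpret v0: quasi_valuation "le v0" t by (rule quasi_valuation)
  note t = v0.t_nonzero
  \<comment> \<open>The split is made place by place, since a finite piece may contain places of
    both kinds. Infinite pieces lie in \<open>G\<close> entirely, which keeps the complement
    finite.\<close>
  define G where "G = {v \<in> S. \<forall>x. le v x 1 \<longrightarrow> le v t (poly f x)}"
  define \<kappa> where "\<kappa> = (\<lambda>v. THE k. k \<in> I \<and> v \<in> X k)"
  have \<kappa>: "\<kappa> v = k" if "k \<in> I" "v \<in> X k" for k v
    unfolding \<kappa>_def using that I(2) by (intro the_equality) (auto simp: disjoint_family_on_def)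
  have \<kappa>_mem: "\<kappa> v \<in> I \<and> v \<in> X (\<kappa> v)" if v: "v \<in> S" for v
    using v \<kappa> I(3) by auto
  define F where "F = S - G"
  have "X k - G = {} \<or> finite (X k)" if "k \<in> I" for k
    using dichotomy [OF that] I(3) that by (auto simp: G_def)
  then have "finite (X k - G)" if "k \<in> I" for k by (metis finite.emptyI finite_Diff that)
  then have "finite (\<Union>k\<in>I. X k - G)" using I(1) by blast
  moreover have "F = (\<Union>k\<in>I. X k - G)" unfolding F_def I(3) by blast
  ultimately have F: "finite F" "F \<subseteq> S" "F \<inter> G = {}" by (auto simp: F_def)
  have "\<exists>x. \<forall>p\<in>F. lt p (x - y (\<kappa> p)) (t * z (\<kappa> p))"
    using F z \<kappa>_mem t by (intro finite_approximation) auto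
  then obtain q where q: "\<And>p. p \<in> F \<Longrightarrow> lt p (q - y (\<kappa> p)) (t * z (\<kappa> p))" by blast
  have "\<exists>x. \<forall>v\<in>S. lt v (x - y (\<kappa> v)) (z (\<kappa> v))"
  proof (cases "G = {}")
    case True
    then have "F = S" by (simp add: F_def)
    then show ?thesis
      using finite_approximation [OF F(1,2), of "\<lambda>p. z (\<kappa> p)" "\<lambda>p. y (\<kappa> p)"] z \<kappa>_mem by auto
  next
    case False
    have Xk: "qcompact (X k \<inter> G)" if k: "k \<in> I" for k
    proof (cases "finite (X k)")
      case False
      then have "X k \<inter> G = X k" using dichotomy [OF k] I(3) k by (auto simp: G_def)
      then show ?thesis using I(4) [OF k] by simp
    qed (auto intro: qcompact_finite)
    have cover: "(\<Union>k\<in>I. X k \<inter> G) = G" using I(3) by (auto simp: G_def)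
    interpret compact_place_family le S t f G
    proof
      show "qcompact G" using qcompact_UN [OF I(1), of "\<lambda>k. X k \<inter> G"] Xk unfolding cover by blast
    qed (use f_le_one f_large False in \<open>auto simp: G_def\<close>)
    \<comment> \<open>\<open>compact_approximation\<close> works with a single radius; this one lies
      below every \<open>z k\<close> throughout \<open>G\<close>.\<close>
    define z0 where "z0 = (\<Prod>k\<in>I. \<psi> (z k))"
    have z0: "z0 \<noteq> 0" using I(1) psi_nonzero by (simp add: z0_def)
    have z0_le: "le v z0 (z (\<kappa> v))" if v: "v \<in> G" for v
    proof -
      interpret quasi_valuation "le v" t by (rule quasi_valuation_G [OF v])
      have k: "\<kappa> v \<in> I" using v \<kappa>_mem G_subset by blast
      have "le v z0 (\<psi> (z (\<kappa> v)))"
        unfolding z0_def by (rule prod_le [OF v I(1) k]) (rule psi_le_one [OF v])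
      also have "le v (\<psi> (z (\<kappa> v))) (z (\<kappa> v))" by (rule psi_le [OF v z [OF k]])
      finally show ?thesis .
    qed
    have "\<exists>x. \<forall>k\<in>I. \<forall>v\<in>X k \<inter> G. lt v (x - (y k - q)) (t * z0)"
      using I(1,2) cover Xk t z0 by (intro compact_approximation) (auto simp: disjoint_family_on_def)
    then obtain x1 where x1: "\<And>v. v \<in> G \<Longrightarrow> lt v (x1 - (y (\<kappa> v) - q)) (t * z0)"
      using \<kappa>_mem G_subset by blast
    define \<beta> \<gamma> where "\<beta> = (if x1 = 0 then 1 else t * z0 / x1)"
      and "\<gamma> = (\<lambda>p. if x1 = 0 then 1 else t * z (\<kappa> p) / x1)"
    have "\<exists>e. (\<forall>v\<in>G. lt v (e - 1) \<beta>) \<and> (\<forall>p\<in>F. lt p e (\<gamma> p))"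
    proof (rule ex_near_one_small_finite_compact [OF F])
      show "\<exists>x. lt p (poly f x) t" if "p \<in> F" for p using that by (auto simp: F_def G_def)
    qed (use F z z0 t \<kappa>_mem less_open in \<open>auto simp: \<beta>_def \<gamma>_def\<close>)
    then obtain e where e: "\<And>v. v \<in> G \<Longrightarrow> lt v (e - 1) \<beta>" "\<And>p. p \<in> F \<Longrightarrow> lt p e (\<gamma> p)" by blast
    \<comment> \<open>\<open>q\<close> is right on \<open>F\<close>, and \<open>x1 * e\<close> corrects it on \<open>G\<close> without disturbing it on \<open>F\<close>.\<close>
    have "lt v (q + x1 * e - y (\<kappa> v)) (z (\<kappa> v))" if v: "v \<in> S" for v
    proof (cases "v \<in> G")
      case True
      interpret quasi_valuation "le v" t by (rule quasi_valuation_G [OF True])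
      have "lt v (x1 * (e - 1)) (t * z0)"
        by (rule mult_less_of_less [OF e(1) [OF True, unfolded \<beta>_def]]) (use t z0 in simp)
      from add_less [OF x1 [OF True] this]
      have "lt v (x1 - (y (\<kappa> v) - q) + x1 * (e - 1)) z0" unfolding mult_left_iff [OF t] .
      from less_le_trans [OF this z0_le [OF True]] show ?thesis by (simp add: algebra_simps)
    next
      case False
      then have vF: "v \<in> F" using v by (simp add: F_def)
      interpret quasi_valuation "le v" t by (rule quasi_valuation [OF v])
      have "lt v (x1 * e) (t * z (\<kappa> v))"
        by (rule mult_less_of_less [OF e(2) [OF vF, unfolded \<gamma>_def]]) (use t z \<kappa>_mem [OF v] in simp)
      from add_less [OF q [OF vF] this]
      have "lt v (q - y (\<kappa> v) + x1 * e) (z (\<kappa> v))" unfolding mult_left_iff [OF t] .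
      then show ?thesis by (simp add: algebra_simps)
    qed
    then show ?thesis by blast
  qed
  then show ?thesis using \<kappa> I(3) by (metis UN_I)
qed (use I in auto)

section \<open>Multiplicative seminorms on real polynomials\<close>

text \<open>If \<open>a\<close> exceeded \<open>b\<close>, the powers of their quotient would
  outgrow every linear function. This is how constants are removed from multiplicative estimates
  below.\<close>

lemma le_of_power_le:
  fixes a b C D :: real
  assumes "0 \<le> a" "0 \<le> b" "\<And>n. a ^ n \<le> (C * real n + D) * b ^ n"
  shows "a \<le> b"
proof (cases "b = 0")
  case True
  then show ?thesis using assms(3) [of 1] by simp
next
  case False
  show ?thesis
  proof (rule ccontr)
    assume "\<not> a \<le> b"
    define r where "r = a / b"
    have r: "r > 1" using \<open>\<not> a \<le> b\<close> False assms(2) by (simp add: r_def)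
    have "(\<lambda>n. C * (real n / r ^ n) + D / r ^ n) \<longlonglongrightarrow> C * 0 + 0"
    proof (intro tendsto_intros)
      have "(\<lambda>n. real n * inverse r ^ n) \<longlonglongrightarrow> 0"
        using r by (intro powser_times_n_limit_0) (simp add: inverse_less_1_iff)
      then show "(\<lambda>n. real n / r ^ n) \<longlonglongrightarrow> 0" by (simp add: field_simps)
      show "(\<lambda>n. D / r ^ n) \<longlonglongrightarrow> 0" using LIMSEQ_divide_realpow_zero r by blast
    qed
    moreover have "1 \<le> C * (real n / r ^ n) + D / r ^ n" for n
    proof -
      have "r ^ n \<le> C * real n + D"
        using assms(3) [of n] False assms(2) by (simp add: r_def power_divide divide_le_eq)
      then show ?thesis using r by (simp add: divide_simps)
    qed
    ultimately have "1 \<le> C * 0 + (0 :: real)" by (intro LIMSEQ_le_const) auto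
    then show False by simp
  qed
qed

definition conj_quadratic :: "complex \<Rightarrow> real poly" where
  "conj_quadratic z = [:(cmod z)\<^sup>2, - 2 * Re z, 1:]"

lemma poly_conj_quadratic: "poly (map_poly of_real (conj_quadratic z)) z = 0"
  unfolding conj_quadratic_def cmod_power2
  by (simp add: map_poly_pCons complex_eq_iff algebra_simps power2_eq_square)

lemma poly_map_of_real_mult [simp]:
  "poly (map_poly of_real (p * q)) (z :: complex) = poly (map_poly of_real p) z * poly (map_poly of_real q) z"
proof -
  have "poly (map_poly of_real p) z = (\<Sum>i\<le>degree p. of_real (coeff p i) * z ^ i)" for p
    by (simp add: poly_altdef coeff_map_poly degree_map_poly)
  show ?thesis
  proof (induction p)
    case (pCons a p)
    have add: "poly (map_poly of_real (p + q)) z = poly (map_poly of_real p) z + poly (map_poly of_real q) z" for p q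
      by (induction p q rule: poly_induct2) (simp_all add: map_poly_pCons algebra_simps)
    have smult: "poly (map_poly of_real (smult a q)) z = of_real a * poly (map_poly of_real q) z" for q
      by (induction q) (simp_all add: map_poly_pCons algebra_simps)
    show ?case using pCons by (simp add: add smult map_poly_pCons algebra_simps)
  qed simp
qed

lemma poly_map_of_real_add [simp]:
  "poly (map_poly of_real (p + q)) (z :: complex) = poly (map_poly of_real p) z + poly (map_poly of_real q) z"
  by (induction p q rule: poly_induct2) (simp_all add: map_poly_pCons algebra_simps)

lemma poly_map_of_real_of_real: "poly (map_poly of_real p) (complex_of_real a) = of_real (poly p a)"
  by (induction p) (simp_all add: map_poly_pCons)

lemma degree_conj_quadratic [simp]: "degree (conj_quadratic z) = 2"
  by (simp add: conj_quadratic_def)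

lemma conj_quadratic_nonzero [simp]: "conj_quadratic z \<noteq> 0"
  by (simp add: conj_quadratic_def)

lemma mod_conj_quadratic: "\<exists>c e. p mod conj_quadratic z = [:c, e:]"
proof -
  have "degree (p mod conj_quadratic z) < 2"
    using degree_mod_less [of "conj_quadratic z" p] by auto
  then have "p mod conj_quadratic z = [:coeff (p mod conj_quadratic z) 0, coeff (p mod conj_quadratic z) 1:]"
    by (intro poly_eqI) (auto simp: coeff_pCons coeff_eq_0 split: nat.split)
  then show ?thesis by blast
qed

lemma conj_quadratic_dvd:
  assumes "poly (map_poly of_real p) z = 0" "Im z \<noteq> 0"
  shows "conj_quadratic z dvd p"
proof -
  obtain c e where ce: "p mod conj_quadratic z = [:c, e:]" using mod_conj_quadratic by blast
  have "p = p div conj_quadratic z * conj_quadratic z + [:c, e:]" by (simp flip: ce)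
  then have "poly (map_poly of_real p) z =
      poly (map_poly of_real (p div conj_quadratic z * conj_quadratic z + [:c, e:])) z" by simp
  also have "\<dots> = of_real c + of_real e * z"
    by (simp add: poly_conj_quadratic map_poly_pCons mult.commute)
  finally have "of_real c + of_real e * z = 0" using assms(1) by simp
  then have "e = 0" "c = 0" using assms(2) by (auto simp: complex_eq_iff)
  then show ?thesis using ce by (simp add: mod_eq_0_iff_dvd)
qed

text \<open>Ostrowski's theorem for one element, by the argument of Neukirch: the values on the real quadratic polynomials with
  complex conjugate roots attain a minimum, and it vanishes.\<close>

locale multiplicative_seminorm =
  fixes N :: "real poly \<Rightarrow> real"
  assumes mult: "N (p * q) = N p * N q"
    and add: "N (p + q) \<le> N p + N q"
    and const: "N [:c:] = \<bar>c\<bar>"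
begin

lemma smult: "N (smult c p) = \<bar>c\<bar> * N p"
  using mult [of "[:c:]" p] const by simp

lemma minus: "N (- p) = N p"
  using smult [of "- 1" p] by simp

lemma nonneg: "0 \<le> N p"
  using add [of p "- p"] const [of 0] by (simp add: minus)

lemma diff: "N p - N q \<le> N (p - q)"
  using add [of "p - q" q] by simp

lemma abs_diff: "\<bar>N p - N q\<bar> \<le> N (p - q)"
  using diff [of p q] diff [of q p] minus [of "p - q"] by simp

lemma power: "N (p ^ n) = N p ^ n"
  using const [of 1] by (induction n) (simp_all add: mult one_pCons)

text \<open>The multiples of \<open>q\<close> lie in the kernel of \<open>N\<close>, which therefore
  descends to residue classes modulo \<open>q\<close>.\<close>

lemma eq_if_zero: "N q = 0 \<Longrightarrow> N (u * q + p) = N p"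
  using abs_diff [of "u * q + p" p] by (simp add: mult)

definition \<xi> where "\<xi> = N [:0, 1:]"

lemma linear_le: "N [:c, e:] \<le> \<bar>c\<bar> + \<bar>e\<bar> * \<xi>"
proof -
  have "[:c, e:] = [:c:] + smult e [:0, 1:]" by simp
  then show ?thesis using add [of "[:c:]" "smult e [:0, 1:]"] by (simp only: const smult \<xi>_def)
qed

lemma continuous: "continuous_on A (\<lambda>z. N (conj_quadratic z))"
proof -
  have lip: "\<bar>N (conj_quadratic z) - N (conj_quadratic w)\<bar>
      \<le> \<bar>(cmod z)\<^sup>2 - (cmod w)\<^sup>2\<bar> + 2 * \<bar>Re z - Re w\<bar> * \<xi>" for z w
  proof -
    have "conj_quadratic z - conj_quadratic w = [:(cmod z)\<^sup>2 - (cmod w)\<^sup>2, 2 * (Re w - Re z):]"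
      by (simp add: conj_quadratic_def algebra_simps)
    then have "\<bar>N (conj_quadratic z) - N (conj_quadratic w)\<bar>
        \<le> N [:(cmod z)\<^sup>2 - (cmod w)\<^sup>2, 2 * (Re w - Re z):]" using abs_diff by metis
    also have "\<dots> \<le> \<bar>(cmod z)\<^sup>2 - (cmod w)\<^sup>2\<bar> + \<bar>2 * (Re w - Re z)\<bar> * \<xi>" by (rule linear_le)
    also have "\<bar>2 * (Re w - Re z)\<bar> = 2 * \<bar>Re z - Re w\<bar>"
      by (metis abs_minus_commute abs_mult abs_numeral)
    finally show ?thesis .
  qed
  have "((\<lambda>z. N (conj_quadratic z)) \<longlongrightarrow> N (conj_quadratic w)) (at w within A)" for w
  proof (rule Lim_transform_bound [THEN LIM_zero_cancel])
    show "\<forall>\<^sub>F z in at w within A. norm (N (conj_quadratic z) - N (conj_quadratic w))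
        \<le> norm (\<bar>(cmod z)\<^sup>2 - (cmod w)\<^sup>2\<bar> + 2 * \<bar>Re z - Re w\<bar> * \<xi>)"
      using lip nonneg by (intro always_eventually) (auto simp: \<xi>_def)
    have "((\<lambda>z. \<bar>(cmod z)\<^sup>2 - (cmod w)\<^sup>2\<bar> + 2 * \<bar>Re z - Re w\<bar> * \<xi>)
        \<longlongrightarrow> \<bar>(cmod w)\<^sup>2 - (cmod w)\<^sup>2\<bar> + 2 * \<bar>Re w - Re w\<bar> * \<xi>) (at w within A)"
      by (intro tendsto_intros)
    then show "((\<lambda>z. \<bar>(cmod z)\<^sup>2 - (cmod w)\<^sup>2\<bar> + 2 * \<bar>Re z - Re w\<bar> * \<xi>) \<longlongrightarrow> 0) (at w within A)"
      by simp
  qed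
  then show ?thesis by (simp add: continuous_on_def)
qed

text \<open>Writes the constant polynomial as \<open>conj_quadratic z\<close> plus 2
  \<open>Re z\<close> times X minus the square of X. The growth in z confines the minimum to a
  disc.\<close>

lemma coercive: "(cmod z)\<^sup>2 - 2 * cmod z * \<xi> - \<xi>\<^sup>2 \<le> N (conj_quadratic z)"
proof -
  have eq: "[:(cmod z)\<^sup>2:] = conj_quadratic z + (smult (2 * Re z) [:0, 1:] + - ([:0, 1:] * [:0, 1:]))"
    by (simp add: conj_quadratic_def)
  have "(cmod z)\<^sup>2 = N [:(cmod z)\<^sup>2:]" by (simp add: const)
  also have "\<dots> \<le> N (conj_quadratic z) + (N (smult (2 * Re z) [:0, 1:]) + N (- ([:0, 1:] * [:0, 1:])))"
    unfolding eq by (intro order_trans [OF add] add_left_mono add)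
  also have "\<dots> = N (conj_quadratic z) + (\<bar>2 * Re z\<bar> * \<xi> + \<xi>\<^sup>2)"
    by (simp only: smult minus mult \<xi>_def power2_eq_square)
  also have "\<dots> \<le> N (conj_quadratic z) + (2 * cmod z * \<xi> + \<xi>\<^sup>2)"
    using abs_Re_le_cmod [of z] nonneg by (simp add: mult_right_mono \<xi>_def abs_mult)
  finally show ?thesis by simp
qed

text \<open>Over the reals a monic polynomial splits into linear factors and conjugate quadratics.
  The square of a linear factor is again a \<open>conj_quadratic\<close>, so each degree contributes
  at least \<open>sqrt m\<close>.\<close>

lemma monic_lower_bound:
  assumes "0 < m" "\<And>z. m \<le> N (conj_quadratic z)" "lead_coeff p = 1"
  shows "sqrt m ^ degree p \<le> N p"
  using assms(3)
proof (induction "degree p" arbitrary: p rule: less_induct)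
  case less
  have p0: "p \<noteq> 0" using less.prems by auto
  show ?case
  proof (cases "degree p = 0")
    case True
    then have "p = [:1:]" using less.prems by (metis degree_0_id)
    then show ?thesis using const [of 1] by simp
  next
    case False
    have "\<not> constant (poly (map_poly of_real p :: complex poly))"
      using False by (simp add: constant_degree degree_map_poly)
    then obtain \<alpha> :: complex where \<alpha>: "poly (map_poly of_real p) \<alpha> = 0"
      using fundamental_theorem_of_algebra by blast
    have step: ?thesis if "p = q * u" "lead_coeff q = 1" "0 < degree q" "sqrt m ^ degree q \<le> N q" for q u
    proof -
      have nz: "q \<noteq> 0" "u \<noteq> 0" using p0 that(1) by auto
      have "lead_coeff u = 1" using less.prems that(1,2) by (simp add: lead_coeff_mult)
      moreover have deg: "degree p = degree q + degree u" using nz that(1) by (simp add: degree_mult_eq)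
      ultimately have "sqrt m ^ degree u \<le> N u" using less.hyps [of u] that(3) by simp
      then have "sqrt m ^ degree q * sqrt m ^ degree u \<le> N q * N u"
        using that(4) nonneg assms(1) by (intro mult_mono) auto
      moreover have "N p = N q * N u" using that(1) mult by simp
      ultimately show ?thesis by (simp add: deg power_add)
    qed
    show ?thesis
    proof (cases "Im \<alpha> = 0")
      case True
      then have "\<alpha> = of_real (Re \<alpha>)" by (simp add: complex_eq_iff)
      then have "complex_of_real (poly p (Re \<alpha>)) = 0"
        using \<alpha> by (metis poly_map_of_real_of_real)
      then have "[:- Re \<alpha>, 1:] dvd p" by (simp flip: poly_eq_0_iff_dvd)
      then obtain u where u: "p = [:- Re \<alpha>, 1:] * u" by (elim dvdE)
      have "conj_quadratic (of_real (Re \<alpha>)) = [:- Re \<alpha>, 1:] * [:- Re \<alpha>, 1:]"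
        by (simp add: conj_quadratic_def power2_eq_square)
      then have "m \<le> (N [:- Re \<alpha>, 1:])\<^sup>2"
        using assms(2) [of "of_real (Re \<alpha>)"] by (simp only: mult power2_eq_square)
      then have "sqrt m \<le> N [:- Re \<alpha>, 1:]" using nonneg by (intro real_le_lsqrt) (auto simp: real_sqrt_le_iff)
      then show ?thesis by (intro step [OF u]) auto
    next
      case False
      from conj_quadratic_dvd [OF \<alpha> this] obtain u where u: "p = conj_quadratic \<alpha> * u" by (elim dvdE)
      show ?thesis
        by (rule step [OF u]) (use assms(1,2) in \<open>auto simp: conj_quadratic_def\<close>)
    qed
  qed
qed

lemma ex_zero: "\<exists>z. N (conj_quadratic z) = 0"
proof -
  \<comment> \<open>Outside the disc of this radius \<open>coercive\<close> gives a value above the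
    square of \<open>\<xi>\<close>, which is the value at 0; hence a minimum over the disc is a
    global one.\<close>
  define r where "r = 3 * \<xi> + 1"
  have \<xi>: "0 \<le> \<xi>" by (simp add: \<xi>_def nonneg)
  have "conj_quadratic 0 = [:0, 1:] * [:0, 1:]" by (simp add: conj_quadratic_def)
  then have N0: "N (conj_quadratic 0) = \<xi>\<^sup>2" by (simp only: mult \<xi>_def power2_eq_square)
  have far: "N (conj_quadratic 0) < N (conj_quadratic z)" if "r < cmod z" for z
  proof -
    have "(3 * \<xi> + 1) * (\<xi> + 1) \<le> cmod z * (cmod z - 2 * \<xi>)"
      using that \<xi> unfolding r_def by (intro mult_mono) auto
    moreover have "(3 * \<xi> + 1) * (\<xi> + 1) = 3 * \<xi>\<^sup>2 + 4 * \<xi> + 1"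
      by (simp add: algebra_simps power2_eq_square)
    moreover have "cmod z * (cmod z - 2 * \<xi>) = (cmod z)\<^sup>2 - 2 * cmod z * \<xi>"
      by (simp add: algebra_simps power2_eq_square)
    ultimately have "2 * \<xi>\<^sup>2 < (cmod z)\<^sup>2 - 2 * cmod z * \<xi>"
      using \<xi> zero_le_power2 [of \<xi>] by linarith
    then show ?thesis using coercive [of z] N0 by simp
  qed
  have "r > 0" using \<xi> by (simp add: r_def)
  then obtain z2 where z2: "z2 \<in> cball 0 r" "\<And>z. z \<in> cball 0 r \<Longrightarrow> N (conj_quadratic z2) \<le> N (conj_quadratic z)"
    using continuous_attains_inf [OF compact_cball _ continuous, of "0 :: complex" r] by auto
  define m where "m = N (conj_quadratic z2)"
  have min: "m \<le> N (conj_quadratic z)" for z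
  proof (cases "z \<in> cball 0 r")
    case False
    then have "N (conj_quadratic 0) < N (conj_quadratic z)" using far by simp
    then show ?thesis using z2(2) [of 0] \<open>r > 0\<close> by (simp add: m_def)
  qed (use z2 in \<open>simp add: m_def\<close>)
  define M where "M = {z. N (conj_quadratic z) = m}"
  have "closed M" unfolding M_def by (intro closed_Collect_eq continuous continuous_on_const)
  moreover have "M \<subseteq> cball 0 r"
  proof
    fix z assume "z \<in> M"
    then have "\<not> r < cmod z" using far [of z] min [of 0] by (auto simp: M_def)
    then show "z \<in> cball 0 r" by simp
  qed
  ultimately have "compact M" using compact_cball compact_Int_closed [of "cball 0 r" M]
    by (simp add: Int_absorb1)
  moreover have "M \<noteq> {}" by (auto simp: M_def m_def)
  ultimately obtain z0 where z0: "z0 \<in> M" "\<And>z. z \<in> M \<Longrightarrow> cmod z \<le> cmod z0"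
    using continuous_attains_sup [of M cmod] by (auto intro: continuous_intros)
  have "m = 0"
  proof (rule ccontr)
    assume "m \<noteq> 0"
    then have m: "0 < m" using nonneg [of "conj_quadratic z2"] by (simp add: m_def)
    \<comment> \<open>Same real part as \<open>z0\<close>, while the squared modulus grows by m / 2;
      hence the polynomial changes by the constant m / 2 only. As \<open>z0\<close> has the largest
      modulus among the minimum points, \<open>z1\<close> is not one of them.\<close>
    define z1 where "z1 = Complex (Re z0) (sqrt ((Im z0)\<^sup>2 + m / 2))"
    have cz1: "(cmod z1)\<^sup>2 = (cmod z0)\<^sup>2 + m / 2" using m by (simp add: z1_def cmod_power2)
    have "cmod z0 < cmod z1" by (rule power2_less_imp_less) (use cz1 m in simp_all)
    then have "N (conj_quadratic z1) \<noteq> m" using z0(2) [of z1] by (auto simp: M_def)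
    then have big: "m < N (conj_quadratic z1)" using min [of z1] by simp
    have q1: "conj_quadratic z1 = conj_quadratic z0 - [:- (m / 2):]"
      by (simp add: conj_quadratic_def cz1) (simp add: z1_def)
    have "N (conj_quadratic z1) \<le> m * (1 + (1 / 2) ^ Suc n)" for n
    proof -
      \<comment> \<open>\<open>conj_quadratic z1\<close> divides the difference of the powers of
        \<open>conj_quadratic z0\<close> and of -m / 2 with exponent n + 1. The cofactor is monic of
        degree 2 n, so its value is at least \<open>m ^ n\<close>, and an upper bound for
        \<open>N (conj_quadratic z1)\<close> that tends to m remains.\<close>
      define Q where "Q = conj_quadratic z0 ^ Suc n"
      define k where "k = (- (m / 2)) ^ Suc n"
      define P where "P = - [:k:] + Q"
      have "P = conj_quadratic z0 ^ Suc n - [:- (m / 2):] ^ Suc n"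
        unfolding P_def Q_def k_def poly_const_pow by simp
      then have "conj_quadratic z1 dvd P" unfolding q1 using power_diff_sumr2 by (metis dvd_triv_left)
      then obtain H where H: "P = conj_quadratic z1 * H" by (elim dvdE)
      have deg0: "degree Q = 2 * Suc n"
        unfolding Q_def by (subst degree_power_eq) auto
      have lt: "degree (- [:k:]) < degree Q" unfolding deg0 by simp
      have degP: "degree P = 2 * Suc n"
        unfolding P_def using degree_add_eq_right [OF lt] deg0 by simp
      have "lead_coeff P = lead_coeff Q" unfolding P_def by (rule lead_coeff_add_le [OF lt])
      also have "\<dots> = lead_coeff (conj_quadratic z0) ^ Suc n" unfolding Q_def by (rule lead_coeff_power)
      also have "\<dots> = 1" by (simp add: conj_quadratic_def)
      finally have lcP: "lead_coeff P = 1" .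
      then have "H \<noteq> 0" using H by auto
      then have "degree P = 2 + degree H" using H by (simp add: degree_mult_eq)
      then have degH: "degree H = 2 * n" using degP by simp
      have "lead_coeff (conj_quadratic z1) = 1" by (simp add: conj_quadratic_def)
      then have "lead_coeff H = 1" using lcP H by (metis lead_coeff_mult mult_1)
      from monic_lower_bound [OF m min this] have "m ^ n \<le> N H"
        using m by (simp add: degH power_mult)
      then have "N (conj_quadratic z1) * m ^ n \<le> N P"
        using nonneg by (simp add: H mult mult_left_mono)
      also have "N P \<le> N (- [:k:]) + N Q" unfolding P_def by (rule add)
      also have "\<dots> = (m / 2) ^ Suc n + m ^ Suc n"
        using z0(1) m unfolding Q_def k_def minus const power by (simp add: M_def power_abs abs_mult)
      also have "\<dots> = (m * (1 + (1 / 2) ^ Suc n)) * m ^ n" by (simp add: field_simps)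
      finally show ?thesis using m by simp
    qed
    moreover have "(\<lambda>n. m * (1 + (1 / 2) ^ Suc n)) \<longlonglongrightarrow> m * (1 + 0)"
      by (intro tendsto_intros LIMSEQ_Suc LIMSEQ_realpow_zero) auto
    ultimately have "N (conj_quadratic z1) \<le> m * (1 + 0)" by (intro LIMSEQ_le_const) auto
    with big show False by simp
  qed
  then show ?thesis using z0(1) by (auto simp: M_def)
qed

text \<open>Since \<open>N\<close> kills a \<open>conj_quadratic z\<close>, it is determined by its
  values on remainders \<open>[:c, e:]\<close>. For real \<open>z\<close> these reduce to constants;
  otherwise they form a copy of the complex numbers, and it remains to show that \<open>N\<close> is
  the modulus there.\<close>

theorem eq_cmod: "\<exists>z. \<forall>p. N p = cmod (poly (map_poly of_real p) z)"
proof -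
  obtain z where z: "N (conj_quadratic z) = 0" using ex_zero by blast
  have red: "\<exists>c e. N p = N [:c, e:] \<and> poly (map_poly of_real p) z = of_real c + of_real e * z" for p
  proof -
    obtain c e where ce: "p mod conj_quadratic z = [:c, e:]" using mod_conj_quadratic by blast
    have p: "p = p div conj_quadratic z * conj_quadratic z + [:c, e:]" by (simp flip: ce)
    have "N p = N [:c, e:]" by (subst p) (rule eq_if_zero [OF z])
    moreover have "poly (map_poly of_real p) z = of_real c + of_real e * z"
      by (subst p) (simp add: poly_conj_quadratic map_poly_pCons mult.commute)
    ultimately show ?thesis by blast
  qed
  show ?thesis
  proof (cases "Im z = 0")
    case True
    define a where "a = Re z"
    have za: "z = of_real a" using True by (simp add: complex_eq_iff a_def)
    then have "conj_quadratic z = [:- a, 1:] * [:- a, 1:]"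
      by (simp add: conj_quadratic_def power2_eq_square)
    then have "N [:- a, 1:] * N [:- a, 1:] = 0" using z by (simp only: mult)
    then have Na: "N [:- a, 1:] = 0" by simp
    have "N [:c, e:] = cmod (of_real c + of_real e * z)" for c e
    proof -
      have "[:c, e:] = [:e:] * [:- a, 1:] + [:c + e * a:]" by simp
      then have "N [:c, e:] = N [:c + e * a:]" using eq_if_zero [OF Na] by metis
      also have "\<dots> = cmod (of_real (c + e * a))" unfolding const norm_of_real ..
      finally show ?thesis by (simp add: za)
    qed
    then show ?thesis using red by metis
  next
    case False
    \<comment> \<open>Comparison of a seminorm with the modulus on a space of dimension 2. The
      constant is eliminated afterwards by taking powers.\<close>
    define C where "C = 1 + (cmod z + \<xi>) / \<bar>Im z\<bar>"
    have "N [:c, e:] \<le> C * cmod (of_real c + of_real e * z)" for c e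
    proof -
      define w where "w = of_real c + of_real e * z"
      have "\<bar>e * Im z\<bar> \<le> cmod w" using abs_Im_le_cmod [of w] by (simp add: w_def)
      then have e: "\<bar>e\<bar> \<le> cmod w / \<bar>Im z\<bar>" using False by (simp add: abs_mult field_simps)
      have "of_real c = w - of_real e * z" by (simp add: w_def)
      then have "cmod (of_real c) \<le> cmod w + cmod (of_real e * z)" using norm_triangle_ineq4 by metis
      then have "\<bar>c\<bar> \<le> cmod w + \<bar>e\<bar> * cmod z" by (simp add: norm_mult)
      then have "N [:c, e:] \<le> cmod w + \<bar>e\<bar> * (cmod z + \<xi>)"
        using linear_le [of c e] by (simp add: algebra_simps)
      also have "\<dots> \<le> cmod w + cmod w / \<bar>Im z\<bar> * (cmod z + \<xi>)"
        using e nonneg by (intro add_left_mono mult_right_mono) (auto simp: \<xi>_def)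
      also have "\<dots> = C * cmod w" by (simp add: C_def algebra_simps)
      finally show ?thesis by (simp add: w_def)
    qed
    then have C: "N p \<le> C * cmod (poly (map_poly of_real p) z)" for p using red [of p] by auto
    have pow: "poly (map_poly of_real (p ^ n)) z = poly (map_poly of_real p) z ^ n" for p n
      by (induction n) (simp_all add: map_poly_1)
    have upper: "N p \<le> cmod (poly (map_poly of_real p) z)" for p
    proof (rule le_of_power_le [of _ _ 0 C])
      show "N p ^ n \<le> (0 * real n + C) * cmod (poly (map_poly of_real p) z) ^ n" for n
        using C [of "p ^ n"] by (simp add: power pow norm_power)
    qed (use nonneg in auto)
    have "N [:c, e:] = cmod (of_real c + of_real e * z)" for c e
    proof -
      define w where "w = of_real c + of_real e * z"
      \<comment> \<open>The remainder that takes the value \<open>cnj w\<close> at \<open>z\<close>.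
        Its product with \<open>[:c, e:]\<close> is the constant of size |w|^2 modulo the quadratic,
        which turns the upper bound for \<open>L'\<close> into a lower bound for
        \<open>[:c, e:]\<close>.\<close>
      define L' where "L' = [:c + e * (2 * Re z), - e:]"
      have "[:c, e:] * L' = [:- (e\<^sup>2):] * conj_quadratic z + [:(cmod w)\<^sup>2:]"
        unfolding L'_def w_def conj_quadratic_def cmod_power2
        by (simp add: algebra_simps power2_eq_square)
      then have "N ([:c, e:] * L') = N [:(cmod w)\<^sup>2:]" using eq_if_zero [OF z] by metis
      then have prod: "N [:c, e:] * N L' = (cmod w)\<^sup>2" unfolding mult const by simp
      have "poly (map_poly of_real L') z = cnj w"
        by (simp add: L'_def w_def map_poly_pCons complex_eq_iff)
      then have "N L' \<le> cmod w" using upper [of L'] by simp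
      moreover have le: "N [:c, e:] \<le> cmod w" using upper [of "[:c, e:]"]
        by (simp add: w_def map_poly_pCons mult.commute)
      ultimately show ?thesis
      proof (cases "cmod w = 0")
        case False
        have "(cmod w)\<^sup>2 \<le> N [:c, e:] * cmod w"
          using prod \<open>N L' \<le> cmod w\<close> nonneg by (metis mult_left_mono)
        then have "cmod w \<le> N [:c, e:]" using False by (simp add: power2_eq_square)
        with le show ?thesis by (simp add: w_def)
      qed (use nonneg [of "[:c, e:]"] in \<open>simp add: w_def\<close>)
    qed
    then show ?thesis using red by metis
  qed
qed

end

section \<open>Archimedean absolute values\<close>

lemma absolute_valueD:
  assumes "absolute_value a"
  shows "0 \<le> a x" "a x = 0 \<longleftrightarrow> x = 0" "a (x * y) = a x * a y" "a (x + y) \<le> a x + a y"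
    "a 1 = 1" "a (- x) = a x" "a (x ^ n) = a x ^ n" "a (inverse x) = inverse (a x)"
    "a (x / y) = a x / a y"
proof -
  show nn: "\<And>x. 0 \<le> a x" and z: "\<And>x. a x = 0 \<longleftrightarrow> x = 0"
    and m: "\<And>x y. a (x * y) = a x * a y" and "\<And>x y. a (x + y) \<le> a x + a y"
    using assms by (auto simp: absolute_value_def)
  show one: "a 1 = 1" using m [of 1 1] z [of 1] by simp
  have "(a (- 1))\<^sup>2 = 1" using m [of "- 1" "- 1"] one by (simp add: power2_eq_square)
  then have "a (- 1) = 1" using nn [of "- 1"] by (simp add: power2_eq_1_iff)
  then show "a (- x) = a x" using m [of "- 1" x] by simp
  show "a (x ^ n) = a x ^ n" by (induction n) (simp_all add: m one)
  show inv: "a (inverse x) = inverse (a x)" for x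
  proof (cases "x = 0")
    case False
    then have "a x * a (inverse x) = 1" using m [of x "inverse x"] one by simp
    then show ?thesis by (simp add: inverse_unique)
  qed (use z [of 0] in simp)
  show "a (x / y) = a x / a y" by (simp add: divide_inverse m inv)
qed

lemma absolute_value_diff:
  assumes "absolute_value a"
  shows "\<bar>a x - a y\<bar> \<le> a (x - y)"
proof -
  note A = absolute_valueD [OF assms]
  show ?thesis using A(4) [of "x - y" y] A(4) [of "y - x" x] A(6) [of "x - y"] by simp
qed

lemma absolute_value_sum:
  assumes "absolute_value a"
  shows "a (sum f I) \<le> (\<Sum>i\<in>I. a (f i))"
proof (induction I rule: infinite_finite_induct)
  case (insert i I)
  then show ?case using absolute_valueD(4) [OF assms, of "f i" "sum f I"] by simp
qed (use absolute_valueD(2) [OF assms, of 0] in auto)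

section \<open>Powers of absolute values\<close>

lemma absolute_value_of_nat_le:
  fixes a :: "'a::field \<Rightarrow> real"
  assumes "absolute_value a" "1 < B" "a 2 \<le> B"
  shows "a (of_nat n) \<le> B / (B - 1) * real n powr log 2 B"
proof -
  note A = absolute_valueD [OF assms(1)]
  define \<sigma> where "\<sigma> = log 2 B"
  have \<sigma>: "0 < \<sigma>" using assms(2) by (simp add: \<sigma>_def)
  have two: "2 powr \<sigma> = B" using assms(2) by (simp add: \<sigma>_def)
  \<comment> \<open>Halving n gives \<open>B\<close> times the bound for the half plus at most 1 for
    the last binary digit. The number -1 / (B - 1) is the fixed point of x \<mapsto> B x + 1, so
    subtracting 1 / (B - 1) makes the induction close.\<close>
  have "a (of_nat n) \<le> B / (B - 1) * real n powr \<sigma> - 1 / (B - 1)" if "1 \<le> n" for n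
    using that
  proof (induction n rule: less_induct)
    case (less n)
    show ?case
    proof (cases "n = 1")
      case True
      then show ?thesis using A(5) assms(2) by (simp add: diff_divide_distrib [symmetric])
    next
      case False
      define m where "m = n div 2"
      have m: "1 \<le> m" "m < n" using less.prems False by (auto simp: m_def)
      have n: "n = 2 * m + n mod 2" by (simp add: m_def)
      have "a (of_nat (n mod 2)) \<le> 1"
        using A(5) A(2) [of 0] by (cases "even n") (simp_all add: odd_iff_mod_2_eq_one even_iff_mod_2_eq_zero)
      moreover have "(of_nat n :: 'a) = 2 * of_nat m + of_nat (n mod 2)"
        by (subst n) (simp only: of_nat_add of_nat_mult of_nat_numeral)
      ultimately have "a (of_nat n) \<le> a 2 * a (of_nat m) + 1"
        using A(4) [of "2 * of_nat m" "of_nat (n mod 2)"] by (simp add: A(3))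
      also have "\<dots> \<le> B * (B / (B - 1) * real m powr \<sigma> - 1 / (B - 1)) + 1"
        using less.IH [OF m(2,1)] assms(2,3) A(1) by (intro add_right_mono mult_mono) auto
      also have "\<dots> = B / (B - 1) * (2 * real m) powr \<sigma> - 1 / (B - 1)"
      proof -
        define k where "k = 1 / (B - 1)"
        have k: "B * k = 1 + k" "B / (B - 1) = 1 + k" using assms(2) by (simp_all add: k_def field_simps)
        have "B * ((1 + k) * real m powr \<sigma> - k) + 1 = (1 + k) * (B * real m powr \<sigma>) - k"
          using k(1) by (simp add: algebra_simps)
        then show ?thesis using k(2) by (simp add: powr_mult two k_def)
      qed
      also have "\<dots> \<le> B / (B - 1) * real n powr \<sigma> - 1 / (B - 1)"
        using assms(2) \<sigma> by (intro diff_right_mono mult_left_mono powr_mono2) (auto simp: m_def)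
      finally show ?thesis .
    qed
  qed
  then have "a (of_nat n) \<le> B / (B - 1) * real n powr \<sigma>" if "1 \<le> n"
    using that assms(2) by (smt (verit) divide_pos_pos)
  moreover have "a (of_nat n) \<le> B / (B - 1) * real n powr \<sigma>" if "n = 0"
    using that A(2) [of 0] by simp
  ultimately show ?thesis unfolding \<sigma>_def by linarith
qed

text \<open>In the binomial expansion of the n-th power of \<open>x + y\<close> each of the n + 1
  terms is bounded by a constant times a power of \<open>b x + b y\<close>;
  \<open>le_of_power_le\<close> then removes both the constant and the number of terms. Taking
  \<open>B = a 2\<close> normalises an archimedean absolute value, and letting B tend to 1 gives the
  ultrametric inequality.\<close>

lemma absolute_value_powr:
  fixes a :: "'a::field \<Rightarrow> real"
  assumes "absolute_value a" "1 < B" "a 2 \<le> B"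
  shows "absolute_value (\<lambda>x. a x powr (1 / log 2 B))"
proof -
  note A = absolute_valueD [OF assms(1)]
  define \<sigma> where "\<sigma> = log 2 B"
  have \<sigma>: "0 < \<sigma>" using assms(2) by (simp add: \<sigma>_def)
  define C where "C = B / (B - 1)"
  have C: "0 \<le> C" using assms(2) by (simp add: C_def)
  define b where "b = (\<lambda>x. a x powr (1 / \<sigma>))"
  have ab: "a x = b x powr \<sigma>" for x using A(1) [of x] \<sigma> by (simp add: b_def powr_powr)
  have b0: "0 \<le> b x" for x by (simp add: b_def)
  have pow: "(c powr \<sigma>) ^ k = (c ^ k) powr \<sigma>" if "0 \<le> c" for c :: real and k
    using that by (induction k) (simp_all add: powr_mult)
  have a_pow: "a (u ^ k) = (b u ^ k) powr \<sigma>" for u k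
    unfolding A(7) ab [of u] by (rule pow [OF b0])
  have "b (x + y) \<le> b x + b y" for x y
  proof -
    have "a (x + y) ^ n \<le> (C * real n + C) * ((b x + b y) powr \<sigma>) ^ n" for n
    proof -
      have "a (x + y) ^ n = a (\<Sum>k\<le>n. of_nat (n choose k) * x ^ k * y ^ (n - k))"
        unfolding A(7) [symmetric] by (simp add: binomial_ring)
      also have "\<dots> \<le> (\<Sum>k\<le>n. a (of_nat (n choose k) * x ^ k * y ^ (n - k)))"
        by (rule absolute_value_sum [OF assms(1)])
      also have "\<dots> \<le> (\<Sum>k\<le>n. C * ((b x + b y) ^ n) powr \<sigma>)"
      proof (rule sum_mono)
        fix k assume k: "k \<in> {..n}"
        have "a (of_nat (n choose k) * x ^ k * y ^ (n - k)) =
            a (of_nat (n choose k)) * (b x ^ k) powr \<sigma> * (b y ^ (n - k)) powr \<sigma>"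
          unfolding A(3) a_pow ..
        also have "\<dots> \<le> (C * real (n choose k) powr \<sigma>) * (b x ^ k) powr \<sigma> * (b y ^ (n - k)) powr \<sigma>"
          using absolute_value_of_nat_le [OF assms, of "n choose k"] unfolding C_def \<sigma>_def
          by (intro mult_right_mono) auto
        also have "\<dots> = C * (real (n choose k) * b x ^ k * b y ^ (n - k)) powr \<sigma>"
          using b0 by (simp add: powr_mult)
        also have "\<dots> \<le> C * ((b x + b y) ^ n) powr \<sigma>"
        proof -
          have "real (n choose k) * b x ^ k * b y ^ (n - k) \<le> (\<Sum>k\<le>n. real (n choose k) * b x ^ k * b y ^ (n - k))"
            using k b0 by (intro member_le_sum) auto
          then show ?thesis using C b0 \<sigma> by (intro mult_left_mono powr_mono2) (auto simp: binomial_ring)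
        qed
        finally show "a (of_nat (n choose k) * x ^ k * y ^ (n - k)) \<le> C * ((b x + b y) ^ n) powr \<sigma>" .
      qed
      also have "\<dots> = (C * real n + C) * ((b x + b y) ^ n) powr \<sigma>" by (simp add: algebra_simps)
      also have "((b x + b y) ^ n) powr \<sigma> = ((b x + b y) powr \<sigma>) ^ n"
        by (rule pow [symmetric]) (use b0 [of x] b0 [of y] in simp)
      finally show ?thesis .
    qed
    then have "a (x + y) \<le> (b x + b y) powr \<sigma>"
      by (rule le_of_power_le [rotated 2]) (use A(1) in auto)
    then have "a (x + y) powr (1 / \<sigma>) \<le> ((b x + b y) powr \<sigma>) powr (1 / \<sigma>)"
      using A(1) \<sigma> by (intro powr_mono2) auto
    then show ?thesis using \<sigma> b0 [of x] b0 [of y] by (simp add: powr_powr b_def)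
  qed
  moreover have "b (x * y) = b x * b y" for x y by (simp add: b_def A(1,3) powr_mult)
  moreover have "b x = 0 \<longleftrightarrow> x = 0" for x by (simp add: b_def A(2))
  ultimately show ?thesis using b0 unfolding absolute_value_def b_def \<sigma>_def by auto
qed

text \<open>Every B > 1 is admissible in \<open>absolute_value_powr\<close>. The resulting triangle
  inequality, raised back to the original exponent, bounds the sum by B times the maximum, and B is
  arbitrary.\<close>

lemma ultrametric:
  fixes a :: "'a::field \<Rightarrow> real"
  assumes "absolute_value a" "a 2 \<le> 1"
  shows "a (x + y) \<le> max (a x) (a y)"
proof -
  note A = absolute_valueD [OF assms(1)]
  define M where "M = max (a x) (a y)"
  have M: "0 \<le> M" using A(1) [of x] by (simp add: M_def le_max_iff_disj)
  have "a (x + y) \<le> B * M" if B: "1 < B" for B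
  proof -
    define \<sigma> where "\<sigma> = log 2 B"
    have \<sigma>: "0 < \<sigma>" using B by (simp add: \<sigma>_def)
    have "absolute_value (\<lambda>x. a x powr (1 / \<sigma>))"
      unfolding \<sigma>_def using assms B by (intro absolute_value_powr) auto
    from absolute_valueD(4) [OF this, of x y]
    have "a (x + y) powr (1 / \<sigma>) \<le> a x powr (1 / \<sigma>) + a y powr (1 / \<sigma>)" .
    also have "\<dots> \<le> M powr (1 / \<sigma>) + M powr (1 / \<sigma>)"
      using A(1) \<sigma> by (intro add_mono powr_mono2) (auto simp: M_def)
    finally have "(a (x + y) powr (1 / \<sigma>)) powr \<sigma> \<le> (2 * M powr (1 / \<sigma>)) powr \<sigma>"
      using \<sigma> by (intro powr_mono2) auto
    then have "a (x + y) \<le> 2 powr \<sigma> * M" using A(1) M \<sigma> by (simp add: powr_powr powr_mult)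
    moreover have "2 powr \<sigma> = B" using B by (simp add: \<sigma>_def)
    ultimately show ?thesis by simp
  qed
  note * = this
  show ?thesis unfolding M_def [symmetric]
  proof (rule field_le_mult_one_interval)
    fix z :: real assume z: "0 < z" "z < 1"
    have "a (x + y) \<le> inverse z * M" using * [of "inverse z"] z by (simp add: one_less_inverse)
    then show "z * a (x + y) \<le> M" using z by (simp add: field_simps)
  qed
qed

section \<open>From an archimedean absolute value to a seminorm on real polynomials\<close>

locale archimedean_absolute_value =
  fixes a :: "'a::field \<Rightarrow> real" and x :: 'a
  assumes absolute_value: "absolute_value a" and two: "a 2 = 2"
begin

lemmas A = absolute_valueD [OF absolute_value]

text \<open>The upper bound is the triangle inequality. Applied also to 2^n - n it leaves no room:
  the two summands of 2^n must together reach the value 2^n.\<close>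

lemma of_nat: "a (of_nat n) = real n"
proof -
  have le: "a (of_nat n) \<le> real n" for n
  proof (induction n)
    case (Suc n)
    then show ?case using A(4) [of 1 "of_nat n"] A(5) by simp
  qed (use A(2) [of 0] in simp)
  have "(2 :: 'a) ^ n = of_nat n + of_nat (2 ^ n - n)"
    using less_exp [of n] by (simp flip: of_nat_add add: less_imp_le)
  then have "2 ^ n \<le> a (of_nat n) + a (of_nat (2 ^ n - n))"
    using A(4) [of "of_nat n" "of_nat (2 ^ n - n)"] A(7) [of 2 n] two by simp
  moreover have "a (of_nat (2 ^ n - n)) \<le> 2 ^ n - real n"
    using le [of "2 ^ n - n"] less_exp [of n] by (simp add: of_nat_diff less_imp_le)
  ultimately show ?thesis using le [of n] by linarith
qed

lemma of_int: "a (of_int i) = \<bar>real_of_int i\<bar>"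
  by (cases i rule: int_cases2) (simp_all add: of_nat A(6))

text \<open>The field contains no real numbers besides rational ones in general; \<open>E n p / n\<close> approximates the missing value
  of the real polynomial \<open>p\<close> at \<open>x\<close>.\<close>

definition E where "E n p = poly (map_poly (\<lambda>c. of_int \<lfloor>c * real n\<rfloor>) p) x"

lemma E_0: "E n 0 = 0"
  by (simp add: E_def)

lemma E_pCons: "E n (pCons c p) = of_int \<lfloor>c * real n\<rfloor> + x * E n p"
  by (simp add: E_def map_poly_pCons)

lemma step:
  assumes "\<bar>real_of_int i\<bar> \<le> D" "a u \<le> D'"
  shows "a (of_int i + x * u) \<le> D + a x * D'"
  using A(4) [of "of_int i" "x * u"] mult_left_mono [OF assms(2) A(1) [of x]] assms(1)
  by (simp add: A(3) of_int)

text \<open>Rounding spoils additivity by a bounded amount and, in \<open>E_mult\<close>,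
  multiplicativity by an amount linear in n. After division by n and by its square, respectively,
  both errors tend to 0, so the limit is a multiplicative seminorm.\<close>

lemma E_add: "\<exists>D. \<forall>n. a (E n (p + q) - E n p - E n q) \<le> D"
proof (induction p q rule: poly_induct2)
  case (pCons c p d q)
  then obtain D where D: "\<And>n. a (E n (p + q) - E n p - E n q) \<le> D" by blast
  have "a (E n (pCons c p + pCons d q) - E n (pCons c p) - E n (pCons d q)) \<le> 2 + a x * D" for n
  proof -
    have "\<bar>real_of_int (\<lfloor>(c + d) * real n\<rfloor> - \<lfloor>c * real n\<rfloor> - \<lfloor>d * real n\<rfloor>)\<bar> \<le> 2"
    proof -
      define u v where "u = c * real n" and "v = d * real n"
      define i j k where "i = real_of_int \<lfloor>u + v\<rfloor>" and "j = real_of_int \<lfloor>u\<rfloor>" and "k = real_of_int \<lfloor>v\<rfloor>"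
      have "i \<le> u + v" "u + v < i + 1" "j \<le> u" "u < j + 1" "k \<le> v" "v < k + 1"
        unfolding i_def j_def k_def by simp_all
      then have "\<bar>i - j - k\<bar> \<le> 2" unfolding abs_le_iff by linarith
      then show ?thesis by (simp add: i_def j_def k_def u_def v_def distrib_right)
    qed
    from step [OF this D] show ?thesis by (simp add: E_pCons algebra_simps)
  qed
  then show ?case by blast
qed (use A(2) [of 0] in \<open>auto simp: E_0\<close>)

lemma floor_mult:
  "\<bar>real n * \<lfloor>c * d * real n\<rfloor> - \<lfloor>c * real n\<rfloor> * \<lfloor>d * real n\<rfloor>\<bar> \<le> (2 + \<bar>c\<bar> + \<bar>d\<bar>) * real n"
proof (cases "n = 0")
  case False
  define \<alpha> \<beta> \<gamma> where "\<alpha> = frac (c * real n)" and "\<beta> = frac (d * real n)" and "\<gamma> = frac (c * d * real n)"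
  have fl: "\<lfloor>c * real n\<rfloor> = c * real n - \<alpha>" "\<lfloor>d * real n\<rfloor> = d * real n - \<beta>"
    "\<lfloor>c * d * real n\<rfloor> = c * d * real n - \<gamma>"
    by (simp_all add: \<alpha>_def \<beta>_def \<gamma>_def frac_def)
  have r: "\<bar>\<alpha>\<bar> \<le> 1" "\<bar>\<beta>\<bar> \<le> 1" "\<bar>\<gamma>\<bar> \<le> 1"
    by (simp_all add: \<alpha>_def \<beta>_def \<gamma>_def frac_ge_0 less_imp_le [OF frac_lt_1])
  have "real n * \<lfloor>c * d * real n\<rfloor> - \<lfloor>c * real n\<rfloor> * \<lfloor>d * real n\<rfloor>
      = (c * \<beta> + d * \<alpha> - \<gamma>) * real n - \<alpha> * \<beta>"
    unfolding of_int_mult fl by (simp add: algebra_simps)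
  also have "\<bar>\<dots>\<bar> \<le> \<bar>c * \<beta> + d * \<alpha> - \<gamma>\<bar> * real n + \<bar>\<alpha> * \<beta>\<bar>"
    using abs_triangle_ineq4 [of "(c * \<beta> + d * \<alpha> - \<gamma>) * real n" "\<alpha> * \<beta>"] by (simp add: abs_mult)
  also have "\<dots> \<le> (\<bar>c\<bar> + \<bar>d\<bar> + 1) * real n + 1"
  proof (intro add_mono mult_right_mono)
    have "\<bar>c * \<beta>\<bar> \<le> \<bar>c\<bar>" "\<bar>d * \<alpha>\<bar> \<le> \<bar>d\<bar>" using r by (simp_all add: abs_mult mult_left_le)
    then show "\<bar>c * \<beta> + d * \<alpha> - \<gamma>\<bar> \<le> \<bar>c\<bar> + \<bar>d\<bar> + 1" using r by linarith
    show "\<bar>\<alpha> * \<beta>\<bar> \<le> 1" using r by (simp add: abs_mult mult_le_one)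
  qed simp
  also have "\<dots> \<le> (2 + \<bar>c\<bar> + \<bar>d\<bar>) * real n" using False by (simp add: algebra_simps)
  finally show ?thesis .
qed simp

lemma E_smult: "\<exists>D. \<forall>n. a (of_nat n * E n (smult c p) - of_int \<lfloor>c * real n\<rfloor> * E n p) \<le> D * real n"
proof (induction p)
  case (pCons d p)
  then obtain D where
    D: "\<And>n. a (of_nat n * E n (smult c p) - of_int \<lfloor>c * real n\<rfloor> * E n p) \<le> D * real n" by blast
  have "a (of_nat n * E n (smult c (pCons d p)) - of_int \<lfloor>c * real n\<rfloor> * E n (pCons d p))
      \<le> (2 + \<bar>c\<bar> + \<bar>d\<bar> + a x * D) * real n" for n
  proof -
    have "\<bar>real_of_int (int n * \<lfloor>c * d * real n\<rfloor> - \<lfloor>c * real n\<rfloor> * \<lfloor>d * real n\<rfloor>)\<bar> \<le> (2 + \<bar>c\<bar> + \<bar>d\<bar>) * real n"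
      using floor_mult [of n c d] by simp
    from step [OF this D] show ?thesis by (simp add: E_pCons algebra_simps)
  qed
  then show ?case by blast
qed (use A(2) [of 0] in \<open>auto simp: E_0 intro: exI [of _ 0]\<close>)

text \<open>Serves the Cauchy property: the normalised values at m and at n are both compared with
  the value at the product m n.\<close>

lemma E_scale: "\<exists>D\<ge>0. \<forall>m n. a (E (m * n) p - of_nat m * E n p) \<le> D * real m"
proof (induction p)
  case (pCons d p)
  then obtain D where D0: "0 \<le> D" and
    D: "\<And>m n. a (E (m * n) p - of_nat m * E n p) \<le> D * real m" by blast
  have "a (E (m * n) (pCons d p) - of_nat m * E n (pCons d p)) \<le> (1 + a x * D) * real m" for m n
  proof -
    have "real m * \<lfloor>d * real n\<rfloor> \<le> real m * (d * real n)" "real m * (d * real n) \<le> real m * (\<lfloor>d * real n\<rfloor> + 1)"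
      by (intro mult_left_mono; linarith)+
    moreover have "d * real (m * n) = real m * (d * real n)" by simp
    ultimately have "\<bar>real_of_int (\<lfloor>d * real (m * n)\<rfloor> - int m * \<lfloor>d * real n\<rfloor>)\<bar> \<le> 1 * real m"
    proof -
      define u where "u = real m * (d * real n)"
      define k where "k = int m * \<lfloor>d * real n\<rfloor>"
      assume *: "real m * \<lfloor>d * real n\<rfloor> \<le> real m * (d * real n)"
        "real m * (d * real n) \<le> real m * (\<lfloor>d * real n\<rfloor> + 1)" "d * real (m * n) = real m * (d * real n)"
      have "real_of_int k \<le> u" "u \<le> real_of_int (k + int m)"
        using *(1,2) by (simp_all add: u_def k_def algebra_simps)
      then have "k \<le> \<lfloor>u\<rfloor>" "\<lfloor>u\<rfloor> \<le> k + int m" by linarith+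
      then show ?thesis unfolding *(3) u_def [symmetric] k_def [symmetric] by linarith
    qed
    from step [OF this D] show ?thesis by (simp add: E_pCons algebra_simps)
  qed
  moreover have "0 \<le> 1 + a x * D" using A(1) D0 by simp
  ultimately show ?case by blast
qed (use A(2) [of 0] in \<open>auto simp: E_0 intro: exI [of _ 0]\<close>)

lemma E_mult: "\<exists>D. \<forall>n. a (of_nat n * E n (p * q) - E n p * E n q) \<le> D * real n"
proof (induction p)
  case (pCons c p)
  then obtain D where D: "\<And>n. a (of_nat n * E n (p * q) - E n p * E n q) \<le> D * real n" by blast
  obtain D1 where D1: "\<And>n. a (E n (smult c q + pCons 0 (p * q)) - E n (smult c q) - E n (pCons 0 (p * q))) \<le> D1"
    using E_add by blast
  obtain D2 where D2: "\<And>n. a (of_nat n * E n (smult c q) - of_int \<lfloor>c * real n\<rfloor> * E n q) \<le> D2 * real n"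
    using E_smult by blast
  have "a (of_nat n * E n (pCons c p * q) - E n (pCons c p) * E n q) \<le> (D1 + (D2 + a x * D)) * real n" for n
  proof -
    define u1 u2 u3 where "u1 = E n (smult c q + pCons 0 (p * q)) - E n (smult c q) - E n (pCons 0 (p * q))"
      and "u2 = of_nat n * E n (smult c q) - of_int \<lfloor>c * real n\<rfloor> * E n q"
      and "u3 = of_nat n * E n (p * q) - E n p * E n q"
    have "of_nat n * E n (pCons c p * q) - E n (pCons c p) * E n q = of_nat n * u1 + (u2 + x * u3)"
      by (simp add: u1_def u2_def u3_def E_pCons algebra_simps)
    also have "a \<dots> \<le> a (of_nat n * u1) + (a u2 + a (x * u3))"
      using A(4) [of "of_nat n * u1" "u2 + x * u3"] A(4) [of u2 "x * u3"] by simp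
    also have "\<dots> \<le> real n * D1 + (D2 * real n + a x * (D * real n))"
      unfolding A(3) of_nat using D1 D2 D A(1)
      by (intro add_mono mult_left_mono) (auto simp: u1_def u2_def u3_def)
    finally show ?thesis by (simp add: algebra_simps)
  qed
  then show ?case by blast
qed (use A(2) [of 0] in \<open>auto simp: E_0 intro: exI [of _ 0]\<close>)

definition e where "e p n = a (E n p) / real n"

definition N where "N p = lim (e p)"

lemma e_tendsto: "e p \<longlonglongrightarrow> N p"
proof -
  obtain D where D0: "0 \<le> D" and D: "\<And>m n. a (E (m * n) p - of_nat m * E n p) \<le> D * real m"
    using E_scale by blast
  have near: "\<bar>e p (m * n) - e p n\<bar> \<le> D / real n" if "0 < m" "0 < n" for m n
  proof -
    have "\<bar>a (E (m * n) p) - real m * a (E n p)\<bar> \<le> D * real m"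
      using absolute_value_diff [OF absolute_value, of "E (m * n) p" "of_nat m * E n p"] D [of m n]
      by (simp add: A(3) of_nat)
    then have "\<bar>a (E (m * n) p) - real m * a (E n p)\<bar> / (real m * real n) \<le> D * real m / (real m * real n)"
      by (intro divide_right_mono) auto
    moreover have "\<bar>a (E (m * n) p) - real m * a (E n p)\<bar> / (real m * real n) = \<bar>e p (m * n) - e p n\<bar>"
    proof -
      have "e p (m * n) - e p n = (a (E (m * n) p) - real m * a (E n p)) / (real m * real n)"
        using that by (simp add: e_def diff_divide_distrib)
      then show ?thesis by (simp add: abs_mult)
    qed
    ultimately show ?thesis using that by simp
  qed
  have "Cauchy (e p)"
  proof (rule metric_CauchyI)
    fix \<epsilon> :: real assume \<epsilon>: "0 < \<epsilon>"
    obtain M where M: "2 * D / \<epsilon> < real M" "0 < M"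
      using reals_Archimedean2 [of "max 1 (2 * D / \<epsilon>)"] by auto
    have "dist (e p m) (e p n) < \<epsilon>" if "M \<le> m" "M \<le> n" for m n
    proof -
      have pos: "0 < m" "0 < n" using that M(2) by auto
      have small: "D / real k < \<epsilon> / 2" if "M \<le> k" for k
      proof -
        have "2 * D / \<epsilon> < real k" "0 < real k" using M that by linarith+
        then show ?thesis using \<epsilon> by (simp add: field_simps)
      qed
      have "\<bar>e p (m * n) - e p n\<bar> < \<epsilon> / 2" "\<bar>e p (n * m) - e p m\<bar> < \<epsilon> / 2"
        using near [OF pos] near [OF pos(2,1)] small that by (meson le_less_trans)+
      then show ?thesis unfolding dist_real_def mult.commute [of n m] by linarith
    qed
    then show "\<exists>M. \<forall>m\<ge>M. \<forall>n\<ge>M. dist (e p m) (e p n) < \<epsilon>" by blast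
  qed
  then show ?thesis using Cauchy_convergent convergent_LIMSEQ_iff by (simp add: N_def) blast
qed

text \<open>Polynomials with integer coefficients undergo no rounding, so on them the limit is the
  original absolute value of the value at \<open>x\<close>.\<close>

lemma N_exact:
  assumes "\<And>n. E n p = of_nat n * u"
  shows "N p = a u"
proof -
  have "eventually (\<lambda>n. e p n = a u) sequentially"
    using eventually_gt_at_top [of 0] by eventually_elim (simp add: e_def assms A(3) of_nat)
  then have "e p \<longlonglongrightarrow> a u" by (rule tendsto_eventually)
  then show ?thesis using e_tendsto LIMSEQ_unique by blast
qed

sublocale multiplicative_seminorm N
proof
  fix p q :: "real poly" and c :: real
  obtain D where D: "\<And>n. a (of_nat n * E n (p * q) - E n p * E n q) \<le> D * real n"
    using E_mult by blast
  have "(\<lambda>n. e (p * q) n - e p n * e q n) \<longlonglongrightarrow> 0"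
  proof (rule Lim_null_comparison)
    show "\<forall>\<^sub>F n in sequentially. norm (e (p * q) n - e p n * e q n) \<le> D / real n"
      using eventually_gt_at_top [of 0]
    proof eventually_elim
      case (elim n)
      have "\<bar>real n * a (E n (p * q)) - a (E n p) * a (E n q)\<bar> \<le> D * real n"
        using absolute_value_diff [OF absolute_value, of "of_nat n * E n (p * q)" "E n p * E n q"] D [of n]
        by (simp add: A(3) of_nat)
      then have "\<bar>real n * a (E n (p * q)) - a (E n p) * a (E n q)\<bar> / (real n * real n) \<le> D * real n / (real n * real n)"
        by (intro divide_right_mono) auto
      moreover have "e (p * q) n - e p n * e q n =
          (real n * a (E n (p * q)) - a (E n p) * a (E n q)) / (real n * real n)"
        using elim by (simp add: e_def diff_divide_distrib)
      ultimately show ?case using elim by (simp add: abs_mult)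
    qed
  qed (rule lim_const_over_n)
  moreover have "(\<lambda>n. e (p * q) n - e p n * e q n) \<longlonglongrightarrow> N (p * q) - N p * N q"
    by (intro tendsto_intros e_tendsto)
  ultimately show "N (p * q) = N p * N q" using LIMSEQ_unique by fastforce
  obtain D' where D': "\<And>n. a (E n (p + q) - E n p - E n q) \<le> D'"
    using E_add by blast
  have "(\<lambda>n. e p n + e q n + D' / real n) \<longlonglongrightarrow> N p + N q + 0"
    by (intro tendsto_intros e_tendsto lim_const_over_n)
  moreover have "e (p + q) n \<le> e p n + e q n + D' / real n" for n
  proof -
    have "a (E n (p + q)) \<le> a (E n p) + a (E n q) + D'"
      using A(4) [of "E n p + E n q" "E n (p + q) - E n p - E n q"] A(4) [of "E n p" "E n q"] D' [of n] by simp
    then have "a (E n (p + q)) / real n \<le> (a (E n p) + a (E n q) + D') / real n" by (rule divide_right_mono) simp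
    then show ?thesis by (simp add: e_def add_divide_distrib)
  qed
  ultimately have "N (p + q) \<le> N p + N q + 0"
    by (intro LIMSEQ_le [OF e_tendsto [of "p + q"]]) auto
  then show "N (p + q) \<le> N p + N q" by simp
  have "(\<lambda>n. e [:c:] n - \<bar>c\<bar>) \<longlonglongrightarrow> 0"
  proof (rule Lim_null_comparison)
    show "\<forall>\<^sub>F n in sequentially. norm (e [:c:] n - \<bar>c\<bar>) \<le> 1 / real n"
      using eventually_gt_at_top [of 0]
    proof eventually_elim
      case (elim n)
      have "\<bar>\<bar>real_of_int \<lfloor>c * real n\<rfloor>\<bar> - \<bar>c * real n\<bar>\<bar> \<le> 1" by linarith
      then have "\<bar>\<bar>real_of_int \<lfloor>c * real n\<rfloor>\<bar> - \<bar>c * real n\<bar>\<bar> / real n \<le> 1 / real n" by (rule divide_right_mono) simp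
      moreover have "e [:c:] n - \<bar>c\<bar> = (\<bar>real_of_int \<lfloor>c * real n\<rfloor>\<bar> - \<bar>c * real n\<bar>) / real n"
        using elim by (simp add: e_def E_pCons E_0 of_int abs_mult diff_divide_distrib)
      ultimately show ?case by simp
    qed
  qed (rule lim_const_over_n)
  then have "e [:c:] \<longlonglongrightarrow> \<bar>c\<bar>" by (rule LIM_zero_cancel)
  then show "N [:c:] = \<bar>c\<bar>" using e_tendsto LIMSEQ_unique by blast
qed

text \<open>All five elements are values at \<open>x\<close> of integer polynomials, hence one
  complex number represents them simultaneously.\<close>

lemma ex_complex:
  "\<exists>z. a x = cmod z \<and> a (1 - x) = cmod (1 - z) \<and> a (1 + x) = cmod (1 + z) \<and>
     a (1 - x\<^sup>2) = cmod (1 - z\<^sup>2) \<and> a (1 + x\<^sup>2) = cmod (1 + z\<^sup>2)"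
proof -
  obtain z where z: "\<And>p. N p = cmod (poly (map_poly of_real p) z)" using eq_cmod by blast
  have fl: "\<lfloor>- real n\<rfloor> = - int n" for n by (metis floor_of_int of_int_minus of_int_of_nat_eq)
  have "N [:0, 1:] = a x" "N [:1, - 1:] = a (1 - x)" "N [:1, 1:] = a (1 + x)"
    "N [:1, 0, - 1:] = a (1 - x\<^sup>2)" "N [:1, 0, 1:] = a (1 + x\<^sup>2)"
    by (rule N_exact; simp add: E_pCons E_0 fl algebra_simps power2_eq_square)+
  then show ?thesis
    unfolding z by (intro exI [of _ z]) (simp add: map_poly_pCons power2_eq_square)
qed

end

lemma cmod_one_minus_le:
  assumes "cmod (1 - z) < cmod (1 + z)" "cmod (1 - z\<^sup>2) < cmod (1 + z\<^sup>2)" "cmod z < 1 / 2"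
  shows "cmod (1 - z) \<le> 1 - cmod z / 2"
proof -
  define p q r where "p = Re z" and "q = Im z" and "r = cmod z"
  have r: "r\<^sup>2 = p\<^sup>2 + q\<^sup>2" "0 \<le> r" "r < 1 / 2" using assms(3) by (simp_all add: r_def p_def q_def cmod_power2)
  have half: "0 < Re w" if "cmod (1 - w) < cmod (1 + w)" for w
  proof -
    have "(cmod (1 - w))\<^sup>2 < (cmod (1 + w))\<^sup>2" using that by (simp add: power_strict_mono)
    then show ?thesis unfolding cmod_power2 by (simp add: power2_eq_square algebra_simps)
  qed
  have p: "0 < p" using half [OF assms(1)] by (simp add: p_def)
  have "q\<^sup>2 < p\<^sup>2" using half [OF assms(2)] by (simp add: p_def q_def Re_power2)
  then have "r\<^sup>2 < 2 * p\<^sup>2" using r(1) by simp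
  \<comment> \<open>After squaring, the claim reads r + 3/4 r^2 \<le> 2 p, and r < 1/2 bounds the
    left side by 11/8 r. Since 121/64 < 2, the sector condition r^2 < 2 p^2 suffices.\<close>
  moreover have "(11 / 8 * r)\<^sup>2 = 121 / 64 * r\<^sup>2" "(2 * p)\<^sup>2 = 4 * p\<^sup>2"
    by (simp_all add: power_mult_distrib power_divide)
  ultimately have "(11 / 8 * r)\<^sup>2 < (2 * p)\<^sup>2" using zero_le_power2 [of p] by linarith
  then have "11 / 8 * r < 2 * p" by (rule power2_less_imp_less) (use p in simp)
  moreover have "r\<^sup>2 \<le> 1 / 2 * r" unfolding power2_eq_square using r(2,3) by (intro mult_right_mono) auto
  ultimately have "3 / 4 * r\<^sup>2 + r \<le> 2 * p" by linarith
  moreover have "(cmod (1 - z))\<^sup>2 = 1 - 2 * p + r\<^sup>2"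
    unfolding r(1) cmod_power2 p_def q_def by (simp add: power2_eq_square algebra_simps)
  moreover have "(1 - r / 2)\<^sup>2 = 1 - r + r\<^sup>2 / 4" by (simp add: power2_eq_square algebra_simps)
  ultimately have "(cmod (1 - z))\<^sup>2 \<le> (1 - r / 2)\<^sup>2" by linarith
  then have "cmod (1 - z) \<le> 1 - r / 2" by (rule power2_le_imp_le) (use r in simp)
  then show ?thesis by (simp add: r_def)
qed

section \<open>Openness of the maximal ideal, uniformly in the place\<close>

lemma krull_valuation_one_le_minus_one:
  assumes "krull_valuation G v"
  shows "(\<one>\<^bsub>G\<^esub>, v (- 1)) \<in> oleq G"
proof -
  note f = krull_valuation_facts [OF assms]
  interpret comm_group G by (rule f(1))
  have c: "v (- 1) \<in> carrier G" using f(2) by simp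
  have sq: "v (- 1) \<otimes>\<^bsub>G\<^esub> v (- 1) = \<one>\<^bsub>G\<^esub>" using f(3) [of "- 1" "- 1"] f(4) by simp
  show ?thesis
  proof (rule ccontr)
    assume n: "(\<one>\<^bsub>G\<^esub>, v (- 1)) \<notin> oleq G"
    then have "(v (- 1), \<one>\<^bsub>G\<^esub>) \<in> oleq G" using f(5) c by blast
    then have "(v (- 1) \<otimes>\<^bsub>G\<^esub> v (- 1), \<one>\<^bsub>G\<^esub> \<otimes>\<^bsub>G\<^esub> v (- 1)) \<in> oleq G" using f(8) c by blast
    with n show False using sq c by simp
  qed
qed

section \<open>Orderings through their strictly positive elements\<close>

locale positive_cone =
  fixes Q :: "'a::field \<Rightarrow> bool"
  assumes add: "Q x \<Longrightarrow> Q y \<Longrightarrow> Q (x + y)"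
    and mult: "Q x \<Longrightarrow> Q y \<Longrightarrow> Q (x * y)"
    and trichotomy: "Q x \<or> x = 0 \<or> Q (- x)"
    and zero: "\<not> Q 0"
begin

lemma asym: "Q x \<Longrightarrow> \<not> Q (- x)"
  using add [of x "- x"] zero by auto

lemma square: "x \<noteq> 0 \<Longrightarrow> Q (x * x)"
  using trichotomy [of x] mult [of x x] mult [of "- x" "- x"] by auto

lemma one: "Q 1"
  using square [of 1] by simp

lemma numeral: "Q (numeral n)"
proof (induction n)
  case (Bit0 n)
  then show ?case unfolding numeral_Bit0 by (intro add)
next
  case (Bit1 n)
  then show ?case unfolding numeral_Bit1 by (intro add one)
qed (simp add: one)

lemma inverse: "Q (inverse x) \<longleftrightarrow> Q x"
proof -
  have "Q (inverse x)" if "Q x" for x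
  proof -
    have "x \<noteq> 0" using that zero by auto
    then show ?thesis using mult [OF that square [of "inverse x"]] by (simp flip: mult.assoc)
  qed
  from this [of x] this [of "inverse x"] show ?thesis by auto
qed

lemma divide: "Q x \<Longrightarrow> Q y \<Longrightarrow> Q (x / y)"
  unfolding divide_inverse by (intro mult) (simp_all add: inverse)

lemma mult_cancel: "Q (x * y) \<Longrightarrow> Q y \<Longrightarrow> Q x"
  using divide [of "x * y" y] zero by (cases "y = 0") auto

definition unit_interval where "unit_interval = {x. Q (1 + x) \<and> Q (1 - x)}"

lemma unit_interval_minus: "- x \<in> unit_interval \<longleftrightarrow> x \<in> unit_interval"
  by (auto simp: unit_interval_def)

text \<open>The Cayley transform expresses the sign of \<open>s\<close> by a membership in the
  maximal ideal, which the constructible topology can detect; \<open>cayley_D\<close> is the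
  converse.\<close>

lemma cayley_mem: "Q s \<Longrightarrow> (1 - s) / (1 + s) \<in> unit_interval"
proof -
  assume s: "Q s"
  have p: "Q (1 + s)" by (intro add one s)
  then have nz: "1 + s \<noteq> 0" using zero by metis
  have "1 + (1 - s) / (1 + s) = 2 / (1 + s)" "1 - (1 - s) / (1 + s) = 2 * s / (1 + s)"
    using nz by (simp_all add: field_simps)
  then show ?thesis using p s by (simp add: unit_interval_def divide mult numeral)
qed

lemma cayley_D:
  assumes "(1 - s) / (1 + s) \<in> unit_interval" "1 + s \<noteq> 0"
  shows "Q s"
proof -
  have "1 + (1 - s) / (1 + s) = 2 * inverse (1 + s)" "1 - (1 - s) / (1 + s) = s * (2 * inverse (1 + s))"
    using assms(2) by (simp_all add: field_simps)
  then have "Q (2 * inverse (1 + s))" "Q (s * (2 * inverse (1 + s)))"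
    using assms(1) by (auto simp: unit_interval_def)
  then show ?thesis using mult_cancel by blast
qed

end

lemma positive_cone_ordering:
  assumes "field_ordering r"
  shows "positive_cone (\<lambda>x. (0, x) \<in> r \<and> x \<noteq> 0)"
    "rep_m (Ordering r) = positive_cone.unit_interval (\<lambda>x. (0, x) \<in> r \<and> x \<noteq> 0)"
proof -
  note f = field_ordering_facts [OF assms]
  show pc: "positive_cone (\<lambda>x. (0, x) \<in> r \<and> x \<noteq> 0)"
  proof
    fix x y :: 'a
    assume xy: "(0, x) \<in> r \<and> x \<noteq> 0" "(0, y) \<in> r \<and> y \<noteq> 0"
    have "x + y \<noteq> 0"
    proof
      assume "x + y = 0"
      then have "y = - x" by (simp add: eq_neg_iff_add_eq_0 add.commute)
      then show False using f(5) [of x] xy by simp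
    qed
    then show "(0, x + y) \<in> r \<and> x + y \<noteq> 0" using f(2) xy by blast
  next
    fix x :: 'a
    show "((0, x) \<in> r \<and> x \<noteq> 0) \<or> x = 0 \<or> ((0, - x) \<in> r \<and> - x \<noteq> 0)" using f(4) [of x] by auto
  qed (use f(3) in auto)
  have "(- 1, x) \<in> r \<longleftrightarrow> (0, 1 + x) \<in> r" "(x, 1) \<in> r \<longleftrightarrow> (0, 1 - x) \<in> r"
    "x \<noteq> - 1 \<longleftrightarrow> 1 + x \<noteq> 0" "x \<noteq> 1 \<longleftrightarrow> 1 - x \<noteq> 0" for x
    using f(1) [of "- 1" x] f(1) [of x 1] by (auto simp: add.commute add_eq_0_iff)
  then show "rep_m (Ordering r) = positive_cone.unit_interval (\<lambda>x. (0, x) \<in> r \<and> x \<noteq> 0)"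
    unfolding positive_cone.unit_interval_def [OF pc] by auto
qed

lemma rep_basic:
  assumes "valid_representative p"
  shows "1 \<in> rep_O p" "- 1 \<in> rep_O p" "0 \<in> rep_m p" "1 \<notin> rep_m p"
proof -
  have "1 \<in> rep_O p \<and> - 1 \<in> rep_O p \<and> 0 \<in> rep_m p \<and> 1 \<notin> rep_m p"
  proof (cases p)
    case (Valuation G v)
    then have kv: "krull_valuation G v" using assms by simp
    note f = krull_valuation_facts [OF kv]
    have "(\<one>\<^bsub>G\<^esub>, \<one>\<^bsub>G\<^esub>) \<in> oleq G" using f(2) [of 1] f(4) f(5) [of "\<one>\<^bsub>G\<^esub>" "\<one>\<^bsub>G\<^esub>"] by simp
    then show ?thesis
      using Valuation f(4) krull_valuation_one_le_minus_one [OF kv] by simp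
  next
    case (Ordering r)
    then have r: "field_ordering r" using assms by simp
    note f = field_ordering_facts [OF r]
    interpret positive_cone "\<lambda>x. (0, x) \<in> r \<and> x \<noteq> 0" by (rule positive_cone_ordering [OF r])
    have "(0, 1) \<in> r" "(0, 2) \<in> r" "(0, 0) \<in> r" using one numeral [of "num.Bit0 num.One"] f(4) [of 0] by auto
    then have "(- 1, 1) \<in> r" "(1, 1) \<in> r" "(- 1, - 1) \<in> r" "(- 1, 0) \<in> r" "(0, 1) \<in> r"
      by (subst f(1); simp)+
    then show ?thesis
      using Ordering by simp
  next
    case (Absolute a)
    then have "absolute_value a" using assms by simp
    note A = absolute_valueD [OF this]
    show ?thesis
      using Absolute A(5,6) A(2) [of 0] by simp
  qed
  then show "1 \<in> rep_O p" "- 1 \<in> rep_O p" "0 \<in> rep_m p" "1 \<notin> rep_m p" by blast+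
qed

lemma rep_m_iff:
  assumes "valid_representative p" "x \<noteq> 0"
  shows "x \<in> rep_m p \<longleftrightarrow> inverse x \<notin> rep_O p"
proof
  assume "x \<in> rep_m p"
  then show "inverse x \<notin> rep_O p"
    using rep_O_m [OF assms(1), of "inverse x" x] rep_basic(4) [OF assms(1)] assms(2) by auto
next
  assume n: "inverse x \<notin> rep_O p"
  then have x: "x \<in> rep_O p" using rep_O_or_inverse assms by blast
  show "x \<in> rep_m p"
  proof (cases p)
    case (Valuation G v)
    then have kv: "krull_valuation G v" using assms by simp
    note f = krull_valuation_facts [OF kv]
    interpret comm_group G by (rule f(1))
    have "v x \<noteq> \<one>\<^bsub>G\<^esub>"
    proof
      assume "v x = \<one>\<^bsub>G\<^esub>"
      then have "v (inverse x) = \<one>\<^bsub>G\<^esub>"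
        using f(3) [of x "inverse x"] f(2) [of "inverse x"] f(4) assms(2) by simp
      moreover have "(\<one>\<^bsub>G\<^esub>, \<one>\<^bsub>G\<^esub>) \<in> oleq G" using f(2) [of 1] f(4) f(5) [of "\<one>\<^bsub>G\<^esub>" "\<one>\<^bsub>G\<^esub>"] by simp
      ultimately show False using n Valuation by simp
    qed
    then show ?thesis using x Valuation by auto
  next
    case (Ordering r)
    have "x \<noteq> 1" "x \<noteq> - 1" using n rep_basic [OF assms(1)] by auto
    then show ?thesis using x Ordering by auto
  next
    case (Absolute a)
    then have "absolute_value a" using assms by simp
    note A = absolute_valueD [OF this]
    have "a x \<noteq> 1" using n Absolute A(8) [of x] by auto
    then show ?thesis using x Absolute by auto
  qed
qed

text \<open>Integrality of 2 excludes orderings, where 2 exceeds 1, and makes an absolute value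
  ultrametric; for valuations the claim is the ultrametric inequality.\<close>

lemma rep_m_add:
  assumes "valid_representative p" "2 \<in> rep_O p" "x \<in> rep_m p" "y \<in> rep_m p"
  shows "x + y \<in> rep_m p"
proof (cases p)
  case (Valuation G v)
  then have kv: "krull_valuation G v" using assms by simp
  note f = krull_valuation_facts [OF kv]
  show ?thesis
  proof (cases "x = 0 \<or> y = 0 \<or> x + y = 0")
    case True
    then show ?thesis using assms(3,4) rep_basic(3) [OF assms(1)] by (elim disjE) simp_all
  next
    case False
    then have le: "(v x, v (x + y)) \<in> oleq G \<or> (v y, v (x + y)) \<in> oleq G"
      using kv unfolding krull_valuation_def by blast
    have m: "(\<one>\<^bsub>G\<^esub>, v x) \<in> oleq G" "v x \<noteq> \<one>\<^bsub>G\<^esub>" "(\<one>\<^bsub>G\<^esub>, v y) \<in> oleq G" "v y \<noteq> \<one>\<^bsub>G\<^esub>"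
      using assms(3,4) Valuation False by auto
    have "(\<one>\<^bsub>G\<^esub>, v (x + y)) \<in> oleq G" using le m f(7) by blast
    moreover have "v (x + y) \<noteq> \<one>\<^bsub>G\<^esub>" using le m f(6) by metis
    ultimately show ?thesis using Valuation by simp
  qed
next
  case (Ordering r)
  then have r: "field_ordering r" using assms by simp
  note f = field_ordering_facts [OF r]
  interpret positive_cone "\<lambda>x. (0, x) \<in> r \<and> x \<noteq> 0" by (rule positive_cone_ordering [OF r])
  have "(2, 1) \<in> r" using assms(2) Ordering by simp
  then have "(0, - 1) \<in> r" using f(1) [of 2 1] by simp
  then show ?thesis using asym [of 1] one by simp
next
  case (Absolute a)
  then have a: "absolute_value a" "a 2 \<le> 1" using assms by simp_all
  then show ?thesis using ultrametric [OF a, of x y] assms(3,4) Absolute by simp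
qed

text \<open>Membership of these elements in the maximal ideal is a constructible condition. At a place where \<open>2\<close> is not integral
  it forces \<open>\<bar>y\<bar> < \<bar>1 - \<rho>\<bar> \<le> 1 - \<bar>\<rho> / 2\<bar>\<close>: the second and the third one put \<open>\<rho>\<close> into the sector around the
  positive real half-line where \<open>Re \<rho>\<close> and \<open>Re \<rho>\<^sup>2\<close> are positive.\<close>

definition gap_conditions :: "'a::field \<Rightarrow> 'a \<Rightarrow> 'a set" where
  "gap_conditions y \<rho> = {1 / 2, (1 - \<rho>) / (1 + \<rho>), (1 - \<rho>\<^sup>2) / (1 + \<rho>\<^sup>2), 2 * \<rho>, y / (1 - \<rho>)}"

text \<open>Division by zero yields 0, which lies in every maximal ideal. A vanishing denominator
  would thus satisfy the gap conditions vacuously, and \<open>\<rho> = 0\<close> would give radius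
  0.\<close>

definition nondegenerate :: "'a::field \<Rightarrow> bool" where
  "nondegenerate \<rho> \<longleftrightarrow> (2 :: 'a) \<noteq> 0 \<and> \<rho> \<noteq> 0 \<and> 1 - \<rho> \<noteq> 0 \<and> 1 + \<rho> \<noteq> 0 \<and> 1 + \<rho>\<^sup>2 \<noteq> 0"

context positive_cone
begin

lemma ex_gap:
  assumes "y \<in> unit_interval"
  shows "\<exists>\<rho>. nondegenerate \<rho> \<and> gap_conditions y \<rho> \<subseteq> unit_interval"
proof -
  obtain \<eta> where \<eta>: "\<eta> = y \<or> \<eta> = - y" "\<eta> = 0 \<or> Q \<eta>" using trichotomy [of y] by fastforce
  have \<eta>1: "Q (1 - \<eta>)" using \<eta>(1) assms by (auto simp: unit_interval_def)
  \<comment> \<open>With \<eta> the absolute value of \<open>y\<close>, a quarter of the distance to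
    1 leaves \<eta> = 1 - 4 \<rho>, hence \<eta> < 1 - \<rho> and 2 \<rho> < 1. As the ordering may
    be non-archimedean, a rational \<rho> need not exist.\<close>
  define \<rho> where "\<rho> = (1 - \<eta>) / 4"
  have four: "(4 :: 'a) \<noteq> 0" "(2 :: 'a) \<noteq> 0" using numeral zero by metis+
  have \<rho>: "Q \<rho>" unfolding \<rho>_def by (intro divide \<eta>1 numeral)
  have "4 * \<rho> = 1 - \<eta>" using four by (simp add: \<rho>_def)
  then have \<eta>_eq: "\<eta> = 1 - 4 * \<rho>" by simp
  have add': "Q (\<eta> + s)" if "Q s" for s using \<eta>(2) that add by auto
  have m_eq: "1 - \<rho> = \<eta> + 3 * \<rho>" "1 - 2 * \<rho> = \<eta> + 2 * \<rho>" by (simp_all add: \<eta>_eq)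
  have m: "Q (1 - \<rho>)" "Q (1 - 2 * \<rho>)" unfolding m_eq by (intro add' mult numeral \<rho>)+
  have p: "Q (1 + \<rho>)" "Q (1 + 2 * \<rho>)" "Q (1 + \<rho>\<^sup>2)"
    by (auto intro!: add one mult numeral \<rho> simp: power2_eq_square)
  have nz: "1 - \<rho> \<noteq> 0" using m zero by metis
  have "1 - \<eta> / (1 - \<rho>) = 3 * \<rho> / (1 - \<rho>)" using nz by (simp add: \<eta>_eq field_simps)
  then have "Q (1 - \<eta> / (1 - \<rho>))" by (simp add: divide mult numeral \<rho> m)
  moreover have "Q (1 + \<eta> / (1 - \<rho>))" using \<eta>(2) by (auto intro: add one divide m)
  ultimately have "\<eta> / (1 - \<rho>) \<in> unit_interval" by (simp add: unit_interval_def)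
  then have y: "y / (1 - \<rho>) \<in> unit_interval"
    using \<eta>(1) unit_interval_minus [of "y / (1 - \<rho>)"] by auto
  have half: "1 - 1 / 2 = (1 / 2 :: 'a)" using four by (simp add: field_simps)
  have "1 / 2 \<in> unit_interval"
    unfolding unit_interval_def mem_Collect_eq half by (intro conjI add one divide numeral)
  moreover have "nondegenerate \<rho>"
    unfolding nondegenerate_def using four nz p \<rho> zero by metis
  moreover have "(1 - \<rho>\<^sup>2) / (1 + \<rho>\<^sup>2) \<in> unit_interval"
    by (intro cayley_mem) (simp add: power2_eq_square mult \<rho>)
  ultimately show ?thesis
    using y cayley_mem [OF \<rho>] m p by (auto simp: gap_conditions_def unit_interval_def intro: exI [of _ \<rho>])
qed

text \<open>The conditions amount to \<rho> > 0 and |y| < 1 - \<rho>, so a perturbation by less than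
  \<rho> / 2 keeps the sum away from both endpoints.\<close>

lemma gap:
  assumes "nondegenerate \<rho>" "gap_conditions y \<rho> \<subseteq> unit_interval" "u \<in> unit_interval"
  shows "y + \<rho> / 2 * u \<in> unit_interval"
proof -
  have nz: "1 + \<rho> \<noteq> 0" "1 - \<rho> \<noteq> 0" "(2 :: 'a) \<noteq> 0" using assms(1) by (auto simp: nondegenerate_def)
  have mem: "(1 - \<rho>) / (1 + \<rho>) \<in> unit_interval" "2 * \<rho> \<in> unit_interval" "y / (1 - \<rho>) \<in> unit_interval"
    using assms(2) by (auto simp: gap_conditions_def)
  have \<rho>: "Q \<rho>" using cayley_D [OF mem(1) nz(1)] .
  have "Q (1 - 2 * \<rho> + \<rho>)" using mem(2) \<rho> by (intro add) (auto simp: unit_interval_def)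
  then have m: "Q (1 - \<rho>)" by simp
  have "Q ((1 + y / (1 - \<rho>)) * (1 - \<rho>))" "Q ((1 - y / (1 - \<rho>)) * (1 - \<rho>))"
    using mem(3) m by (auto intro!: mult simp: unit_interval_def)
  moreover have "(1 + y / (1 - \<rho>)) * (1 - \<rho>) = 1 - \<rho> + y" "(1 - y / (1 - \<rho>)) * (1 - \<rho>) = 1 - \<rho> - y"
    using nz(2) by (simp_all add: field_simps)
  ultimately have y: "Q (1 - \<rho> + y)" "Q (1 - \<rho> - y)" by simp_all
  define h where "h = \<rho> / 2"
  have h: "Q h" unfolding h_def by (intro divide \<rho> numeral)
  have \<rho>_eq: "\<rho> = h + h" using nz(3) by (simp add: h_def field_simps)
  have u: "Q (1 + u)" "Q (1 - u)" using assms(3) by (auto simp: unit_interval_def)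
  have "1 + (y + h * u) = (1 - \<rho> + y) + (h + h * (1 + u))" "1 - (y + h * u) = (1 - \<rho> - y) + (h + h * (1 - u))"
    by (simp_all add: \<rho>_eq algebra_simps)
  moreover have "Q ((1 - \<rho> + y) + (h + h * (1 + u)))" "Q ((1 - \<rho> - y) + (h + h * (1 - u)))"
    by (intro add mult y h u)+
  ultimately show ?thesis unfolding unit_interval_def mem_Collect_eq h_def by metis
qed

end

section \<open>Gaps at archimedean absolute values\<close>

lemma archimedean_normalization:
  assumes "absolute_value a" "1 < a 2"
  obtains b where "absolute_value b" "b 2 = 2" "\<And>x. a x < 1 \<longleftrightarrow> b x < 1"
proof
  note A = absolute_valueD [OF assms(1)]
  define \<sigma> where "\<sigma> = log 2 (a 2)"
  have \<sigma>: "0 < \<sigma>" using assms(2) by (simp add: \<sigma>_def)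
  show "absolute_value (\<lambda>x. a x powr (1 / \<sigma>))"
    unfolding \<sigma>_def using assms by (intro absolute_value_powr) auto
  have "a 2 = 2 powr \<sigma>" using assms(2) by (simp add: \<sigma>_def)
  then show "a 2 powr (1 / \<sigma>) = 2" using \<sigma> by (simp add: powr_powr)
  show "a x < 1 \<longleftrightarrow> a x powr (1 / \<sigma>) < 1" for x
    using powr_less_mono2 [of "1 / \<sigma>" "a x" 1] powr_mono2 [of "1 / \<sigma>" 1 "a x"] A(1) [of x] \<sigma>
    by (cases "a x < 1") auto
qed

lemma absolute_value_ex_gap:
  assumes "absolute_value b" "b 2 = 2" "b y < 1"
  shows "\<exists>\<rho>. nondegenerate \<rho> \<and> (\<forall>x \<in> gap_conditions y \<rho>. b x < 1)"
proof -
  note A = absolute_valueD [OF assms(1)]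
  \<comment> \<open>The element 0 is a placeholder; the locale is entered for the values on natural
    numbers.\<close>
  interpret archimedean_absolute_value b 0 by standard (use assms in auto)
  \<comment> \<open>For \<rho> = 1 / k, the bound k > 2 makes 2 \<rho> smaller than 1, and k > 1 /
    (1 - b y) says that \<open>b y\<close> is below 1 - 1 / k.\<close>
  obtain k :: nat where k: "max 2 (1 / (1 - b y)) < real k" using reals_Archimedean2 by blast
  then have k2: "2 < real k" and k1: "1 / (1 - b y) < real k" by auto
  define c :: 'a where "c = of_nat k"
  have c: "b c = real k" by (simp add: c_def of_nat)
  have c0: "c \<noteq> 0" using A(2) [of c] c k2 by auto
  have val: "b (c - 1) = real k - 1" "b (c + 1) = real k + 1" "b (c * c - 1) = real k * real k - 1"
      "b (c * c + 1) = real k * real k + 1"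
  proof -
    have kk: "1 \<le> k" "1 \<le> k * k" using k2 by auto
    have eq: "c - 1 = of_nat (k - 1)" "c + 1 = of_nat (k + 1)" "c * c - 1 = of_nat (k * k - 1)" "c * c + 1 = of_nat (k * k + 1)"
      using kk by (simp_all add: c_def of_nat_diff)
    show "b (c - 1) = real k - 1" "b (c + 1) = real k + 1" "b (c * c - 1) = real k * real k - 1"
        "b (c * c + 1) = real k * real k + 1"
      unfolding eq of_nat using kk by (simp_all add: of_nat_diff)
  qed
  have nz: "c - 1 \<noteq> 0" "c + 1 \<noteq> 0" "c * c + 1 \<noteq> 0" "(2 :: 'a) \<noteq> 0"
    using val A(2) k2 assms(2) by (smt (verit) of_nat_0_le_iff mult_nonneg_nonneg)+
  define \<rho> where "\<rho> = 1 / c"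
  have eqs: "1 - \<rho> = (c - 1) / c" "1 + \<rho> = (c + 1) / c" "1 - \<rho>\<^sup>2 = (c * c - 1) / (c * c)" "1 + \<rho>\<^sup>2 = (c * c + 1) / (c * c)"
    using c0 by (simp_all add: \<rho>_def field_simps power2_eq_square)
  have "nondegenerate \<rho>" unfolding nondegenerate_def eqs using nz c0 by (simp add: \<rho>_def)
  moreover have "b x < 1" if "x \<in> gap_conditions y \<rho>" for x
  proof -
    have "b ((1 - \<rho>) / (1 + \<rho>)) < 1" "b ((1 - \<rho>\<^sup>2) / (1 + \<rho>\<^sup>2)) < 1"
      unfolding eqs using k2 c0 by (simp_all add: A(9) val c A(3) add_pos_pos)
    moreover have "b (2 * \<rho>) < 1" "b (1 / 2) < 1"
      using k2 by (simp_all add: \<rho>_def A(3,5,9) assms(2) c)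
    moreover have "b (y / (1 - \<rho>)) < 1"
    proof -
      have "b y * real k < real k - 1" using k1 assms(3) by (simp add: field_simps)
      then show ?thesis unfolding eqs using k2 by (simp add: A(3,9) val c)
    qed
    ultimately show ?thesis using that unfolding gap_conditions_def by blast
  qed
  ultimately show ?thesis by blast
qed

text \<open>Here \<rho> is an arbitrary element of the field. It is replaced by a complex number
  with the same relevant values, for which the Cayley conditions give positive real parts of z and
  of its square; \<open>cmod_one_minus_le\<close> then improves the triangle inequality for 1 -
  \<rho>.\<close>

lemma absolute_value_gap:
  assumes "absolute_value b" "b 2 = 2" "nondegenerate \<rho>" "\<forall>x \<in> gap_conditions y \<rho>. b x < 1" "b u < 1"
  shows "b (y + \<rho> / 2 * u) < 1"
proof -
  note A = absolute_valueD [OF assms(1)]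
  have nz: "\<rho> \<noteq> 0" "1 - \<rho> \<noteq> 0" "1 + \<rho> \<noteq> 0" "1 + \<rho>\<^sup>2 \<noteq> 0" using assms(3) by (auto simp: nondegenerate_def)
  then have pos: "0 < b \<rho>" "0 < b (1 - \<rho>)" "0 < b (1 + \<rho>)" "0 < b (1 + \<rho>\<^sup>2)"
    using A(1,2) by (metis order_le_less)+
  interpret archimedean_absolute_value b \<rho> by standard (use assms in auto)
  obtain z where z: "b \<rho> = cmod z" "b (1 - \<rho>) = cmod (1 - z)" "b (1 + \<rho>) = cmod (1 + z)"
    "b (1 - \<rho>\<^sup>2) = cmod (1 - z\<^sup>2)" "b (1 + \<rho>\<^sup>2) = cmod (1 + z\<^sup>2)" using ex_complex by blast
  have c: "b (1 - \<rho>) < b (1 + \<rho>)" "b (1 - \<rho>\<^sup>2) < b (1 + \<rho>\<^sup>2)" "b \<rho> < 1 / 2" "b y < b (1 - \<rho>)"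
    using assms(4) pos by (auto simp: gap_conditions_def A(3,9) assms(2))
  then have "b (1 - \<rho>) \<le> 1 - b \<rho> / 2" unfolding z by (intro cmod_one_minus_le)
  moreover have "b (\<rho> / 2 * u) < b \<rho> / 2"
    using mult_strict_left_mono [OF assms(5), of "b \<rho> / 2"] pos(1) by (simp add: A(3,9) assms(2))
  ultimately show ?thesis using A(4) [of y "\<rho> / 2 * u"] c(4) by linarith
qed

lemma krull_valuation_two: "krull_valuation G v \<Longrightarrow> 2 \<in> rep_O (Valuation G v)"
proof -
  assume kv: "krull_valuation G v"
  note f = krull_valuation_facts [OF kv]
  have "(v 1, v (1 + 1)) \<in> oleq G \<or> (v 1, v (1 + 1)) \<in> oleq G" if "(1 :: 'a) + 1 \<noteq> 0"
    using kv that unfolding krull_valuation_def by (metis one_neq_zero)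
  then show ?thesis using f(4) by (auto simp: one_add_one)
qed

lemma rep_ex_gap:
  assumes "valid_representative p" "2 \<notin> rep_O p" "y \<in> rep_m p"
  shows "\<exists>\<rho>. nondegenerate \<rho> \<and> gap_conditions y \<rho> \<subseteq> rep_m p"
proof (cases p)
  case (Valuation G v)
  then show ?thesis using assms krull_valuation_two [of G v] by simp
next
  case (Ordering r)
  then have r: "field_ordering r" using assms by simp
  note pc = positive_cone_ordering [OF r]
  show ?thesis using positive_cone.ex_gap [OF pc(1), of y] assms(3) unfolding Ordering pc(2) by blast
next
  case (Absolute a)
  then have a: "absolute_value a" "1 < a 2" "a y < 1" using assms by auto
  from a(1,2) obtain b where b: "absolute_value b" "b 2 = 2" "\<And>x. a x < 1 \<longleftrightarrow> b x < 1"
    by (rule archimedean_normalization) blast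
  then show ?thesis using absolute_value_ex_gap [OF b(1,2), of y] a(3) Absolute by auto
qed

text \<open>The membership of \<open>1 / 2\<close> says that 2 is not integral, which leaves only
  orderings and absolute values with value above 1 at 2.\<close>

lemma rep_gap:
  assumes "valid_representative p" "nondegenerate \<rho>" "gap_conditions y \<rho> \<subseteq> rep_m p" "u \<in> rep_m p"
  shows "y + \<rho> / 2 * u \<in> rep_m p"
proof -
  have half: "1 / 2 \<in> rep_m p" and two: "(2 :: 'a) \<noteq> 0"
    using assms(2,3) by (auto simp: gap_conditions_def nondegenerate_def)
  have n2: "2 \<notin> rep_O p"
    using rep_m_iff [OF assms(1), of "1 / 2"] half two by simp
  show ?thesis
  proof (cases p)
    case (Valuation G v)
    then show ?thesis using assms(1) n2 krull_valuation_two [of G v] by simp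
  next
    case (Ordering r)
    then have r: "field_ordering r" using assms by simp
    note pc = positive_cone_ordering [OF r]
    show ?thesis using positive_cone.gap [OF pc(1) assms(2)] assms(3,4) unfolding Ordering pc(2) by blast
  next
    case (Absolute a)
    then have a: "absolute_value a" "1 < a 2" using assms n2 by auto
    from a obtain b where b: "absolute_value b" "b 2 = 2" "\<And>x. a x < 1 \<longleftrightarrow> b x < 1"
      by (rule archimedean_normalization) blast
    then show ?thesis using absolute_value_gap [OF b(1,2) assms(2), of y u] assms(3,4) Absolute by auto
  qed
qed

section \<open>The topology and the constructible topology of localities\<close>

lemma rep_m_subset_O: "rep_m p \<subseteq> rep_O p"
  by (cases p) auto

lemma rep_O_mult:
  assumes "valid_representative p" "x \<in> rep_O p" "y \<in> rep_O p"
  shows "x * y \<in> rep_O p"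
proof (rule ccontr)
  assume n: "x * y \<notin> rep_O p"
  then have nz: "x \<noteq> 0" "y \<noteq> 0" using rep_basic(3) [OF assms(1)] rep_m_subset_O [of p] by auto
  then have "inverse (x * y) \<in> rep_m p" using rep_m_iff [OF assms(1), of "inverse (x * y)"] n by simp
  from rep_O_m [OF assms(1,3) rep_O_m [OF assms(1,2) this]] show False
    using nz rep_basic(4) [OF assms(1)] by (simp add: field_simps)
qed

lemma locality_facts:
  assumes "v \<in> localities"
  shows "1 \<in> loc_O v" "- 1 \<in> loc_O v" "0 \<in> loc_m v" "1 \<notin> loc_m v" "loc_m v \<subseteq> loc_O v"
    "x \<in> loc_O v \<Longrightarrow> y \<in> loc_O v \<Longrightarrow> x * y \<in> loc_O v"
    "x \<in> loc_O v \<Longrightarrow> y \<in> loc_m v \<Longrightarrow> x * y \<in> loc_m v"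
    "x \<noteq> 0 \<Longrightarrow> x \<in> loc_m v \<longleftrightarrow> inverse x \<notin> loc_O v"
    "x \<noteq> 0 \<Longrightarrow> x \<in> loc_O v \<or> inverse x \<in> loc_O v"
proof -
  obtain p where p: "valid_representative p" "loc_O v = rep_O p" "loc_m v = rep_m p"
    using localities_cases [OF assms] by metis
  show "1 \<in> loc_O v" "- 1 \<in> loc_O v" "0 \<in> loc_m v" "1 \<notin> loc_m v" "loc_m v \<subseteq> loc_O v"
    "x \<in> loc_O v \<Longrightarrow> y \<in> loc_O v \<Longrightarrow> x * y \<in> loc_O v"
    "x \<in> loc_O v \<Longrightarrow> y \<in> loc_m v \<Longrightarrow> x * y \<in> loc_m v"
    "x \<noteq> 0 \<Longrightarrow> x \<in> loc_m v \<longleftrightarrow> inverse x \<notin> loc_O v"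
    "x \<noteq> 0 \<Longrightarrow> x \<in> loc_O v \<or> inverse x \<in> loc_O v"
    unfolding p(2,3)
    using rep_basic [OF p(1)] rep_m_subset_O rep_O_mult [OF p(1)] rep_O_m [OF p(1)] rep_m_iff [OF p(1)]
      rep_O_or_inverse [OF p(1)] by simp_all
qed

text \<open>Zero is treated separately because \<open>x / 0 = 0\<close> is integral, so the quotient
  alone would place every element below 0.\<close>

definition loc_le :: "'a::field locality \<Rightarrow> 'a \<Rightarrow> 'a \<Rightarrow> bool" where
  "loc_le v x y \<longleftrightarrow> x = 0 \<or> (y \<noteq> 0 \<and> x / y \<in> loc_O v)"

abbreviation loc_less :: "'a::field locality \<Rightarrow> 'a \<Rightarrow> 'a \<Rightarrow> bool" where
  "loc_less v x y \<equiv> \<not> loc_le v y x"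

lemma loc_less_iff:
  assumes "v \<in> localities" "y \<noteq> 0"
  shows "loc_less v x y \<longleftrightarrow> x / y \<in> loc_m v"
  using locality_facts(3) [OF assms(1)] locality_facts(8) [OF assms(1), of "x / y"] assms(2)
  by (cases "x = 0") (auto simp: loc_le_def)

lemma loc_le_one: "v \<in> localities \<Longrightarrow> loc_le v x 1 \<longleftrightarrow> x \<in> loc_O v"
  using locality_facts(3,5) by (fastforce simp: loc_le_def)

lemma quasi_valuation_loc_le:
  assumes v: "v \<in> localities" and "t \<noteq> 0"
    and t: "\<And>x y. x \<in> loc_O v \<Longrightarrow> y \<in> loc_O v \<Longrightarrow> t * (x + y) \<in> loc_O v"
  shows "quasi_valuation (loc_le v) t"
proof
  note L = locality_facts [OF v]
  have O0: "0 \<in> loc_O v" using L(3,5) by blast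
  fix x y z :: 'a
  show "loc_le v x y \<or> loc_le v y x"
    using L(9) [of "x / y"] by (cases "x = 0 \<or> y = 0") (auto simp: loc_le_def)
  show "loc_le v x z" if "loc_le v x y" "loc_le v y z"
    using that L(6) [of "x / y" "y / z"] by (auto simp: loc_le_def)
  show "loc_le v (x * z) (y * z)" if "loc_le v x y"
    using that by (cases "z = 0") (auto simp: loc_le_def)
  show "x = 0" if "loc_le v x 0" using that by (auto simp: loc_le_def)
  show "loc_le v (- x) x" using L(2) by (auto simp: loc_le_def)
  show "t \<noteq> 0" by fact
  show "loc_le v (t * (x + y)) z" if "loc_le v x z" "loc_le v y z"
  proof (cases "z = 0")
    case False
    have "x / z \<in> loc_O v" "y / z \<in> loc_O v" using that False O0 by (auto simp: loc_le_def)
    moreover have "t * (x / z + y / z) = t * (x + y) / z"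
      by (simp add: add_divide_distrib distrib_left)
    ultimately have "t * (x + y) / z \<in> loc_O v" using t by metis
    then show ?thesis using False by (simp add: loc_le_def)
  qed (use that in \<open>auto simp: loc_le_def\<close>)
qed

lemma same_locality_eqI:
  assumes "valid_representative p" "valid_representative q" "equivclp linked p q"
  shows "same_locality `` {p} = same_locality `` {q}"
  using assms unfolding same_locality_def by (auto intro: equivclp_trans equivclp_sym)

text \<open>If the maximal ideal is zero, every nonzero element lies in \<open>loc_O\<close> but not
  in \<open>loc_m\<close>. A valuation then has a one-element value group and is linked to the
  trivial absolute value by the zero map; an absolute value is itself trivial; an ordering is
  impossible, as \<open>1 / 2\<close> lies in its maximal ideal.\<close>

lemma locality_nontrivial:
  assumes "v \<in> localities" "v \<noteq> trivial_locality"
  shows "\<exists>x. x \<noteq> 0 \<and> x \<in> loc_m v"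
proof (rule ccontr)
  assume n: "\<not> ?thesis"
  obtain p where p: "valid_representative p" "v = same_locality `` {p}" "loc_O v = rep_O p" "loc_m v = rep_m p"
    using localities_cases [OF assms(1)] by metis
  have O: "x \<in> rep_O p" "x \<notin> rep_m p" if "x \<noteq> 0" for x
  proof -
    have nm: "u \<notin> rep_m p" if "u \<noteq> 0" for u using n that p(4) by blast
    show "x \<in> rep_O p" using rep_m_iff [OF p(1), of "inverse x"] nm [of "inverse x"] that by simp
    show "x \<notin> rep_m p" by (rule nm [OF that])
  qed
  define T :: "'a \<Rightarrow> real" where "T = (\<lambda>x. if x = 0 then 0 else 1)"
  have T: "absolute_value T" by (auto simp: absolute_value_def T_def)
  have "same_locality `` {p} = same_locality `` {Absolute T}"
  proof (cases p)
    case (Valuation G w)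
    then have kv: "krull_valuation G w" using p(1) by simp
    note f = krull_valuation_facts [OF kv]
    have w1: "w x = \<one>\<^bsub>G\<^esub>" if "x \<noteq> 0" for x using O [OF that] Valuation that by auto
    have "carrier G = w ` (- {0})" using kv by (simp add: krull_valuation_def)
    then have G1: "b = \<one>\<^bsub>G\<^esub>" if "b \<in> carrier G" for b using that w1 by auto
    have "(\<one>\<^bsub>G\<^esub>, \<one>\<^bsub>G\<^esub>) \<in> oleq G" using f(2) [of 1] f(4) f(5) [of "\<one>\<^bsub>G\<^esub>" "\<one>\<^bsub>G\<^esub>"] by simp
    then have "linked p (Absolute T)"
      unfolding Valuation using kv T G1
      by (intro linked.rank_one [where \<phi> = "\<lambda>_. 0"]) (auto simp: T_def)
    then show ?thesis using p(1) T by (intro same_locality_eqI) auto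
  next
    case (Ordering r)
    then have r: "field_ordering r" using p(1) by simp
    note pc = positive_cone_ordering [OF r]
    have "0 \<in> rep_m p" using rep_basic(3) [OF p(1)] .
    then obtain \<rho> where "nondegenerate \<rho>" "gap_conditions 0 \<rho> \<subseteq> rep_m p"
      using positive_cone.ex_gap [OF pc(1), of 0] unfolding Ordering pc(2) by blast
    then have "1 / 2 \<in> rep_m p" "(1 / 2 :: 'a) \<noteq> 0" by (auto simp: nondegenerate_def gap_conditions_def)
    then show ?thesis using O(2) by blast
  next
    case (Absolute a)
    then have "absolute_value a" using p(1) by simp
    note A = absolute_valueD [OF this]
    have "a x = 1" if "x \<noteq> 0" for x using O [OF that] Absolute by simp
    then have "a = T" using A(2) [of 0] by (auto simp: T_def)
    then show ?thesis using Absolute by simp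
  qed
  then show False using assms(2) p(2) by (simp add: trivial_locality_def T_def)
qed

text \<open>Without such an element, multiplication by \<open>a\<close> maps \<open>loc_m w\<close>
  into \<open>loc_m v\<close> and, by passing to inverses, also \<open>loc_m v\<close> into
  \<open>loc_m w\<close>. Every ball of one place then contains a concentric ball of the other, and
  the topologies agree.\<close>

lemma independent_localities_ex:
  assumes v: "v \<in> localities" and w: "w \<in> localities" and ind: "independent_localities v w" and "a \<noteq> 0"
  shows "\<exists>x. x \<noteq> 0 \<and> loc_le w x a \<and> loc_le v 1 x"
proof (rule ccontr)
  assume n: "\<not> ?thesis"
  note V = locality_facts [OF v] and W = locality_facts [OF w]
  have H: "x \<in> loc_m v" if "x \<noteq> 0" "loc_le w x a" for x
    using n that loc_less_iff [OF v, of 1 x] by auto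
  have 1: "a * u \<in> loc_m v" if "u \<in> loc_m w" for u
  proof (cases "u = 0")
    case False
    then show ?thesis using that W(5) \<open>a \<noteq> 0\<close> by (intro H) (auto simp: loc_le_def)
  qed (use V in simp)
  have 2: "a * u \<in> loc_m w" if u: "u \<in> loc_m v" for u
  proof (rule ccontr)
    assume au: "a * u \<notin> loc_m w"
    then have "u \<noteq> 0" using W(3) by auto
    then have "inverse (a * u) \<in> loc_O w" using au W(8) [of "a * u"] \<open>a \<noteq> 0\<close> by simp
    then have "loc_le w (inverse u) a" using \<open>a \<noteq> 0\<close> by (simp add: loc_le_def divide_inverse mult.commute)
    then have "inverse u \<in> loc_m v" using H \<open>u \<noteq> 0\<close> by simp
    then have "inverse u * u \<in> loc_m v" using V(5,7) u by blast
    then show False using \<open>u \<noteq> 0\<close> V(4) by simp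
  qed
  have sub: "loc_ball v' y (z * a) \<subseteq> loc_ball w' y z"
    if "\<And>u. u \<in> loc_m v' \<Longrightarrow> a * u \<in> loc_m w'" for v' w' :: "'a locality" and y z
    using that by (force simp: loc_ball_def elt_set_plus_def elt_set_times_def mult.assoc)
  have "openin (loc_topology v) U \<longleftrightarrow> openin (loc_topology w) U" for U
    unfolding openin_loc_topology [OF v] openin_loc_topology [OF w]
    using sub [of w v] sub [of v w] 1 2 \<open>a \<noteq> 0\<close> by (meson mult_eq_0_iff order_trans)
  then have "loc_topology v = loc_topology w" by (simp add: topology_eq)
  with ind show False by (simp add: independent_localities_def)
qed

section \<open>Clopen sets of localities\<close>

definition clopen :: "'a::field locality set \<Rightarrow> bool" where
  "clopen N \<longleftrightarrow> openin constructible_topology N \<and> closedin constructible_topology N"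

lemma topspace_constructible: "topspace (constructible_topology :: 'a::field locality topology) = localities"
proof -
  have "localities = {v \<in> localities. (1 :: 'a) \<in> loc_O v}" using locality_facts(1) by blast
  then show ?thesis unfolding constructible_topology_def topology_generated_by_topspace by blast
qed

lemma openin_constructible:
  "openin constructible_topology {v \<in> localities. x \<in> loc_O v}"
  "openin constructible_topology {v \<in> localities. x \<in> loc_m v}"
  unfolding constructible_topology_def by (rule topology_generated_by_Basis; blast)+

text \<open>For nonzero \<open>x\<close>, failing to be integral means that the inverse lies in the
  maximal ideal, so the complement of a subbasic set is again subbasic.\<close>

lemma clopen_O: "clopen {v \<in> localities. x \<in> loc_O v}"
proof (cases "x = 0")
  case True
  then have "{v \<in> localities. x \<in> loc_O v} = localities" using locality_facts(3,5) by blast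
  then show ?thesis unfolding clopen_def by (metis closedin_topspace openin_topspace topspace_constructible)
next
  case False
  have "topspace constructible_topology - {v \<in> localities. x \<in> loc_O v} = {v \<in> localities. inverse x \<in> loc_m v}"
    unfolding topspace_constructible using locality_facts(8) [of _ "inverse x"] False by auto
  then show ?thesis
    unfolding clopen_def closedin_def using openin_constructible topspace_constructible by auto
qed

lemma clopen_m: "clopen {v \<in> localities. x \<in> loc_m v}"
proof (cases "x = 0")
  case True
  then have "{v \<in> localities. x \<in> loc_m v} = localities" using locality_facts(3) by blast
  then show ?thesis unfolding clopen_def by (metis closedin_topspace openin_topspace topspace_constructible)
next
  case False
  have "topspace constructible_topology - {v \<in> localities. x \<in> loc_m v} = {v \<in> localities. inverse x \<in> loc_O v}"
    unfolding topspace_constructible using locality_facts(8) [of _ x] False by auto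
  then show ?thesis
    unfolding clopen_def closedin_def using openin_constructible topspace_constructible by auto
qed

lemma clopen_Int: "clopen M \<Longrightarrow> clopen N \<Longrightarrow> clopen (M \<inter> N)"
  unfolding clopen_def by blast

lemma clopen_localities: "clopen localities"
  unfolding clopen_def by (metis closedin_topspace openin_topspace topspace_constructible)

lemma clopen_Diff: "clopen N \<Longrightarrow> clopen (localities - N)"
  unfolding clopen_def by (metis closedin_topspace openin_topspace topspace_constructible openin_diff closedin_diff)

lemma clopen_finite:
  assumes "finite A"
  shows "clopen {v \<in> localities. A \<subseteq> loc_m v}"
  using assms
proof (induction A)
  case (insert x A)
  have "{v \<in> localities. insert x A \<subseteq> loc_m v} = {v \<in> localities. x \<in> loc_m v} \<inter> {v \<in> localities. A \<subseteq> loc_m v}"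
    by blast
  then show ?case by (simp only: clopen_Int clopen_m insert.IH)
qed (simp add: clopen_localities)

text \<open>Where 2 is integral, the maximal ideal is closed under addition and radius 1 works
  wherever 2 remains integral and \<open>y\<close> remains in the ideal. Elsewhere a witness chosen
  at \<open>v\<close> carries its gap conditions to a clopen neighbourhood, and there
  \<open>rep_gap\<close> applies.\<close>

lemma loc_m_uniformly_open:
  assumes v: "v \<in> localities" and y: "y \<in> loc_m v"
  shows "\<exists>\<rho> N. \<rho> \<noteq> 0 \<and> clopen N \<and> v \<in> N \<and> (\<forall>w\<in>N. \<forall>u\<in>loc_m w. y + \<rho> * u \<in> loc_m w)"
proof -
  have rep: "\<exists>p. valid_representative p \<and> loc_O w = rep_O p \<and> loc_m w = rep_m p"
    if "w \<in> localities" for w :: "'a locality"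
    using localities_cases [OF that] by metis
  show ?thesis
  proof (cases "2 \<in> loc_O v")
    case True
    show ?thesis
    proof (intro exI [of _ 1] exI [of _ "{w \<in> localities. 2 \<in> loc_O w} \<inter> {w \<in> localities. y \<in> loc_m w}"] conjI ballI)
      fix w u assume w: "w \<in> {w \<in> localities. 2 \<in> loc_O w} \<inter> {w \<in> localities. y \<in> loc_m w}" and u: "u \<in> loc_m w"
      then obtain p where p: "valid_representative p" "loc_O w = rep_O p" "loc_m w = rep_m p" using rep by blast
      then have "y + u \<in> rep_m p" using w u by (intro rep_m_add) auto
      then show "y + 1 * u \<in> loc_m w" using p by simp
    qed (use v y True in \<open>auto intro: clopen_Int clopen_O clopen_m\<close>)
  next
    case False
    obtain p where p: "valid_representative p" "loc_O v = rep_O p" "loc_m v = rep_m p" using rep [OF v] by blast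
    then obtain \<rho> where \<rho>: "nondegenerate \<rho>" "gap_conditions y \<rho> \<subseteq> loc_m v"
      using rep_ex_gap [OF p(1), of y] False y unfolding p(2,3) by blast
    show ?thesis
    proof (intro exI [of _ "\<rho> / 2"] exI [of _ "{w \<in> localities. gap_conditions y \<rho> \<subseteq> loc_m w}"] conjI ballI)
      show "clopen {w \<in> localities. gap_conditions y \<rho> \<subseteq> loc_m w}"
        by (rule clopen_finite) (simp add: gap_conditions_def)
      fix w u assume w: "w \<in> {w \<in> localities. gap_conditions y \<rho> \<subseteq> loc_m w}" and u: "u \<in> loc_m w"
      then obtain q where q: "valid_representative q" "loc_m w = rep_m q" using rep by blast
      then show "y + \<rho> / 2 * u \<in> loc_m w" using rep_gap [OF q(1) \<rho>(1)] w u by simp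
    qed (use \<rho> v in \<open>auto simp: nondegenerate_def\<close>)
  qed
qed

section \<open>Continuity of rational functions, uniformly in the place\<close>

locale locality_family = place_family loc_le S t
  for S :: "'a::field locality set" and t :: 'a +
  assumes S_localities: "S \<subseteq> localities"
begin

text \<open>Neighbourhoods of the pair of \<open>v\<close> and \<open>a\<close>, with the place and
  the point moving together. The radius is a fixed element of the field, measured at the moving
  place \<open>w\<close>.\<close>

definition near :: "'a locality \<Rightarrow> nat set \<Rightarrow> (nat \<Rightarrow> 'a) \<Rightarrow> ('a locality \<times> (nat \<Rightarrow> 'a)) filter" where
  "near v C a = (INF (N, r)\<in>{(N, r). clopen N \<and> v \<in> N \<and> r \<noteq> 0}.
     principal {(w, x). w \<in> N \<inter> S \<and> (\<forall>c\<in>C. loc_less w (x c - a c) r)})"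

lemma eventually_near:
  assumes "v \<in> S"
  shows "eventually P (near v C a) \<longleftrightarrow> (\<exists>N r. clopen N \<and> v \<in> N \<and> r \<noteq> 0 \<and>
    (\<forall>w\<in>N \<inter> S. \<forall>x. (\<forall>c\<in>C. loc_less w (x c - a c) r) \<longrightarrow> P (w, x)))"
proof -
  define B where "B = {(N, r :: 'a). clopen N \<and> v \<in> N \<and> r \<noteq> 0}"
  define F where "F = (\<lambda>(N, r). principal {(w, x). w \<in> N \<inter> S \<and> (\<forall>c\<in>C. loc_less w (x c - a c) r)})"
  have vL: "v \<in> localities" using assms S_localities by blast
  interpret V: quasi_valuation "loc_le v" t by (rule quasi_valuation [OF assms])
  have "\<exists>b\<in>B. F b \<le> inf (F b1) (F b2)" if b: "b1 \<in> B" "b2 \<in> B" for b1 b2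
  proof -
    obtain N1 r1 N2 r2 where [simp]: "b1 = (N1, r1)" "b2 = (N2, r2)" by (cases b1, cases b2)
    have B1: "clopen N1" "v \<in> N1" "r1 \<noteq> 0" and B2: "clopen N2" "v \<in> N2" "r2 \<noteq> 0"
      using b by (auto simp: B_def)
    obtain r where r: "r \<in> {r1, r2}" "loc_le v r r1" "loc_le v r r2" by (metis insertCI V.total V.refl)
    then have r0: "r \<noteq> 0" using B1 B2 by auto
    \<comment> \<open>The smaller radius is selected at \<open>v\<close>. Since the comparison may
      turn out otherwise at another place, the neighbourhood is cut down to the clopen set where it
      persists.\<close>
    define N where "N = (N1 \<inter> N2) \<inter> ({w \<in> localities. r / r1 \<in> loc_O w} \<inter> {w \<in> localities. r / r2 \<in> loc_O w})"
    have "clopen N" unfolding N_def by (intro clopen_Int clopen_O B1 B2)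
    moreover have "v \<in> N" using B1 B2 vL r r0 by (auto simp: N_def loc_le_def)
    ultimately have "(N, r) \<in> B" using r0 by (simp add: B_def)
    moreover have "loc_less w u r1 \<and> loc_less w u r2" if w: "w \<in> N" "w \<in> S" and u: "loc_less w u r" for w u
    proof -
      interpret W: quasi_valuation "loc_le w" t by (rule quasi_valuation [OF w(2)])
      have "loc_le w r r1" "loc_le w r r2" using w B1 B2 by (auto simp: N_def loc_le_def)
      then show ?thesis using u W.less_le_trans by blast
    qed
    then have "F (N, r) \<le> inf (F b1) (F b2)" by (auto simp: F_def N_def)
    ultimately show ?thesis by blast
  qed
  moreover have "B \<noteq> {}"
  proof -
    have "(localities, 1) \<in> B" using vL clopen_localities by (simp add: B_def)
    then show ?thesis by blast
  qed
  ultimately have "eventually P (INF b\<in>B. F b) \<longleftrightarrow> (\<exists>b\<in>B. eventually P (F b))"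
    by (intro eventually_INF_base)
  moreover have "near v C a = (INF b\<in>B. F b)" by (simp add: near_def B_def F_def)
  moreover have "eventually P (F (N, r)) \<longleftrightarrow>
      (\<forall>w\<in>N \<inter> S. \<forall>x. (\<forall>c\<in>C. loc_less w (x c - a c) r) \<longrightarrow> P (w, x))" for N r
    by (auto simp: F_def eventually_principal)
  moreover have "(\<exists>b\<in>B. Q b) \<longleftrightarrow> (\<exists>N r. clopen N \<and> v \<in> N \<and> r \<noteq> 0 \<and> Q (N, r))" for Q
    by (auto simp: B_def)
  ultimately show ?thesis by (simp only:)
qed

lemma eventually_near_clopen:
  assumes "v \<in> S" "clopen N" "v \<in> N"
  shows "\<forall>\<^sub>F (w, x) in near v C a. w \<in> N \<and> w \<in> S"
  unfolding eventually_near [OF assms(1)] using assms(2,3) by (intro exI [of _ N] exI [of _ 1]) auto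

lemma tends_near_const: "v \<in> S \<Longrightarrow> tends (near v C a) (\<lambda>x. c) c"
  using eventually_near_clopen [OF _ clopen_localities, of v C a] S_localities
  by (intro tends_const) (fastforce elim: eventually_mono)

lemma tends_near_coordinate:
  assumes "v \<in> S" "c \<in> C"
  shows "tends (near v C a) (\<lambda>x. x c) (a c)"
  unfolding tends_def eventually_near [OF assms(1)]
  using assms S_localities clopen_localities by (intro allI impI exI [of _ localities]) auto

lemma tends_near_sum:
  assumes "v \<in> S" "\<And>i. i \<in> I \<Longrightarrow> tends (near v C a) (\<phi> i) (c i)"
  shows "tends (near v C a) (\<lambda>x. \<Sum>i\<in>I. \<phi> i x) (\<Sum>i\<in>I. c i)"
  using assms(2)
  by (induction I rule: infinite_finite_induct) (simp_all add: tends_near_const [OF assms(1)] tends_add)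

lemma tends_near_prod:
  assumes "v \<in> S" "\<And>i. i \<in> I \<Longrightarrow> tends (near v C a) (\<phi> i) (c i)"
  shows "tends (near v C a) (\<lambda>x. \<Prod>i\<in>I. \<phi> i x) (\<Prod>i\<in>I. c i)"
  using assms(2)
  by (induction I rule: infinite_finite_induct) (simp_all add: tends_near_const [OF assms(1)] tends_mult)

lemma tends_near_power:
  assumes "v \<in> S" "tends (near v C a) \<phi> c"
  shows "tends (near v C a) (\<lambda>x. \<phi> x ^ n) (c ^ n)"
  by (induction n) (simp_all add: tends_near_const [OF assms(1)] tends_mult assms(2))

lemma tends_near_mpoly:
  assumes "v \<in> S" "p \<in> mpolys l"
  shows "tends (near v {1..l} a) (mpoly_eval p) (mpoly_eval p a)"
  unfolding mpoly_eval_def [abs_def]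
proof (intro tends_near_sum tends_mult tends_near_const tends_near_prod tends_near_power tends_near_coordinate)
  fix M i assume "M \<in> Poly_Mapping.keys p" "i \<in> Poly_Mapping.keys M"
  then show "i \<in> {1..l}" using assms(2) unfolding mpolys_def by blast
qed (rule assms(1))+

lemma uniform_neighbourhood:
  assumes v: "v \<in> S" and J: "finite J"
    and hk: "\<And>j. j \<in> J \<Longrightarrow> h j \<in> mpolys l \<and> k j \<in> mpolys l \<and> mpoly_eval (k j) a \<noteq> 0"
    and z: "\<And>j. j \<in> J \<Longrightarrow> z j \<noteq> 0"
    and ball: "\<And>j. j \<in> J \<Longrightarrow> mpoly_eval (h j) a / mpoly_eval (k j) a \<in> loc_ball v (y j) (z j)"
  shows "\<exists>N r. clopen N \<and> v \<in> N \<and> r \<noteq> 0 \<and>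
    (\<forall>w\<in>N \<inter> S. \<forall>x. (\<forall>c\<in>{1..l}. loc_less w (x c - a c) r) \<longrightarrow>
      (\<forall>j\<in>J. mpoly_eval (k j) x \<noteq> 0 \<and> mpoly_eval (h j) x / mpoly_eval (k j) x \<in> loc_ball w (y j) (z j)))"
proof -
  have mem: "x \<in> loc_ball w b s \<longleftrightarrow> (x - b) / s \<in> loc_m w" if "s \<noteq> 0" for w :: "'a locality" and x b s
    using that by (force simp: loc_ball_def elt_set_plus_def elt_set_times_def)
  have vL: "v \<in> localities" using v S_localities by blast
  have "\<forall>\<^sub>F (w, x) in near v {1..l} a. mpoly_eval (k j) x \<noteq> 0 \<and>
      mpoly_eval (h j) x / mpoly_eval (k j) x \<in> loc_ball w (y j) (z j)" if j: "j \<in> J" for j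
  proof -
    define \<phi> where "\<phi> = (\<lambda>x. mpoly_eval (h j) x * inverse (mpoly_eval (k j) x))"
    have k: "tends (near v {1..l} a) (mpoly_eval (k j)) (mpoly_eval (k j) a)"
      using tends_near_mpoly v hk j by blast
    have \<phi>: "tends (near v {1..l} a) \<phi> (\<phi> a)"
      unfolding \<phi>_def using hk [OF j] by (intro tends_mult tends_near_mpoly v tends_inverse(2) k) auto
    have zj: "z j \<noteq> 0" by (rule z [OF j])
    have "(\<phi> a - y j) / z j \<in> loc_m v" using ball [OF j] mem [OF zj] by (simp add: \<phi>_def divide_inverse)
    from loc_m_uniformly_open [OF vL this] obtain \<rho> N where \<rho>: "\<rho> \<noteq> 0" and N: "clopen N" "v \<in> N"
      "\<And>w u. w \<in> N \<Longrightarrow> u \<in> loc_m w \<Longrightarrow> (\<phi> a - y j) / z j + \<rho> * u \<in> loc_m w" by blast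
    \<comment> \<open>Closeness of \<phi> to its value at \<open>a\<close> within this radius
      becomes, after division by \<open>z j\<close>, a perturbation by \<rho> times an element of
      the maximal ideal, as uniform openness demands.\<close>
    have "z j * \<rho> \<noteq> 0" using zj \<rho> by simp
    from tendsD [OF \<phi> this] tends_inverse(1) [OF k conjunct2 [OF conjunct2 [OF hk [OF j]]]] eventually_near_clopen [OF v N(1,2), of "{1..l}" a]
    show ?thesis
    proof (eventually_elim)
      case (elim wx)
      obtain w x where [simp]: "wx = (w, x)" by (cases wx)
      have w: "w \<in> N" "w \<in> localities" using elim S_localities by auto
      have "(\<phi> x - \<phi> a) / (z j * \<rho>) \<in> loc_m w"
        using elim loc_less_iff [OF w(2) \<open>z j * \<rho> \<noteq> 0\<close>] by simp
      from N(3) [OF w(1) this] have "(\<phi> a - y j) / z j + \<rho> * ((\<phi> x - \<phi> a) / (z j * \<rho>)) \<in> loc_m w" .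
      moreover have "(\<phi> a - y j) / z j + \<rho> * ((\<phi> x - \<phi> a) / (z j * \<rho>)) = (\<phi> x - y j) / z j"
        using \<rho> zj by (simp add: field_simps)
      ultimately have "(\<phi> x - y j) / z j \<in> loc_m w" by simp
      then show ?case using elim mem [OF zj] hk [OF j] by (simp add: \<phi>_def divide_inverse)
    qed
  qed
  then have "\<forall>\<^sub>F wx in near v {1..l} a. \<forall>j\<in>J. case wx of (w, x) \<Rightarrow> mpoly_eval (k j) x \<noteq> 0 \<and>
      mpoly_eval (h j) x / mpoly_eval (k j) x \<in> loc_ball w (y j) (z j)"
    using J by (intro eventually_ball_finite) auto
  then show ?thesis unfolding eventually_near [OF v] by simp
qed

text \<open>The covers in \<open>qcompact\<close> are by subbasic open sets, those on which
  \<open>c v\<close> lies in the maximal ideal.\<close>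

lemma qcompact_compactin:
  assumes "compactin constructible_topology X" "X \<subseteq> S"
  shows "qcompact X"
  unfolding qcompact_def
proof (intro allI impI)
  fix c :: "'a locality \<Rightarrow> 'a" assume c: "\<forall>v\<in>X. loc_less v (c v) 1"
  define N where "N = (\<lambda>v. {w \<in> localities. c v \<in> loc_m w})"
  have XL: "X \<subseteq> localities" using assms(2) S_localities by blast
  have less: "loc_less w (c v) 1 \<longleftrightarrow> w \<in> N v" if "w \<in> X" for v w
    using loc_less_iff [of w 1 "c v"] that XL by (auto simp: N_def)
  have "\<And>U. U \<in> N ` X \<Longrightarrow> openin constructible_topology U" unfolding N_def using openin_constructible(2) by blast
  moreover have "X \<subseteq> \<Union>(N ` X)" using c less by blast
  ultimately obtain \<F> where \<F>: "finite \<F>" "\<F> \<subseteq> N ` X" "X \<subseteq> \<Union>\<F>" using compactinD [OF assms(1)] by metis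
  obtain V where V: "V \<subseteq> X" "finite V" "\<F> = N ` V" using finite_subset_image [OF \<F>(1,2)] by blast
  then have "\<exists>v\<in>V. loc_less w (c v) 1" if "w \<in> X" for w using that \<F>(3) less [OF that] by blast
  with V(1,2) show "\<exists>V. finite V \<and> V \<subseteq> X \<and> (\<forall>w\<in>X. \<exists>v\<in>V. loc_less w (c v) 1)" by blast
qed

end

section \<open>Clopen pieces and approximation in each coordinate\<close>

theorem corollary7p9:
  fixes n m l :: nat
    and S :: "nat \<Rightarrow> 'a::field locality set"
    and t :: 'a
    and y z :: "nat \<Rightarrow> nat \<Rightarrow> 'a"
    and g :: "nat \<Rightarrow> 'a ratfun"
  assumes "1 \<le> n"
    and "\<And>i. i \<in> {1..n} \<Longrightarrow> S i \<noteq> {} \<and> S i \<subseteq> localities - {trivial_locality}"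
    and "disjoint_family_on S {1..n}"
    and "t \<noteq> 0"
    and "\<And>i j. i \<in> {1..n} \<Longrightarrow> j \<in> {1..m} \<Longrightarrow> z i j \<noteq> 0"
    and U: "exceptional_uniformity n S t"
    and T: "\<And>i. i \<in> {1..n} \<Longrightarrow> compactin constructible_topology (S i)"
    and I: "pairwise independent_localities (\<Union>i\<in>{1..n}. S i)"
    and "\<And>j. j \<in> {1..m} \<Longrightarrow> g j \<in> ratfuns l"
    and "\<And>i v. i \<in> {1..n} \<Longrightarrow> v \<in> S i \<Longrightarrow>
           \<exists>x \<in> ratfun_domain l m g.
             \<forall>j\<in>{1..m}. ratfun_eval l (g j) x \<in> loc_ball v (y i j) (z i j)"
  shows "\<exists>x \<in> ratfun_domain l m g.
           \<forall>i\<in>{1..n}. \<forall>j\<in>{1..m}. \<forall>v \<in> S i.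
             ratfun_eval l (g j) x \<in> loc_ball v (y i j) (z i j)"
proof -
  define SS where "SS = (\<Union>i\<in>{1..n}. S i)"
  have SL': "SS \<subseteq> localities - {trivial_locality}" using assms(2) unfolding SS_def by blast
  then have SL: "SS \<subseteq> localities" by blast
  obtain f :: "'a poly" where deg: "2 \<le> degree f" and f_SS: "\<forall>v\<in>SS.
      (\<forall>x\<in>loc_O v. poly f x \<in> loc_O v) \<and>
      (\<forall>x. x \<notin> loc_O v \<longrightarrow>
        poly f x \<in> (x ^ degree f *o (loc_O v - t *o loc_m v)) \<inter>
          ((lead_coeff f * x ^ degree f) +o (x ^ (degree f - 1) *o loc_O v))) \<and>
      loc_O v + loc_O v \<subseteq> inverse t *o loc_O v"
    and f_infinite: "\<forall>i\<in>{1..n}. infinite (S i) \<longrightarrow> (\<forall>v\<in>S i. \<forall>x\<in>loc_O v. poly f x \<notin> (t *o loc_m v))"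
    using U unfolding exceptional_uniformity_def SS_def [symmetric] by (elim exE conjE) (rule that, simp_all only:)
  have f_O: "poly f x \<in> loc_O v" if "v \<in> SS" "x \<in> loc_O v" for v x
    using bspec [OF f_SS that(1)] that(2) by blast
  have f_not_O: "poly f x \<in> (x ^ degree f *o (loc_O v - t *o loc_m v))" if "v \<in> SS" "x \<notin> loc_O v" for v x
    using bspec [OF f_SS that(1)] that(2) by blast
  have O_add: "loc_O v + loc_O v \<subseteq> inverse t *o loc_O v" if "v \<in> SS" for v
    using bspec [OF f_SS that(1)] by blast
  have qv: "quasi_valuation (loc_le v) t" if v: "v \<in> SS" for v
  proof (rule quasi_valuation_loc_le)
    fix a b assume "a \<in> loc_O v" "b \<in> loc_O v"
    then have "a + b \<in> inverse t *o loc_O v" using O_add [OF v] set_plus_intro by blast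
    then obtain c where "c \<in> loc_O v" "a + b = inverse t * c" by (auto simp: elt_set_times_def)
    then show "t * (a + b) \<in> loc_O v" using assms(4) by (simp flip: mult.assoc)
  qed (use v SL assms(4) in auto)
  have "place_family loc_le SS t"
  proof (rule place_family.intro)
    fix v w :: "'a locality" and a :: 'a
    assume v: "v \<in> SS"
    then have vL: "v \<in> localities" "v \<noteq> trivial_locality" using SL' by auto
    from locality_nontrivial [OF this] show "\<exists>x. x \<noteq> 0 \<and> loc_less v x 1"
      by (simp add: loc_less_iff [OF vL(1)])
    assume "w \<in> SS" "v \<noteq> w" "a \<noteq> 0"
    then show "\<exists>x. x \<noteq> 0 \<and> loc_le w x a \<and> loc_le v 1 x"
      using v SL pairwiseD [OF I [folded SS_def], of v w] by (intro independent_localities_ex) auto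
  qed (rule qv)
  then interpret locality_family SS t
    by (rule locality_family.intro) (simp add: locality_family_axioms_def SL)
  define h k where "h = (\<lambda>j. fst (lowest_terms l (g j)))" and "k = (\<lambda>j. snd (lowest_terms l (g j)))"
  have hk: "h j \<in> mpolys l \<and> k j \<in> mpolys l" if "j \<in> {1..m}" for j
  proof -
    have "case lowest_terms l (g j) of (h, k) \<Rightarrow>
        h \<in> mpolys l \<and> k \<in> mpolys l \<and> k \<noteq> 0 \<and> g j = Fract h k \<and> mpoly_coprime l h k"
      unfolding lowest_terms_def
      by (rule someI_ex) (use ex_lowest_terms [OF assms(9) [OF that]] in auto)
    then show ?thesis by (auto simp: h_def k_def split: prod.splits)
  qed
  have eval: "ratfun_eval l (g j) x = mpoly_eval (h j) x / mpoly_eval (k j) x" for j x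
    by (simp add: ratfun_eval_def h_def k_def)
  have dom: "x \<in> ratfun_domain l m g \<longleftrightarrow> x \<in> {1..l} \<rightarrow>\<^sub>E UNIV \<and> (\<forall>j\<in>{1..m}. mpoly_eval (k j) x \<noteq> 0)" for x
    by (simp add: ratfun_domain_def k_def)
  define P where "P = (\<lambda>i v a N r. clopen N \<and> v \<in> N \<and> r \<noteq> 0 \<and>
      (\<forall>w\<in>N \<inter> SS. \<forall>x. (\<forall>c\<in>{1..l}. loc_less w (x c - a c) r) \<longrightarrow>
        (\<forall>j\<in>{1..m}. mpoly_eval (k j) x \<noteq> 0 \<and> mpoly_eval (h j) x / mpoly_eval (k j) x \<in> loc_ball w (y i j) (z i j))))"
  have "\<exists>a N r. P i v a N r"
    if i: "i \<in> {1..n}" and v: "v \<in> S i" for i v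
  proof -
    obtain a where a: "a \<in> ratfun_domain l m g"
      "\<And>j. j \<in> {1..m} \<Longrightarrow> ratfun_eval l (g j) a \<in> loc_ball v (y i j) (z i j)"
      using assms(10) [OF i v] by blast
    show ?thesis
      unfolding P_def using i v a hk assms(5) unfolding dom eval
      by (intro exI [of _ a] uniform_neighbourhood) (auto simp: SS_def)
  qed
  then have "\<exists>a N r. \<forall>i\<in>{1..n}. \<forall>v\<in>S i. P i v (a i v) (N i v) (r i v)" by metis
  then obtain a N r where aNr: "\<And>i v. i \<in> {1..n} \<Longrightarrow> v \<in> S i \<Longrightarrow> P i v (a i v) (N i v) (r i v)" by blast
  have N: "clopen (N i v)" "v \<in> N i v" and r: "r i v \<noteq> 0" if "i \<in> {1..n}" "v \<in> S i" for i v
    using aNr [OF that] by (simp_all add: P_def)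
  have a: "mpoly_eval (k j) x \<noteq> 0 \<and> mpoly_eval (h j) x / mpoly_eval (k j) x \<in> loc_ball w (y i j) (z i j)"
    if "i \<in> {1..n}" "v \<in> S i" "w \<in> N i v" "w \<in> SS"
      "\<And>c. c \<in> {1..l} \<Longrightarrow> loc_less w (x c - a i v c) (r i v)" "j \<in> {1..m}" for i v w x j
    using aNr [OF that(1,2)] that(3-6) unfolding P_def by blast
  have "\<exists>V. finite V \<and> V \<subseteq> S i \<and> S i \<subseteq> (\<Union>v\<in>V. N i v)" if i: "i \<in> {1..n}" for i
  proof -
    have "\<And>U. U \<in> N i ` S i \<Longrightarrow> openin constructible_topology U" using N(1) i by (auto simp: clopen_def)
    moreover have "S i \<subseteq> \<Union>(N i ` S i)" using N(2) i by blast
    ultimately obtain \<F> where \<F>: "finite \<F>" "\<F> \<subseteq> N i ` S i" "S i \<subseteq> \<Union>\<F>"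
      using compactinD [OF T [OF i]] by metis
    then show ?thesis using finite_subset_image [OF \<F>(1,2)] by metis
  qed
  then obtain V where V: "\<And>i. i \<in> {1..n} \<Longrightarrow> finite (V i)" "\<And>i. i \<in> {1..n} \<Longrightarrow> V i \<subseteq> S i"
    "\<And>i. i \<in> {1..n} \<Longrightarrow> S i \<subseteq> (\<Union>v\<in>V i. N i v)" by metis
  define sig where "sig = (\<lambda>i w. {v \<in> V i. w \<in> N i v})"
  \<comment> \<open>The empty pattern is left out: \<open>V i\<close> indexes a cover of
    \<open>S i\<close>, so it does not occur, and nonempty patterns supply a witness to
    approximate.\<close>
  define K where "K = (SIGMA i:{1..n}. Pow (V i) - {{}})"
  \<comment> \<open>Clopen pieces of \<open>S i\<close>: places with the same membership pattern in the finite cover.\<close>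
  define X where "X = (\<lambda>(i, \<sigma>). {w \<in> S i. sig i w = \<sigma>})"
  \<comment> \<open>All places of a piece with pattern \<sigma> lie in \<open>N i v\<close> for
    every v in \<sigma>, so the witness belonging to any such v serves the entire piece.\<close>
  define ctr where "ctr = (\<lambda>\<sigma>. SOME v :: 'a locality. v \<in> \<sigma>)"
  have ctr: "ctr \<sigma> \<in> \<sigma>" if "\<sigma> \<noteq> {}" for \<sigma> using that by (auto simp: ctr_def some_in_eq)
  have sigK: "(i, sig i w) \<in> K" if "i \<in> {1..n}" "w \<in> S i" for i w
    using V(3) [OF that(1)] that by (auto simp: K_def sig_def)
  \<comment> \<open>The coordinates are approximated one at a time, for every natural number
    \<open>c\<close>; the resulting sequence is restricted to the variables afterwards.\<close>
  have "\<exists>u. \<forall>q\<in>K. \<forall>w\<in>X q. loc_less w (u - a (fst q) (ctr (snd q)) c) (r (fst q) (ctr (snd q)))" for c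
  proof (rule approximation [of f])
    fix v x assume v: "v \<in> SS"
    then have vL: "v \<in> localities" using SL by blast
    interpret quasi_valuation "loc_le v" t by (rule qv [OF v])
    show "loc_le v (poly f x) 1" if "loc_le v x 1" using that f_O [OF v] vL by (simp add: loc_le_one)
    show "loc_le v (t * x\<^sup>2) (poly f x)" if x: "loc_less v 1 x"
    proof -
      have "x \<notin> loc_O v" using x vL by (simp add: loc_le_one)
      then obtain b where b: "b \<notin> t *o loc_m v" "poly f x = x ^ degree f * b"
        using f_not_O [OF v, of x] by (auto simp: elt_set_times_def)
      \<comment> \<open>Condition (iii) enters through the cofactor \<open>b\<close>: being outside
        t times the maximal ideal, it is at least \<open>t\<close>, and the remaining power of
        \<open>x\<close> is at least the square as the degree is at least 2.\<close>
      have "b / t \<notin> loc_m v" using b(1) assms(4) by (force simp: elt_set_times_def)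
      then have "loc_le v t b" using loc_less_iff [OF vL assms(4), of b] by blast
      moreover have "loc_le v (x\<^sup>2) (x ^ degree f)"
      proof -
        have "loc_le v (1 ^ (degree f - 2)) (x ^ (degree f - 2))" using power_mono less_imp_le [OF x] by blast
        then have "loc_le v (x\<^sup>2 * 1 ^ (degree f - 2)) (x\<^sup>2 * x ^ (degree f - 2))" by (rule mult_mono [OF refl])
        moreover have "x\<^sup>2 * x ^ (degree f - 2) = x ^ degree f" by (metis deg le_add_diff_inverse power_add)
        ultimately show ?thesis by simp
      qed
      ultimately have "loc_le v (t * x\<^sup>2) (b * x ^ degree f)" by (rule mult_mono)
      then show ?thesis by (simp add: b(2) mult.commute)
    qed
    show "\<exists>s. s \<noteq> 0 \<and> (\<forall>u. loc_less v u s \<longrightarrow> loc_less v (x + u) 1)" if x: "loc_less v x 1"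
    proof -
      have "x \<in> loc_m v" using x loc_less_iff [OF vL, of 1 x] by simp
      from loc_m_uniformly_open [OF vL this] obtain \<rho> where \<rho>: "\<rho> \<noteq> 0" "\<And>u. u \<in> loc_m v \<Longrightarrow> x + \<rho> * u \<in> loc_m v"
        by blast
      have "loc_less v (x + u) 1" if "loc_less v u \<rho>" for u
        using \<rho>(2) [of "u / \<rho>"] that \<rho>(1) loc_less_iff [OF vL, of \<rho> u] loc_less_iff [OF vL, of 1 "x + u"] by simp
      with \<rho>(1) show ?thesis by blast
    qed
  next
    show "finite K" unfolding K_def using V(1) by (intro finite_SigmaI) auto
    show "disjoint_family_on X K"
      using assms(3) by (fastforce simp: disjoint_family_on_def X_def K_def)
    show "SS = (\<Union>q\<in>K. X q)"
      using sigK by (fastforce simp: SS_def X_def K_def)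
  next
    fix q assume q: "q \<in> K"
    obtain i \<sigma> where [simp]: "q = (i, \<sigma>)" by (cases q)
    have i: "i \<in> {1..n}" and \<sigma>: "\<sigma> \<subseteq> V i" "\<sigma> \<noteq> {}" using q by (auto simp: K_def)
    have ctrS: "ctr \<sigma> \<in> S i" using ctr \<sigma> V(2) [OF i] by blast
    show "r (fst q) (ctr (snd q)) \<noteq> 0" using r i ctrS by simp
    \<comment> \<open>Prescribing the pattern means intersecting with finitely many clopen sets or
      their complements; so a piece is the intersection of the compact set \<open>S i\<close> with a
      closed set.\<close>
    define C where "C = (\<lambda>v. if v \<in> \<sigma> then N i v else localities - N i v)"
    have "X q = S i \<inter> (\<Inter>v\<in>V i. C v)"
    proof -
      have "sig i w = \<sigma> \<longleftrightarrow> (\<forall>v\<in>V i. w \<in> N i v \<longleftrightarrow> v \<in> \<sigma>)" for w using \<sigma>(1) unfolding sig_def by blast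
      moreover have "w \<in> C v \<longleftrightarrow> (w \<in> N i v \<longleftrightarrow> v \<in> \<sigma>)" if "w \<in> S i" for v w
        using that assms(2) [OF i] unfolding C_def by auto
      ultimately show ?thesis unfolding X_def by auto
    qed
    moreover have "closedin constructible_topology (\<Inter>v\<in>V i. C v)"
      using \<sigma> V(2) [OF i] N(1) [OF i] clopen_Diff by (intro closedin_INT) (auto simp: C_def clopen_def)
    ultimately have "compactin constructible_topology (X q)"
      using compact_Int_closedin [OF T [OF i]] by simp
    then show "qcompact (X q)" by (rule qcompact_compactin) (use i in \<open>auto simp: X_def SS_def\<close>)
    show "finite (X q) \<or> (\<forall>v\<in>X q. \<forall>x. loc_le v x 1 \<longrightarrow> loc_le v t (poly f x))"
    proof (cases "finite (S i)")
      case True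
      then show ?thesis by (simp add: X_def)
    next
      case False
      have "loc_le v t (poly f x)" if v: "v \<in> S i" and x: "loc_le v x 1" for v x
      proof -
        have vL: "v \<in> localities" using v assms(2) [OF i] by blast
        have "poly f x \<notin> t *o loc_m v" using f_infinite i False v x vL by (simp add: loc_le_one)
        then have "poly f x / t \<notin> loc_m v" using assms(4) by (force simp: elt_set_times_def)
        then show ?thesis using loc_less_iff [OF vL assms(4)] by blast
      qed
      then show ?thesis by (auto simp: X_def)
    qed
  qed
  then obtain u where u: "\<And>c q w. q \<in> K \<Longrightarrow> w \<in> X q \<Longrightarrow>
      loc_less w (u c - a (fst q) (ctr (snd q)) c) (r (fst q) (ctr (snd q)))" by metis
  define x where "x = restrict u {1..l}"
  have x: "mpoly_eval (k j) x \<noteq> 0 \<and> mpoly_eval (h j) x / mpoly_eval (k j) x \<in> loc_ball w (y i j) (z i j)"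
    if i: "i \<in> {1..n}" and w: "w \<in> S i" and j: "j \<in> {1..m}" for i w j
  proof -
    define v where "v = ctr (sig i w)"
    have "v \<in> sig i w" unfolding v_def by (rule ctr) (use sigK [OF i w] in \<open>auto simp: K_def\<close>)
    then have v: "v \<in> S i" "w \<in> N i v" using V(2) [OF i] by (auto simp: sig_def)
    have "loc_less w (u c - a i v c) (r i v)" for c
      using u [OF sigK [OF i w], of w c] w by (simp add: X_def v_def)
    then show ?thesis using i w j by (intro a [OF i v]) (auto simp: x_def SS_def)
  qed
  have "x \<in> ratfun_domain l m g"
  proof -
    \<comment> \<open>The denominators do not depend on a place, but their nonvanishing is read off
      at one; nonemptiness of \<open>S 1\<close> provides it.\<close>
    have "1 \<in> {1..n}" using assms(1) by simp
    moreover obtain w where "w \<in> S 1" using assms(2) [of 1] assms(1) by auto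
    ultimately have "\<forall>j\<in>{1..m}. mpoly_eval (k j) x \<noteq> 0" using x by blast
    then show ?thesis unfolding dom by (auto simp: x_def)
  qed
  moreover have "\<forall>i\<in>{1..n}. \<forall>j\<in>{1..m}. \<forall>v\<in>S i. ratfun_eval l (g j) x \<in> loc_ball v (y i j) (z i j)"
    unfolding eval using x by blast
  ultimately show ?thesis by blast
qed

end
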